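(* Let $(S,\omega,H)$ be a symplectic Hamiltonian system with a scaling symmetry $\phi:\mathbb{R}^\times\times S\to S$, let $\mathbf{p}_S:S\to C=S/\mathbb{R}^\times$ be the quotient map, and let $F:S\to\mathbb{R}^\times$ be a scaling function. Let $\eta$ be the induced contact $1$-form on $C$, $\mathcal{R}$ its Reeb vector field and $h_H:C\to\mathbb{R}$ the function with $h_H\circ\mathbf{p}_S=\frac1F H$. Let $x_0\in S$, $s_0=F(x_0)$, let $\Gamma:(-\epsilon,\epsilon)\to S$ be the integral curve of the Hamiltonian vector field $X_H^\omega$ with $\Gamma(0)=x_0$, and let $\gamma:(-\epsilon,\epsilon)\to C$ be the integral curve, with $\gamma(0)=\mathbf{p}_S(x_0)$, of the reduced vector field on $C$, i.e. of the $\mathbf{p}_S$-projection of $X_H^\omega$ (with $\epsilon>0$ small enough). Then $$(F,\mathbf{p}_S)(\Gamma(t))=\left(s_0\exp\left(-\int_0^t\mathcal{R}(h_H)(\gamma(s))\,ds\right),\ \gamma(t)\right)\qquad\text{for all } t\in(-\epsilon,\epsilon),$$ where $(F,\mathbf{p}_S):S\to\mathbb{R}^\times\times C$ is a diffeomorphism.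
   Context: Everything is smooth. $\mathbb{R}^\times$ denotes either the multiplicative group $\mathbb{R}^+$ or $\mathbb{R}\setminus\{0\}$. A scaling symmetry for a symplectic Hamiltonian system $(S,\omega,H)$ (a symplectic manifold with a function $H:S\to\mathbb{R}$) is a principal action $\phi:\mathbb{R}^\times\times S\to S$ (free and proper, so that $\mathbf{p}_S$ is a principal bundle) with $\phi_s^*\omega=s\omega$ and $H\circ\phi_s=sH$ for all $s\in\mathbb{R}^\times$; $\Delta$ is its infinitesimal generator and $\lambda=-i_\Delta\omega$, so $\omega=-d\lambda$. A scaling function is a non-vanishing homogeneous function $F:S\to\mathbb{R}^\times$, i.e. $F\circ\phi_s=sF$ for all $s\in\mathbb{R}^\times$. The Hamiltonian vector field $X_H^\omega$ is given by $i_{X_H^\omega}\omega=dH$; it is $\mathbf{p}_S$-projectable. The contact $1$-form $\eta$ on $C$ is the one characterized by $\mathbf{p}_S^*\eta=\frac1F\lambda$. Its Reeb vector field $\mathcal{R}$ is characterized by $i_{\mathcal{R}}d\eta=0$ and $\eta(\mathcal{R})=1$. *)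

theory Defs
  imports "HOL-Analysis.Analysis"
begin

section \<open>Smooth maps between open subsets of normed spaces\<close>

text \<open>\<open>Ck_on k U f\<close>: \<open>f\<close> is \<open>k\<close> times continuously differentiable on the open set \<open>U\<close>; in finite
  dimension it is enough to iterate the directional derivatives in all constant directions.\<close>

primrec Ck_on :: "nat \<Rightarrow> 'e::real_normed_vector set \<Rightarrow> ('e \<Rightarrow> 'f::real_normed_vector) \<Rightarrow> bool" where
  "Ck_on 0 U f \<longleftrightarrow> continuous_on U f"
| "Ck_on (Suc k) U f \<longleftrightarrow>
     (\<forall>y\<in>U. f differentiable (at y)) \<and> (\<forall>v. Ck_on k U (\<lambda>y. frechet_derivative f (at y) v))"

definition smooth_on :: "'e::real_normed_vector set \<Rightarrow> ('e \<Rightarrow> 'f::real_normed_vector) \<Rightarrow> bool" where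
  "smooth_on U f \<longleftrightarrow> (\<forall>k. Ck_on k U f)"


section \<open>Smooth manifolds\<close>

text \<open>A chart is a pair \<open>(U, \<psi>)\<close>, and only the values of \<open>\<psi>\<close> on \<open>U\<close> matter. Manifolds are given by
  a (not necessarily maximal) smooth atlas; the dimension is that of the model space \<open>'e\<close>.\<close>

type_synonym ('a, 'e) chart = "'a set \<times> ('a \<Rightarrow> 'e)"

record ('a, 'e) mfd =
  mtop :: "'a topology"
  atlas :: "('a, 'e) chart set"

abbreviation pts :: "('a, 'e) mfd \<Rightarrow> 'a set" where
  "pts M \<equiv> topspace (mtop M)"

definition chart_inv :: "('a, 'e) chart \<Rightarrow> 'e \<Rightarrow> 'a" where
  "chart_inv c = inv_into (fst c) (snd c)"

definition is_chart :: "'a topology \<Rightarrow> ('a, 'e::euclidean_space) chart \<Rightarrow> bool" where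
  "is_chart T c \<longleftrightarrow>
     openin T (fst c) \<and> open (snd c ` fst c) \<and>
     homeomorphic_map (subtopology T (fst c)) (top_of_set (snd c ` fst c)) (snd c)"

definition smooth_manifold :: "('a, 'e::euclidean_space) mfd \<Rightarrow> bool" where
  "smooth_manifold M \<longleftrightarrow>
     Hausdorff_space (mtop M) \<and> second_countable (mtop M) \<and>
     (\<forall>c\<in>atlas M. is_chart (mtop M) c) \<and>
     (\<Union>c\<in>atlas M. fst c) = pts M \<and>
     (\<forall>c\<in>atlas M. \<forall>d\<in>atlas M. smooth_on (snd c ` (fst c \<inter> fst d)) (snd d \<circ> chart_inv c))"

definition open_mfd :: "'e::euclidean_space set \<Rightarrow> ('e, 'e) mfd" where
  "open_mfd U = \<lparr>mtop = top_of_set U, atlas = {(U, id)}\<rparr>"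

definition prod_mfd ::
    "('a, 'e::euclidean_space) mfd \<Rightarrow> ('b, 'f::euclidean_space) mfd \<Rightarrow> ('a \<times> 'b, 'e \<times> 'f) mfd" where
  "prod_mfd M N =
     \<lparr>mtop = prod_topology (mtop M) (mtop N),
      atlas = {(fst c \<times> fst d, map_prod (snd c) (snd d)) | c d. c \<in> atlas M \<and> d \<in> atlas N}\<rparr>"

definition smooth_map ::
    "('a, 'e::euclidean_space) mfd \<Rightarrow> ('b, 'f::euclidean_space) mfd \<Rightarrow> ('a \<Rightarrow> 'b) \<Rightarrow> bool" where
  "smooth_map M N f \<longleftrightarrow>
     continuous_map (mtop M) (mtop N) f \<and>
     (\<forall>c\<in>atlas M. \<forall>d\<in>atlas N.
        smooth_on (snd c ` {x\<in>fst c. f x \<in> fst d}) (snd d \<circ> f \<circ> chart_inv c))"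

abbreviation smooth_fun :: "('a, 'e::euclidean_space) mfd \<Rightarrow> ('a \<Rightarrow> real) \<Rightarrow> bool" where
  "smooth_fun M f \<equiv> smooth_map M (open_mfd UNIV) f"

definition diffeomorphism ::
    "('a, 'e::euclidean_space) mfd \<Rightarrow> ('b, 'f::euclidean_space) mfd \<Rightarrow> ('a \<Rightarrow> 'b) \<Rightarrow> bool" where
  "diffeomorphism M N f \<longleftrightarrow>
     bij_betw f (pts M) (pts N) \<and> smooth_map M N f \<and> smooth_map N M (inv_into (pts M) f)"


section \<open>Tangent vectors and vector fields\<close>

text \<open>A tangent vector at \<open>x\<close> is the family of its coordinate vectors in all charts around \<open>x\<close>,
  subject to the usual transformation law. For other charts the entry is 0, so that equality of
  tangent vectors is equality in HOL.\<close>

type_synonym ('a, 'e) tvec = "('a, 'e) chart \<Rightarrow> 'e"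

definition charts_at :: "('a, 'e) mfd \<Rightarrow> 'a \<Rightarrow> ('a, 'e) chart set" where
  "charts_at M x = {c\<in>atlas M. x \<in> fst c}"

definition tangent_space :: "('a, 'e::euclidean_space) mfd \<Rightarrow> 'a \<Rightarrow> ('a, 'e) tvec set" where
  "tangent_space M x =
     {v. (\<forall>c\<in>charts_at M x. \<forall>d\<in>charts_at M x.
            v d = frechet_derivative (snd d \<circ> chart_inv c) (at (snd c x)) (v c)) \<and>
         (\<forall>c. c \<notin> charts_at M x \<longrightarrow> v c = 0)}"

text \<open>The tangent vector at \<open>x\<close> with coordinates \<open>e\<close> in the chart \<open>c\<close>.\<close>

definition tvec_of :: "('a, 'e::euclidean_space) mfd \<Rightarrow> ('a, 'e) chart \<Rightarrow> 'a \<Rightarrow> 'e \<Rightarrow> ('a, 'e) tvec" where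
  "tvec_of M c x e =
     (\<lambda>d. if d \<in> charts_at M x
          then frechet_derivative (snd d \<circ> chart_inv c) (at (snd c x)) e else 0)"

text \<open>Below, objects which do not depend on the chart used to compute them (differentials,
  tangent maps, exterior derivatives) are computed in this chart.\<close>

definition chart_at :: "('a, 'e) mfd \<Rightarrow> 'a \<Rightarrow> ('a, 'e) chart" where
  "chart_at M x = (SOME c. c \<in> charts_at M x)"

definition tangent_map ::
    "('a, 'e::euclidean_space) mfd \<Rightarrow> ('b, 'f::euclidean_space) mfd \<Rightarrow> ('a \<Rightarrow> 'b) \<Rightarrow> 'a
       \<Rightarrow> ('a, 'e) tvec \<Rightarrow> ('b, 'f) tvec" where
  "tangent_map M N f x v =
     (let c = chart_at M x in
       (\<lambda>d. if d \<in> charts_at N (f x)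
            then frechet_derivative (snd d \<circ> f \<circ> chart_inv c) (at (snd c x)) (v c) else 0))"

definition velocity :: "('a, 'e::euclidean_space) mfd \<Rightarrow> (real \<Rightarrow> 'a) \<Rightarrow> real \<Rightarrow> ('a, 'e) tvec" where
  "velocity M g t =
     (\<lambda>d. if d \<in> charts_at M (g t) then vector_derivative (snd d \<circ> g) (at t) else 0)"

definition submersion ::
    "('a, 'e::euclidean_space) mfd \<Rightarrow> ('b, 'f::euclidean_space) mfd \<Rightarrow> ('a \<Rightarrow> 'b) \<Rightarrow> bool" where
  "submersion M N f \<longleftrightarrow>
     smooth_map M N f \<and>
     (\<forall>x\<in>pts M. tangent_map M N f x ` tangent_space M x = tangent_space N (f x))"

definition vector_field ::
    "('a, 'e::euclidean_space) mfd \<Rightarrow> ('a \<Rightarrow> ('a, 'e) tvec) \<Rightarrow> bool" where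
  "vector_field M X \<longleftrightarrow>
     (\<forall>x\<in>pts M. X x \<in> tangent_space M x) \<and>
     (\<forall>c\<in>atlas M. smooth_on (snd c ` fst c) (\<lambda>y. X (chart_inv c y) c))"

text \<open>\<open>I\<close> is an open interval.\<close>

definition integral_curve ::
    "('a, 'e::euclidean_space) mfd \<Rightarrow> ('a \<Rightarrow> ('a, 'e) tvec) \<Rightarrow> real set \<Rightarrow> (real \<Rightarrow> 'a) \<Rightarrow> bool" where
  "integral_curve M X I g \<longleftrightarrow>
     smooth_map (open_mfd I) M g \<and> (\<forall>t\<in>I. velocity M g t = X (g t))"

definition projects_to ::
    "('a, 'e::euclidean_space) mfd \<Rightarrow> ('b, 'f::euclidean_space) mfd \<Rightarrow> ('a \<Rightarrow> 'b)
       \<Rightarrow> ('a \<Rightarrow> ('a, 'e) tvec) \<Rightarrow> ('b \<Rightarrow> ('b, 'f) tvec) \<Rightarrow> bool" where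
  "projects_to M N f X Y \<longleftrightarrow> (\<forall>x\<in>pts M. tangent_map M N f x (X x) = Y (f x))"


section \<open>Differential forms of degree at most two\<close>

type_synonym ('a, 'e) form1 = "'a \<Rightarrow> ('a, 'e) tvec \<Rightarrow> real"
type_synonym ('a, 'e) form2 = "'a \<Rightarrow> ('a, 'e) tvec \<Rightarrow> ('a, 'e) tvec \<Rightarrow> real"

definition linear_form :: "('a, 'e::euclidean_space) tvec set \<Rightarrow> (('a, 'e) tvec \<Rightarrow> real) \<Rightarrow> bool" where
  "linear_form V l \<longleftrightarrow>
     (\<forall>u\<in>V. \<forall>v\<in>V. \<forall>a b. l (\<lambda>c. a *\<^sub>R u c + b *\<^sub>R v c) = a * l u + b * l v)"

definition one_form :: "('a, 'e::euclidean_space) mfd \<Rightarrow> ('a, 'e) form1 \<Rightarrow> bool" where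
  "one_form M \<alpha> \<longleftrightarrow>
     (\<forall>x\<in>pts M. linear_form (tangent_space M x) (\<alpha> x)) \<and>
     (\<forall>c\<in>atlas M. \<forall>e. smooth_on (snd c ` fst c)
        (\<lambda>y. \<alpha> (chart_inv c y) (tvec_of M c (chart_inv c y) e)))"

definition two_form :: "('a, 'e::euclidean_space) mfd \<Rightarrow> ('a, 'e) form2 \<Rightarrow> bool" where
  "two_form M \<beta> \<longleftrightarrow>
     (\<forall>x\<in>pts M. \<forall>u\<in>tangent_space M x.
        linear_form (tangent_space M x) (\<beta> x u) \<and>
        (\<forall>v\<in>tangent_space M x. \<beta> x u v = - \<beta> x v u)) \<and>
     (\<forall>c\<in>atlas M. \<forall>e e'. smooth_on (snd c ` fst c)
        (\<lambda>y. \<beta> (chart_inv c y) (tvec_of M c (chart_inv c y) e) (tvec_of M c (chart_inv c y) e')))"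

text \<open>\<open>df\<close>; in particular \<open>differential M f x (X x)\<close> is the value at \<open>x\<close> of \<open>X(f)\<close>.\<close>

definition differential :: "('a, 'e::euclidean_space) mfd \<Rightarrow> ('a \<Rightarrow> real) \<Rightarrow> ('a, 'e) form1" where
  "differential M f x v =
     (let c = chart_at M x in frechet_derivative (f \<circ> chart_inv c) (at (snd c x)) (v c))"

text \<open>The exterior derivatives follow the formula
  \<open>d\<alpha>(v\<^sub>0, \<dots>, v\<^sub>k) = \<Sum>i. (-1)\<^sup>i D\<^bsub>v\<^sub>i\<^esub> \<alpha>(v\<^sub>0, \<dots>, v\<^sub>i omitted, \<dots>, v\<^sub>k)\<close>
  for vectors extended constantly in a chart (so there is no factor \<open>1/(k+1)\<close>).\<close>

definition ext_deriv1 :: "('a, 'e::euclidean_space) mfd \<Rightarrow> ('a, 'e) form1 \<Rightarrow> ('a, 'e) form2" where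
  "ext_deriv1 M \<alpha> x u v =
     (let c = chart_at M x;
          a = (\<lambda>e y. \<alpha> (chart_inv c y) (tvec_of M c (chart_inv c y) e));
          D = (\<lambda>e f. frechet_derivative f (at (snd c x)) e)
      in D (u c) (a (v c)) - D (v c) (a (u c)))"

definition ext_deriv2 ::
    "('a, 'e::euclidean_space) mfd \<Rightarrow> ('a, 'e) form2
       \<Rightarrow> 'a \<Rightarrow> ('a, 'e) tvec \<Rightarrow> ('a, 'e) tvec \<Rightarrow> ('a, 'e) tvec \<Rightarrow> real" where
  "ext_deriv2 M \<beta> x u v w =
     (let c = chart_at M x;
          b = (\<lambda>e e' y. \<beta> (chart_inv c y) (tvec_of M c (chart_inv c y) e)
                                       (tvec_of M c (chart_inv c y) e'));
          D = (\<lambda>e f. frechet_derivative f (at (snd c x)) e)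
      in D (u c) (b (v c) (w c)) - D (v c) (b (u c) (w c)) + D (w c) (b (u c) (v c)))"

definition pullback1 ::
    "('a, 'e::euclidean_space) mfd \<Rightarrow> ('b, 'f::euclidean_space) mfd \<Rightarrow> ('a \<Rightarrow> 'b)
       \<Rightarrow> ('b, 'f) form1 \<Rightarrow> ('a, 'e) form1" where
  "pullback1 M N f \<alpha> x v = \<alpha> (f x) (tangent_map M N f x v)"

definition pullback2 ::
    "('a, 'e::euclidean_space) mfd \<Rightarrow> ('b, 'f::euclidean_space) mfd \<Rightarrow> ('a \<Rightarrow> 'b)
       \<Rightarrow> ('b, 'f) form2 \<Rightarrow> ('a, 'e) form2" where
  "pullback2 M N f \<beta> x u v = \<beta> (f x) (tangent_map M N f x u) (tangent_map M N f x v)"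

definition contraction :: "('a \<Rightarrow> ('a, 'e) tvec) \<Rightarrow> ('a, 'e) form2 \<Rightarrow> ('a, 'e) form1" where
  "contraction X \<beta> x v = \<beta> x (X x) v"


section \<open>Symplectic Hamiltonian systems with scaling symmetry\<close>

definition symplectic_form :: "('a, 'e::euclidean_space) mfd \<Rightarrow> ('a, 'e) form2 \<Rightarrow> bool" where
  "symplectic_form S \<omega> \<longleftrightarrow>
     two_form S \<omega> \<and>
     (\<forall>x\<in>pts S. \<forall>u\<in>tangent_space S x. \<forall>v\<in>tangent_space S x. \<forall>w\<in>tangent_space S x.
        ext_deriv2 S \<omega> x u v w = 0) \<and>
     (\<forall>x\<in>pts S. \<forall>u\<in>tangent_space S x.
        (\<forall>v\<in>tangent_space S x. \<omega> x u v = 0) \<longrightarrow> u = (\<lambda>c. 0))"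

definition symplectic_Hamiltonian_system ::
    "('a, 'e::euclidean_space) mfd \<Rightarrow> ('a, 'e) form2 \<Rightarrow> ('a \<Rightarrow> real) \<Rightarrow> bool" where
  "symplectic_Hamiltonian_system S \<omega> H \<longleftrightarrow>
     smooth_manifold S \<and> symplectic_form S \<omega> \<and> smooth_fun S H"

definition Hamiltonian_vector_field ::
    "('a, 'e::euclidean_space) mfd \<Rightarrow> ('a, 'e) form2 \<Rightarrow> ('a \<Rightarrow> real) \<Rightarrow> ('a \<Rightarrow> ('a, 'e) tvec) \<Rightarrow> bool" where
  "Hamiltonian_vector_field S \<omega> H X \<longleftrightarrow>
     vector_field S X \<and>
     (\<forall>x\<in>pts S. \<forall>v\<in>tangent_space S x. contraction X \<omega> x v = differential S H x v)"

text \<open>The two multiplicative groups meant by \<open>\<real>\<^sup>\<times>\<close>.\<close>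

definition scaling_group :: "real set \<Rightarrow> bool" where
  "scaling_group G \<longleftrightarrow> G = {0<..} \<or> G = - {0}"

definition principal_action ::
    "real set \<Rightarrow> ('a, 'e::euclidean_space) mfd \<Rightarrow> (real \<Rightarrow> 'a \<Rightarrow> 'a) \<Rightarrow> bool" where
  "principal_action G S \<phi> \<longleftrightarrow>
     smooth_map (prod_mfd (open_mfd G) S) S (\<lambda>(s, x). \<phi> s x) \<and>
     (\<forall>x\<in>pts S. \<phi> 1 x = x) \<and>
     (\<forall>s\<in>G. \<forall>r\<in>G. \<forall>x\<in>pts S. \<phi> (s * r) x = \<phi> s (\<phi> r x)) \<and>
     (\<forall>s\<in>G. \<forall>x\<in>pts S. \<phi> s x = x \<longrightarrow> s = 1) \<and>
     proper_map (prod_topology (top_of_set G) (mtop S)) (prod_topology (mtop S) (mtop S))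
       (\<lambda>(s, x). (\<phi> s x, x))"

definition scaling_symmetry ::
    "real set \<Rightarrow> ('a, 'e::euclidean_space) mfd \<Rightarrow> ('a, 'e) form2 \<Rightarrow> ('a \<Rightarrow> real)
       \<Rightarrow> (real \<Rightarrow> 'a \<Rightarrow> 'a) \<Rightarrow> bool" where
  "scaling_symmetry G S \<omega> H \<phi> \<longleftrightarrow>
     principal_action G S \<phi> \<and>
     (\<forall>s\<in>G. \<forall>x\<in>pts S. \<forall>u\<in>tangent_space S x. \<forall>v\<in>tangent_space S x.
        pullback2 S S (\<phi> s) \<omega> x u v = s * \<omega> x u v) \<and>
     (\<forall>s\<in>G. \<forall>x\<in>pts S. H (\<phi> s x) = s * H x)"

definition scaling_function ::
    "real set \<Rightarrow> ('a, 'e::euclidean_space) mfd \<Rightarrow> (real \<Rightarrow> 'a \<Rightarrow> 'a) \<Rightarrow> ('a \<Rightarrow> real) \<Rightarrow> bool" where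
  "scaling_function G S \<phi> F \<longleftrightarrow>
     smooth_map S (open_mfd G) F \<and> (\<forall>s\<in>G. \<forall>x\<in>pts S. F (\<phi> s x) = s * F x)"

text \<open>\<open>\<Delta>\<close>; the unit of the group is \<open>s = 1\<close>.\<close>

definition generator :: "('a, 'e::euclidean_space) mfd \<Rightarrow> (real \<Rightarrow> 'a \<Rightarrow> 'a) \<Rightarrow> 'a \<Rightarrow> ('a, 'e) tvec" where
  "generator S \<phi> x = velocity S (\<lambda>s. \<phi> s x) 1"

definition liouville_form ::
    "('a, 'e::euclidean_space) mfd \<Rightarrow> ('a, 'e) form2 \<Rightarrow> (real \<Rightarrow> 'a \<Rightarrow> 'a) \<Rightarrow> ('a, 'e) form1" where
  "liouville_form S \<omega> \<phi> x v = - contraction (generator S \<phi>) \<omega> x v"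

text \<open>The quotient map sends a point to its orbit.\<close>

definition quot_map :: "real set \<Rightarrow> (real \<Rightarrow> 'a \<Rightarrow> 'a) \<Rightarrow> 'a \<Rightarrow> 'a set" where
  "quot_map G \<phi> x = (\<lambda>s. \<phi> s x) ` G"

text \<open>The orbit space with its quotient manifold structure, i.e. the unique smooth structure for
  which the quotient map is a submersion.\<close>

definition quotient_manifold ::
    "real set \<Rightarrow> ('a, 'e::euclidean_space) mfd \<Rightarrow> (real \<Rightarrow> 'a \<Rightarrow> 'a)
       \<Rightarrow> ('a set, 'f::euclidean_space) mfd \<Rightarrow> bool" where
  "quotient_manifold G S \<phi> C \<longleftrightarrow>
     smooth_manifold C \<and> pts C = quot_map G \<phi> ` pts S \<and> submersion S C (quot_map G \<phi>)"

definition induced_contact_form ::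
    "real set \<Rightarrow> ('a, 'e::euclidean_space) mfd \<Rightarrow> ('a, 'e) form2 \<Rightarrow> (real \<Rightarrow> 'a \<Rightarrow> 'a)
       \<Rightarrow> ('a \<Rightarrow> real) \<Rightarrow> ('a set, 'f::euclidean_space) mfd \<Rightarrow> ('a set, 'f) form1 \<Rightarrow> bool" where
  "induced_contact_form G S \<omega> \<phi> F C \<eta> \<longleftrightarrow>
     one_form C \<eta> \<and>
     (\<forall>x\<in>pts S. \<forall>v\<in>tangent_space S x.
        pullback1 S C (quot_map G \<phi>) \<eta> x v = 1 / F x * liouville_form S \<omega> \<phi> x v)"

definition Reeb_vector_field ::
    "('b, 'f::euclidean_space) mfd \<Rightarrow> ('b, 'f) form1 \<Rightarrow> ('b \<Rightarrow> ('b, 'f) tvec) \<Rightarrow> bool" where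
  "Reeb_vector_field C \<eta> R \<longleftrightarrow>
     vector_field C R \<and>
     (\<forall>y\<in>pts C. (\<forall>v\<in>tangent_space C y. contraction R (ext_deriv1 C \<eta>) y v = 0) \<and> \<eta> y (R y) = 1)"

end

theory Submission
  imports Defs
begin

text \<open>Along an orbit of the scaling action \<open>F\<close> takes each value of the group exactly once, so
  \<open>(F, p)\<close>, where \<open>p\<close> is the quotient map, is a bijection onto \<open>G \<times> C\<close>. Its inverse is smooth because it can be written
  \<open>(s, y) \<mapsto> \<phi> (s / F (\<sigma> y)) (\<sigma> y)\<close> near any point, where \<open>\<sigma>\<close> is a smooth local section of the
  submersion \<open>p\<close>; such sections come from the inverse function theorem
  (\<open>smooth_local_section\<close>, \<open>triv_in_charts\<close>, \<open>trivialisation\<close>).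

  The trivialisation turns the symplectic form into \<open>\<omega> = - ds \<and> \<eta> - s d\<eta>\<close>. The coefficient of
  \<open>ds\<close> is the definition of \<open>\<eta>\<close>, because the generator of the action is \<open>s \<partial>\<^sub>s\<close> (\<open>P_vertical\<close>).
  The restriction of \<open>\<omega>\<close> to the slices \<open>s = const\<close> is linear in \<open>s\<close> by the scaling symmetry
  (\<open>P_homogeneous\<close>), so its \<open>s\<close>-derivative is the restriction divided by \<open>s\<close>, and closedness of
  \<open>\<omega>\<close> equates that derivative with \<open>- d\<eta>\<close> (\<open>P_horizontal\<close>). That closedness may be tested in
  the new coordinates rests on the symmetry of second derivatives (\<open>closed_two_form_pullback\<close>).

  Now write \<open>X\<close> as \<open>a \<partial>\<^sub>s + Y\<close>, with \<open>a = dF(X)\<close>, and pair it with the lift \<open>(0, R)\<close> of the Reeb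
  field. Since \<open>\<eta>(R) = 1\<close> and \<open>i\<^sub>R d\<eta> = 0\<close> the form gives \<open>- a\<close>, while \<open>H = s h\<close> shows that
  \<open>dH\<close> gives \<open>s R(h)\<close>. Hence \<open>dF(X) = - F R(h)\<close> (\<open>F_derivative_along_X\<close>). So \<open>F \<circ> \<Gamma>\<close> solves a
  scalar linear equation, whose solution is the exponential in the theorem
  (\<open>F_along_\<Gamma>_eq\<close>), and \<open>p \<circ> \<Gamma>\<close> is an integral curve of \<open>Y\<close>, equal to \<open>\<gamma>\<close> by uniqueness on the
  Hausdorff manifold \<open>C\<close> (\<open>projected_curve\<close>).\<close>

section \<open>Calculus of smooth maps between open sets\<close>

lemma Ck_on_cong:
  assumes "open U" "Ck_on k U f" "\<And>y. y \<in> U \<Longrightarrow> f y = g y"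
  shows "Ck_on k U g"
  using assms(2,3)
proof (induction k arbitrary: f g)
  case 0
  then show ?case by (simp cong: continuous_on_cong)
next
  case (Suc k)
  have der: "(g has_derivative frechet_derivative f (at y)) (at y)" if "y \<in> U" for y
  proof (rule has_derivative_transform_within_open[OF _ \<open>open U\<close> that Suc.prems(2)])
    show "(f has_derivative frechet_derivative f (at y)) (at y)"
      using Suc.prems(1) that by (simp add: frechet_derivative_works[symmetric])
  qed
  have "Ck_on k U (\<lambda>y. frechet_derivative g (at y) v)" for v
  proof (rule Suc.IH)
    show "Ck_on k U (\<lambda>y. frechet_derivative f (at y) v)"
      using Suc.prems(1) by simp
    show "frechet_derivative f (at y) v = frechet_derivative g (at y) v" if "y \<in> U" for y
      by (rule arg_cong[OF frechet_derivative_at[OF der[OF that]]])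
  qed
  moreover have "g differentiable at y" if "y \<in> U" for y
    using der[OF that] by (rule differentiableI)
  ultimately show ?case by simp
qed

lemma Ck_on_SucI:
  assumes "open U" "\<And>y. y \<in> U \<Longrightarrow> (f has_derivative f' y) (at y)" "\<And>v. Ck_on k U (\<lambda>y. f' y v)"
  shows "Ck_on (Suc k) U f"
proof -
  have "frechet_derivative f (at y) = f' y" if "y \<in> U" for y
    using frechet_derivative_at[OF assms(2)[OF that]] by simp
  then have "Ck_on k U (\<lambda>y. frechet_derivative f (at y) v)" for v
    by (intro Ck_on_cong[OF assms(1) assms(3)[of v]]) simp
  then show ?thesis
    using assms(2) by (auto simp: differentiable_def)
qed

lemma Ck_on_imp_continuous: "Ck_on k U f \<Longrightarrow> continuous_on U f"
  by (cases k)
    (auto intro!: continuous_at_imp_continuous_on differentiable_imp_continuous_within)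

lemma Ck_on_SucD: "Ck_on (Suc k) U f \<Longrightarrow> Ck_on k U f"
proof (induction k arbitrary: f)
  case 0
  then have "continuous_on U f" by (rule Ck_on_imp_continuous)
  then show ?case by simp
next
  case (Suc k)
  then show ?case by (metis Ck_on.simps(2))
qed

lemma Ck_on_subset: "Ck_on k U f \<Longrightarrow> V \<subseteq> U \<Longrightarrow> Ck_on k V f"
  by (induction k arbitrary: f) (auto intro: continuous_on_subset)

lemma Ck_on_locally:
  assumes "\<And>x. x \<in> U \<Longrightarrow> \<exists>V. open V \<and> x \<in> V \<and> Ck_on k V f"
  shows "Ck_on k U f"
  using assms
proof (induction k arbitrary: f)
  case 0
  then show ?case
    by (metis Ck_on.simps(1) continuous_at_imp_continuous_on continuous_on_eq_continuous_at)
next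
  case (Suc k)
  have "f differentiable at y" if "y \<in> U" for y
    using Suc.prems[OF that] by auto
  moreover have "Ck_on k U (\<lambda>y. frechet_derivative f (at y) v)" for v
    by (rule Suc.IH) (use Suc.prems in force)
  ultimately show ?case by simp
qed

lemma Ck_on_const: "Ck_on k U (\<lambda>x. c)"
  by (induction k arbitrary: c) auto

lemma Ck_on_ident: "Ck_on k U (\<lambda>x. x)"
  by (cases k) (auto intro: Ck_on_const)

lemma Ck_on_has_derivative:
  "Ck_on (Suc k) U f \<Longrightarrow> x \<in> U \<Longrightarrow> (f has_derivative frechet_derivative f (at x)) (at x)"
  by (simp add: frechet_derivative_works[symmetric])

lemma Ck_on_linear_image:
  assumes "open U" "bounded_linear A" "Ck_on k U f"
  shows "Ck_on k U (\<lambda>x. A (f x))"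
  using assms(3)
proof (induction k arbitrary: f)
  case 0
  then show ?case
    using assms by (auto intro: bounded_linear.continuous_on)
next
  case (Suc k)
  show ?case
    by (rule Ck_on_SucI[OF \<open>open U\<close> bounded_linear.has_derivative[OF assms(2)
            Ck_on_has_derivative[OF Suc.prems]]])
      (use Suc in auto)
qed

lemma Ck_on_add:
  assumes "open U" "Ck_on k U f" "Ck_on k U g"
  shows "Ck_on k U (\<lambda>x. f x + g x)"
  using assms(2,3)
proof (induction k arbitrary: f g)
  case 0
  then show ?case by (auto intro: continuous_on_add)
next
  case (Suc k)
  show ?case
    by (rule Ck_on_SucI[OF \<open>open U\<close> has_derivative_add[OF Ck_on_has_derivative[OF Suc.prems(1)]
            Ck_on_has_derivative[OF Suc.prems(2)]]])
      (use Suc in auto)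
qed

lemma Ck_on_sum:
  assumes "open U" "\<And>i. i \<in> I \<Longrightarrow> Ck_on k U (f i)"
  shows "Ck_on k U (\<lambda>x. \<Sum>i\<in>I. f i x)"
  using assms(2)
  by (induction I rule: infinite_finite_induct) (auto intro: Ck_on_const Ck_on_add[OF assms(1)])

lemma Ck_on_bilinear:
  assumes "open U" "bounded_bilinear B" "Ck_on k U f" "Ck_on k U g"
  shows "Ck_on k U (\<lambda>x. B (f x) (g x))"
  using assms(3,4)
proof (induction k arbitrary: f g)
  case 0
  then show ?case using assms(2) by (auto intro: bounded_bilinear.continuous_on)
next
  case (Suc k)
  note lower = Ck_on_SucD[OF Suc.prems(1)] Ck_on_SucD[OF Suc.prems(2)]
  show ?case
    by (rule Ck_on_SucI[OF \<open>open U\<close> bounded_bilinear.FDERIV[OF assms(2)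
          Ck_on_has_derivative[OF Suc.prems(1)] Ck_on_has_derivative[OF Suc.prems(2)]]])
      (use Suc lower in \<open>auto intro!: Ck_on_add[OF \<open>open U\<close>] Suc.IH\<close>)
qed

lemma linear_eq_sum_Basis:
  fixes A :: "'e::euclidean_space \<Rightarrow> 'f::real_vector"
  assumes "linear A"
  shows "A v = (\<Sum>b\<in>Basis. (v \<bullet> b) *\<^sub>R A b)"
  by (metis (no_types, lifting) assms euclidean_representation linear_cmul linear_sum sum.cong)

text \<open>In finite dimension the chain rule is a finite sum of products of iterated directional
  derivatives, which is what makes the induction on the order of differentiability close.\<close>

lemma Ck_on_compose:
  fixes f :: "'d::real_normed_vector \<Rightarrow> 'e::euclidean_space" and g :: "'e \<Rightarrow> 'f::real_normed_vector"
  assumes "open U" "open V" "f ` U \<subseteq> V" "Ck_on k U f" "Ck_on k V g"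
  shows "Ck_on k U (\<lambda>x. g (f x))"
  using assms(4,5)
proof (induction k arbitrary: g)
  case 0
  then show ?case using assms(3) by (auto intro: continuous_on_compose2)
next
  case (Suc k)
  show ?case
  proof (rule Ck_on_SucI[OF \<open>open U\<close> _])
    fix y assume y: "y \<in> U"
    then have g: "(g has_derivative frechet_derivative g (at (f y))) (at (f y))"
      using Suc.prems assms(3) by (intro Ck_on_has_derivative) auto
    have "((\<lambda>x. g (f x)) has_derivative
         (\<lambda>v. frechet_derivative g (at (f y)) (frechet_derivative f (at y) v))) (at y)"
      by (rule has_derivative_compose[OF Ck_on_has_derivative[OF Suc.prems(1) y] g])
    moreover have "(\<lambda>v. frechet_derivative g (at (f y)) (frechet_derivative f (at y) v)) =
       (\<lambda>v. \<Sum>b\<in>Basis. (frechet_derivative f (at y) v \<bullet> b) *\<^sub>R frechet_derivative g (at (f y)) b)"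
      by (rule ext, rule linear_eq_sum_Basis, rule has_derivative_linear[OF g])
    ultimately show "((\<lambda>x. g (f x)) has_derivative
         (\<lambda>v. \<Sum>b\<in>Basis. (frechet_derivative f (at y) v \<bullet> b) *\<^sub>R frechet_derivative g (at (f y)) b)) (at y)"
      by simp
  next
    fix v
    have "Ck_on k U (\<lambda>y. frechet_derivative g (at (f y)) b)" for b
      by (rule Suc.IH[OF Ck_on_SucD[OF Suc.prems(1)]]) (use Suc.prems in auto)
    then show "Ck_on k U (\<lambda>y. \<Sum>b\<in>Basis. (frechet_derivative f (at y) v \<bullet> b) *\<^sub>R
        frechet_derivative g (at (f y)) b)"
      using Suc.prems
      by (intro Ck_on_sum[OF \<open>open U\<close>] Ck_on_bilinear[OF \<open>open U\<close> bounded_bilinear_scaleR]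
          Ck_on_linear_image[OF \<open>open U\<close> bounded_linear_inner_left]) auto
  qed
qed

lemma Ck_on_inverse:
  fixes f :: "'e::real_normed_vector \<Rightarrow> real"
  assumes "open U" "\<And>x. x \<in> U \<Longrightarrow> f x \<noteq> 0" "Ck_on k U f"
  shows "Ck_on k U (\<lambda>x. inverse (f x))"
  using assms(3)
proof (induction k)
  case 0
  then show ?case using assms(2) by (auto intro: continuous_on_inverse)
next
  case (Suc k)
  have "Ck_on k U (\<lambda>x. inverse (f x))"
    using Suc Ck_on_SucD by blast
  then show ?case
    by (intro Ck_on_SucI[OF \<open>open U\<close> Deriv.has_derivative_inverse[OF assms(2)
            Ck_on_has_derivative[OF Suc.prems]]])
      (use Suc in \<open>auto intro!: Ck_on_linear_image[OF \<open>open U\<close> bounded_linear_minus[OF bounded_linear_ident]]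
          Ck_on_bilinear[OF \<open>open U\<close> bounded_bilinear_mult]\<close>)
qed

lemma smooth_on_cong:
  "open U \<Longrightarrow> smooth_on U f \<Longrightarrow> (\<And>y. y \<in> U \<Longrightarrow> f y = g y) \<Longrightarrow> smooth_on U g"
  unfolding smooth_on_def using Ck_on_cong by blast

lemma smooth_on_subset: "smooth_on U f \<Longrightarrow> V \<subseteq> U \<Longrightarrow> smooth_on V f"
  unfolding smooth_on_def using Ck_on_subset by blast

lemma smooth_on_locally:
  "(\<And>x. x \<in> U \<Longrightarrow> \<exists>V. open V \<and> x \<in> V \<and> smooth_on V f) \<Longrightarrow> smooth_on U f"
  unfolding smooth_on_def using Ck_on_locally by meson

lemma smooth_on_imp_continuous: "smooth_on U f \<Longrightarrow> continuous_on U f"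
  unfolding smooth_on_def using Ck_on_imp_continuous by blast

lemma smooth_on_has_derivative:
  "smooth_on U f \<Longrightarrow> x \<in> U \<Longrightarrow> (f has_derivative frechet_derivative f (at x)) (at x)"
  unfolding smooth_on_def using Ck_on_has_derivative by blast

lemma smooth_on_derivative:
  "smooth_on U f \<Longrightarrow> smooth_on U (\<lambda>x. frechet_derivative f (at x) v)"
  unfolding smooth_on_def by (metis Ck_on.simps(2))

lemma smooth_on_const: "smooth_on U (\<lambda>x. c)"
  by (simp add: smooth_on_def Ck_on_const)

lemma smooth_on_ident: "smooth_on U (\<lambda>x. x)"
  by (simp add: smooth_on_def Ck_on_ident)

lemma smooth_on_linear_image:
  "open U \<Longrightarrow> bounded_linear A \<Longrightarrow> smooth_on U f \<Longrightarrow> smooth_on U (\<lambda>x. A (f x))"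
  by (simp add: smooth_on_def Ck_on_linear_image)

lemma smooth_on_add:
  "open U \<Longrightarrow> smooth_on U f \<Longrightarrow> smooth_on U g \<Longrightarrow> smooth_on U (\<lambda>x. f x + g x)"
  by (simp add: smooth_on_def Ck_on_add)

lemma smooth_on_sum:
  "open U \<Longrightarrow> (\<And>i. i \<in> I \<Longrightarrow> smooth_on U (f i)) \<Longrightarrow> smooth_on U (\<lambda>x. \<Sum>i\<in>I. f i x)"
  by (simp add: smooth_on_def Ck_on_sum)

lemma smooth_on_scaleR:
  "open U \<Longrightarrow> smooth_on U f \<Longrightarrow> smooth_on U g \<Longrightarrow> smooth_on U (\<lambda>x. f x *\<^sub>R g x)"
  by (simp add: smooth_on_def Ck_on_bilinear[OF _ bounded_bilinear_scaleR])

lemma smooth_on_mult: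
  fixes f g :: "_ \<Rightarrow> real"
  shows "open U \<Longrightarrow> smooth_on U f \<Longrightarrow> smooth_on U g \<Longrightarrow> smooth_on U (\<lambda>x. f x * g x)"
  by (simp add: smooth_on_def Ck_on_bilinear[OF _ bounded_bilinear_mult])

lemma smooth_on_divide:
  fixes f g :: "_ \<Rightarrow> real"
  shows "open U \<Longrightarrow> smooth_on U f \<Longrightarrow> smooth_on U g \<Longrightarrow> (\<And>x. x \<in> U \<Longrightarrow> g x \<noteq> 0) \<Longrightarrow>
    smooth_on U (\<lambda>x. f x / g x)"
  unfolding divide_inverse by (intro smooth_on_mult) (auto simp add: smooth_on_def Ck_on_inverse)

lemma smooth_on_Pair:
  assumes "open U" "smooth_on U f" "smooth_on U g"
  shows "smooth_on U (\<lambda>x. (f x, g x))"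
proof -
  have "smooth_on U (\<lambda>x. (f x, 0) + (0, g x))"
    by (intro smooth_on_add assms smooth_on_linear_image[of U "\<lambda>a. (a, 0)"]
        smooth_on_linear_image[of U "\<lambda>a. (0, a)"] bounded_linear_Pair
        bounded_linear_ident bounded_linear_zero)
  then show ?thesis by simp
qed

lemma smooth_on_compose:
  fixes f :: "'d::real_normed_vector \<Rightarrow> 'e::euclidean_space"
  shows "open U \<Longrightarrow> open V \<Longrightarrow> f ` U \<subseteq> V \<Longrightarrow> smooth_on U f \<Longrightarrow> smooth_on V g \<Longrightarrow>
    smooth_on U (\<lambda>x. g (f x))"
  by (simp add: smooth_on_def Ck_on_compose)

text \<open>The defining condition of smoothness only speaks of constant directions; expanding in a
  basis allows directions that vary smoothly.\<close>

lemma smooth_on_derivative_along: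
  fixes f :: "'e::euclidean_space \<Rightarrow> 'f::real_normed_vector"
  assumes "open U" "smooth_on U f" "smooth_on U w"
  shows "smooth_on U (\<lambda>x. frechet_derivative f (at x) (w x))"
proof -
  have "smooth_on U (\<lambda>x. \<Sum>b\<in>Basis. (w x \<bullet> b) *\<^sub>R frechet_derivative f (at x) b)"
    by (intro smooth_on_sum smooth_on_scaleR assms smooth_on_derivative
        smooth_on_linear_image[OF _ bounded_linear_inner_left])
  then show ?thesis
    by (rule smooth_on_cong[OF assms(1)])
      (metis has_derivative_linear linear_eq_sum_Basis assms(2) smooth_on_has_derivative)
qed

section \<open>Symmetry of second derivatives\<close>

lemma has_real_derivative_along:
  assumes "(f has_derivative A) (at (x + s *\<^sub>R a))"
  shows "((\<lambda>s. f (x + s *\<^sub>R a)) has_real_derivative A a) (at s)"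
proof -
  have "((\<lambda>s. x + s *\<^sub>R a) has_derivative (\<lambda>h. h *\<^sub>R a)) (at s)"
    by (auto intro!: derivative_eq_intros)
  from has_derivative_compose[OF this assms]
  have "((\<lambda>s. f (x + s *\<^sub>R a)) has_derivative (\<lambda>h. A (h *\<^sub>R a))) (at s)" .
  moreover have "(\<lambda>h. A (h *\<^sub>R a)) = (*) (A a)"
    using has_derivative_linear[OF assms] by (auto simp: linear_cmul mult.commute)
  ultimately show ?thesis by (simp add: has_field_derivative_def)
qed

text \<open>Two applications of the mean value theorem: to \<open>r \<mapsto> f (x + r a + t b) - f (x + r a)\<close>, and then
  to the derivative of \<open>f\<close> in direction \<open>a\<close> along the segment in direction \<open>b\<close>.\<close>

lemma second_difference_mean_value:
  fixes f :: "'e::real_normed_vector \<Rightarrow> real"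
  assumes "smooth_on U f" "t > 0"
    and U: "\<And>r s. 0 \<le> r \<Longrightarrow> r \<le> t \<Longrightarrow> 0 \<le> s \<Longrightarrow> s \<le> t \<Longrightarrow> x + r *\<^sub>R a + s *\<^sub>R b \<in> U"
  obtains r s where "0 \<le> r" "r \<le> t" "0 \<le> s" "s \<le> t"
    "f (x + t *\<^sub>R a + t *\<^sub>R b) - f (x + t *\<^sub>R a) - f (x + t *\<^sub>R b) + f x =
      t * (t * frechet_derivative (\<lambda>y. frechet_derivative f (at y) a) (at (x + r *\<^sub>R a + s *\<^sub>R b)) b)"
proof -
  let ?D = "\<lambda>y. frechet_derivative f (at y) a"
  have 1: "((\<lambda>r. f (x + r *\<^sub>R a + t *\<^sub>R b) - f (x + r *\<^sub>R a)) has_real_derivative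
      ?D (x + r *\<^sub>R a + t *\<^sub>R b) - ?D (x + r *\<^sub>R a)) (at r)" if "0 \<le> r" "r \<le> t" for r
  proof (rule DERIV_diff)
    have "((\<lambda>r. f ((x + t *\<^sub>R b) + r *\<^sub>R a)) has_real_derivative ?D ((x + t *\<^sub>R b) + r *\<^sub>R a)) (at r)"
      using that assms(2) U[of r t]
      by (intro has_real_derivative_along smooth_on_has_derivative[OF assms(1)])
        (simp add: add_ac)
    then show "((\<lambda>r. f (x + r *\<^sub>R a + t *\<^sub>R b)) has_real_derivative ?D (x + r *\<^sub>R a + t *\<^sub>R b)) (at r)"
      by (simp add: add_ac)
    show "((\<lambda>r. f (x + r *\<^sub>R a)) has_real_derivative ?D (x + r *\<^sub>R a)) (at r)"
      using that assms(2) U[of r 0]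
      by (intro has_real_derivative_along smooth_on_has_derivative[OF assms(1)]) auto
  qed
  obtain r where r: "0 < r" "r < t" and
    "(f (x + t *\<^sub>R a + t *\<^sub>R b) - f (x + t *\<^sub>R a)) - (f (x + 0 *\<^sub>R a + t *\<^sub>R b) - f (x + 0 *\<^sub>R a)) =
      (t - 0) * (?D (x + r *\<^sub>R a + t *\<^sub>R b) - ?D (x + r *\<^sub>R a))"
    using MVT2[OF assms(2) 1] by blast
  moreover
  have 2: "((\<lambda>s. ?D (x + r *\<^sub>R a + s *\<^sub>R b)) has_real_derivative
      frechet_derivative ?D (at (x + r *\<^sub>R a + s *\<^sub>R b)) b) (at s)" if "0 \<le> s" "s \<le> t" for s
    using that r U[of r s]
    by (intro has_real_derivative_along smooth_on_has_derivative[OF smooth_on_derivative[OF assms(1)]])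
      auto
  obtain s where s: "0 < s" "s < t" and
    "?D (x + r *\<^sub>R a + t *\<^sub>R b) - ?D (x + r *\<^sub>R a + 0 *\<^sub>R b) =
      (t - 0) * frechet_derivative ?D (at (x + r *\<^sub>R a + s *\<^sub>R b)) b"
    using MVT2[OF assms(2) 2] by blast
  ultimately show thesis
    by (intro that[of r s]) (auto simp: algebra_simps)
qed

text \<open>The second difference is symmetric in \<open>a\<close> and \<open>b\<close>, so its two mean value expressions agree
  for every small \<open>t\<close>; their common limit is both second derivatives.\<close>

lemma symmetric_second_derivative_real:
  fixes f :: "'e::real_normed_vector \<Rightarrow> real"
  assumes "open U" "smooth_on U f" "x \<in> U"
  shows "frechet_derivative (\<lambda>y. frechet_derivative f (at y) a) (at x) b =
         frechet_derivative (\<lambda>y. frechet_derivative f (at y) b) (at x) a"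
proof -
  define h where "h a b y = frechet_derivative (\<lambda>y. frechet_derivative f (at y) a) (at y) b" for a b y
  have cont: "isCont (h a b) x" for a b
    using assms unfolding h_def
    by (metis continuous_on_eq_continuous_at smooth_on_derivative smooth_on_imp_continuous)
  have "\<bar>h a b x - h b a x\<bar> \<le> 2 * \<epsilon>" if "\<epsilon> > 0" for \<epsilon>
  proof -
    have "\<forall>\<^sub>F y in nhds x. dist (h a b y) (h a b x) < \<epsilon> \<and> dist (h b a y) (h b a x) < \<epsilon> \<and> y \<in> U"
      using that assms(1,3)
      by (intro eventually_conj eventually_nhds_in_open
          tendstoD[OF cont[unfolded isCont_def tendsto_at_iff_tendsto_nhds]])
    then obtain d where d: "d > 0" "\<And>y. dist y x < d \<Longrightarrow> dist (h a b y) (h a b x) < \<epsilon> \<and>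
        dist (h b a y) (h b a x) < \<epsilon> \<and> y \<in> U"
      unfolding eventually_nhds_metric by blast
    define t where "t = d / (norm a + norm b + 1)"
    have K: "norm a + norm b + 1 > 0" by (smt (verit) norm_ge_zero)
    have t: "t > 0" using d(1) K by (simp add: t_def)
    have near: "dist (x + r *\<^sub>R a + s *\<^sub>R b) x < d" if "0 \<le> r" "r \<le> t" "0 \<le> s" "s \<le> t" for r s
    proof -
      have "dist (x + r *\<^sub>R a + s *\<^sub>R b) x \<le> r * norm a + s * norm b"
        using that norm_triangle_ineq[of "r *\<^sub>R a" "s *\<^sub>R b"] by (simp add: dist_norm add.assoc)
      also have "\<dots> \<le> t * norm a + t * norm b"
        using that by (intro add_mono mult_right_mono) auto
      also have "\<dots> < t * (norm a + norm b + 1)"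
        using t by (simp add: algebra_simps)
      also have "\<dots> = d" using K by (simp add: t_def)
      finally show ?thesis .
    qed
    have near': "dist (x + r *\<^sub>R b + s *\<^sub>R a) x < d" if "0 \<le> r" "r \<le> t" "0 \<le> s" "s \<le> t" for r s
      using near[of s r] that by (simp add: add_ac)
    obtain r s where rs: "0 \<le> r" "r \<le> t" "0 \<le> s" "s \<le> t"
      "f (x + t *\<^sub>R a + t *\<^sub>R b) - f (x + t *\<^sub>R a) - f (x + t *\<^sub>R b) + f x =
        t * (t * h a b (x + r *\<^sub>R a + s *\<^sub>R b))"
      using second_difference_mean_value[OF assms(2) t, of x a b] near d(2) unfolding h_def by metis
    obtain r' s' where rs': "0 \<le> r'" "r' \<le> t" "0 \<le> s'" "s' \<le> t"
      "f (x + t *\<^sub>R b + t *\<^sub>R a) - f (x + t *\<^sub>R b) - f (x + t *\<^sub>R a) + f x =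
        t * (t * h b a (x + r' *\<^sub>R b + s' *\<^sub>R a))"
      using second_difference_mean_value[OF assms(2) t, of x b a] near' d(2) unfolding h_def by metis
    have "f (x + t *\<^sub>R b + t *\<^sub>R a) = f (x + t *\<^sub>R a + t *\<^sub>R b)" by (simp add: add_ac)
    then have "t * (t * h a b (x + r *\<^sub>R a + s *\<^sub>R b)) = t * (t * h b a (x + r' *\<^sub>R b + s' *\<^sub>R a))"
      using rs(5) rs'(5) by linarith
    then have "h a b (x + r *\<^sub>R a + s *\<^sub>R b) = h b a (x + r' *\<^sub>R b + s' *\<^sub>R a)"
      using t by simp
    then show ?thesis
      using d(2)[OF near[OF rs(1-4)]] d(2)[OF near'[OF rs'(1-4)]]
      unfolding dist_real_def by (elim conjE) linarith
  qed
  from this[of "\<bar>h a b x - h b a x\<bar> / 4"] have "h a b x = h b a x"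
    by (cases "h a b x = h b a x") auto
  then show ?thesis by (simp add: h_def)
qed

lemma frechet_derivative_inner:
  assumes "f differentiable at x"
  shows "frechet_derivative (\<lambda>y. f y \<bullet> i) (at x) = (\<lambda>v. frechet_derivative f (at x) v \<bullet> i)"
  using assms bounded_linear.has_derivative[OF bounded_linear_inner_left, of f _ "at x" i]
  by (metis frechet_derivative_at frechet_derivative_works)

lemma symmetric_second_derivative:
  fixes f :: "'e::real_normed_vector \<Rightarrow> 'f::euclidean_space"
  assumes "open U" "smooth_on U f" "x \<in> U"
  shows "frechet_derivative (\<lambda>y. frechet_derivative f (at y) a) (at x) b =
         frechet_derivative (\<lambda>y. frechet_derivative f (at y) b) (at x) a"
proof (rule euclidean_eqI)
  fix i :: 'f assume "i \<in> Basis"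
  have diff: "f differentiable at y" "(\<lambda>y. frechet_derivative f (at y) a) differentiable at y"
    if "y \<in> U" for y a
    using that smooth_on_has_derivative[OF assms(2)]
      smooth_on_has_derivative[OF smooth_on_derivative[OF assms(2)]] by (auto intro: differentiableI)
  have *: "frechet_derivative (\<lambda>y. frechet_derivative (\<lambda>y. f y \<bullet> i) (at y) a) (at x) b =
     frechet_derivative (\<lambda>y. frechet_derivative f (at y) a) (at x) b \<bullet> i" for a b
  proof -
    have "frechet_derivative (\<lambda>y. frechet_derivative (\<lambda>y. f y \<bullet> i) (at y) a) (at x) =
        frechet_derivative (\<lambda>y. frechet_derivative f (at y) a \<bullet> i) (at x)"
    proof (rule frechet_derivative_transform_within_open[OF _ assms(1,3)])
      have "((\<lambda>y. frechet_derivative f (at y) a \<bullet> i) has_derivative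
          (\<lambda>v. frechet_derivative (\<lambda>y. frechet_derivative f (at y) a) (at x) v \<bullet> i)) (at x)"
        using diff(2)[OF assms(3)] 
        by (intro bounded_linear.has_derivative[OF bounded_linear_inner_left])
          (simp add: frechet_derivative_works)
      then show "(\<lambda>y. frechet_derivative (\<lambda>y. f y \<bullet> i) (at y) a) differentiable at x"
        by (rule differentiableI[OF has_derivative_transform_within_open[OF _ assms(1,3)]])
          (simp only: frechet_derivative_inner[OF diff(1)])
    qed (simp only: frechet_derivative_inner[OF diff(1)])
    also have "\<dots> = (\<lambda>v. frechet_derivative (\<lambda>y. frechet_derivative f (at y) a) (at x) v \<bullet> i)"
      by (rule frechet_derivative_inner[OF diff(2)[OF assms(3)]])
    finally show ?thesis by (rule fun_cong)
  qed
  have "smooth_on U (\<lambda>y. f y \<bullet> i)"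
    by (rule smooth_on_linear_image[OF assms(1) bounded_linear_inner_left assms(2)])
  from symmetric_second_derivative_real[OF assms(1) this assms(3), of a b]
  show "frechet_derivative (\<lambda>y. frechet_derivative f (at y) a) (at x) b \<bullet> i =
         frechet_derivative (\<lambda>y. frechet_derivative f (at y) b) (at x) a \<bullet> i"
    by (simp add: *)
qed

section \<open>Pulling back a closed two-form\<close>

lemma bilinear_eq_sum_Basis:
  fixes B :: "'e::euclidean_space \<Rightarrow> 'e \<Rightarrow> real"
  assumes "bilinear B"
  shows "B u v = (\<Sum>i\<in>Basis. \<Sum>j\<in>Basis. (u \<bullet> i) * (v \<bullet> j) * B i j)"
proof -
  have "B u v = (\<Sum>i\<in>Basis. (u \<bullet> i) * B i v)"
    using assms linear_eq_sum_Basis[of "\<lambda>u. B u v" u] by (simp add: bilinear_def)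
  also have "\<dots> = (\<Sum>i\<in>Basis. (u \<bullet> i) * (\<Sum>j\<in>Basis. (v \<bullet> j) * B i j))"
    using assms linear_eq_sum_Basis[of "B i" v for i] by (simp add: bilinear_def)
  finally show ?thesis by (simp add: sum_distrib_left mult.assoc)
qed

text \<open>The product rule for \<open>w \<mapsto> B (Y w) (u w) (v w)\<close> when only the coefficients \<open>B y i j\<close> of a
  family of bilinear forms are known to be differentiable.\<close>

lemma has_derivative_bilinear_family:
  fixes B :: "'e::euclidean_space \<Rightarrow> 'e \<Rightarrow> 'e \<Rightarrow> real" and Y u v :: "'w::real_normed_vector \<Rightarrow> 'e"
  assumes "open U" "\<And>y. y \<in> U \<Longrightarrow> bilinear (B y)"
    and B: "\<And>i j. (\<lambda>y. B y i j) differentiable at (Y w)"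
    and "Y w \<in> U" and Y: "(Y has_derivative Y') (at w)"
    and u: "(u has_derivative u') (at w)" and v: "(v has_derivative v') (at w)"
  shows "((\<lambda>w. B (Y w) (u w) (v w)) has_derivative
    (\<lambda>h. frechet_derivative (\<lambda>y. B y (u w) (v w)) (at (Y w)) (Y' h) + B (Y w) (u' h) (v w)
       + B (Y w) (u w) (v' h))) (at w)"
proof -
  let ?D = "\<lambda>i j. frechet_derivative (\<lambda>y. B y i j) (at (Y w))"
  have D: "((\<lambda>y. B y i j) has_derivative ?D i j) (at (Y w))" for i j
    using B by (simp add: frechet_derivative_works)
  have Bsum: "B y p q = (\<Sum>i\<in>Basis. \<Sum>j\<in>Basis. (p \<bullet> i) * (q \<bullet> j) * B y i j)" if "y \<in> U" for y p q
    by (rule bilinear_eq_sum_Basis[OF assms(2)[OF that]])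
  have Dsum: "?D p q = (\<lambda>h. \<Sum>i\<in>Basis. \<Sum>j\<in>Basis. (p \<bullet> i) * (q \<bullet> j) * ?D i j h)" for p q
  proof (rule frechet_derivative_at[symmetric])
    have "((\<lambda>y. \<Sum>i\<in>Basis. \<Sum>j\<in>Basis. (p \<bullet> i) * (q \<bullet> j) * B y i j) has_derivative
        (\<lambda>h. \<Sum>i\<in>Basis. \<Sum>j\<in>Basis. (p \<bullet> i) * (q \<bullet> j) * ?D i j h)) (at (Y w))"
      by (intro has_derivative_sum has_derivative_mult_right D)
    then show "((\<lambda>y. B y p q) has_derivative
        (\<lambda>h. \<Sum>i\<in>Basis. \<Sum>j\<in>Basis. (p \<bullet> i) * (q \<bullet> j) * ?D i j h)) (at (Y w))"
      by (rule has_derivative_transform_within_open[OF _ assms(1,4)]) (simp add: Bsum[symmetric])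
  qed
  have comp: "((\<lambda>w. B (Y w) i j) has_derivative (\<lambda>h. ?D i j (Y' h))) (at w)" for i j
    by (rule has_derivative_compose[OF Y D])
  have "((\<lambda>w. \<Sum>i\<in>Basis. \<Sum>j\<in>Basis. (u w \<bullet> i) * (v w \<bullet> j) * B (Y w) i j) has_derivative
     (\<lambda>h. \<Sum>i\<in>Basis. \<Sum>j\<in>Basis. (u w \<bullet> i) * (v w \<bullet> j) * ?D i j (Y' h) +
         ((u w \<bullet> i) * (v' h \<bullet> j) + (u' h \<bullet> i) * (v w \<bullet> j)) * B (Y w) i j)) (at w)"
    by (intro has_derivative_sum has_derivative_mult comp bounded_linear.has_derivative[OF bounded_linear_inner_left]
       u v)
  moreover have "(\<lambda>h. \<Sum>i\<in>Basis. \<Sum>j\<in>Basis. (u w \<bullet> i) * (v w \<bullet> j) * ?D i j (Y' h) +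
         ((u w \<bullet> i) * (v' h \<bullet> j) + (u' h \<bullet> i) * (v w \<bullet> j)) * B (Y w) i j) =
    (\<lambda>h. ?D (u w) (v w) (Y' h) + B (Y w) (u' h) (v w) + B (Y w) (u w) (v' h))"
    unfolding Bsum[OF assms(4), of "u' _"] Bsum[OF assms(4), of _ "v' _"] Dsum[of "u w"]
    by (simp add: sum.distrib algebra_simps)
  ultimately have main: "((\<lambda>w. \<Sum>i\<in>Basis. \<Sum>j\<in>Basis. (u w \<bullet> i) * (v w \<bullet> j) * B (Y w) i j) has_derivative
     (\<lambda>h. ?D (u w) (v w) (Y' h) + B (Y w) (u' h) (v w) + B (Y w) (u w) (v' h))) (at w)"
    by simp
  have "\<forall>\<^sub>F z in at w. Y z \<in> U"
    using has_derivative_continuous[OF Y] assms(1,4)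
    by (auto simp: continuous_at intro: topological_tendstoD)
  then have "\<forall>\<^sub>F z in at w. (\<Sum>i\<in>Basis. \<Sum>j\<in>Basis. (u z \<bullet> i) * (v z \<bullet> j) * B (Y z) i j) = B (Y z) (u z) (v z)"
    by eventually_elim (simp add: Bsum[symmetric])
  then show ?thesis
    by (rule has_derivative_transform_eventually[OF main]) (simp_all add: Bsum[symmetric] assms(4))
qed

text \<open>Exterior differentiation commutes with pullback, at a single point and for a vanishing
  derivative. Of the six terms with a second derivative of \<open>\<Psi>\<close> those with equal pairs of
  directions cancel, by symmetry of second derivatives and antisymmetry of \<open>B\<close>.\<close>

lemma closed_two_form_pullback:
  fixes B :: "'e::euclidean_space \<Rightarrow> 'e \<Rightarrow> 'e \<Rightarrow> real"
    and \<Psi> :: "'w::real_normed_vector \<Rightarrow> 'e"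
  defines "P \<equiv> \<lambda>a b w. B (\<Psi> w) (frechet_derivative \<Psi> (at w) a) (frechet_derivative \<Psi> (at w) b)"
  assumes "open U" "\<And>y. y \<in> U \<Longrightarrow> bilinear (B y)" "\<And>i j. smooth_on U (\<lambda>y. B y i j)"
    and antisym: "\<And>u v. B (\<Psi> w) u v = - B (\<Psi> w) v u"
    and closed: "\<And>u v z. frechet_derivative (\<lambda>y. B y v z) (at (\<Psi> w)) u
       - frechet_derivative (\<lambda>y. B y u z) (at (\<Psi> w)) v
       + frechet_derivative (\<lambda>y. B y u v) (at (\<Psi> w)) z = 0"
    and "open W" "w \<in> W" "smooth_on W \<Psi>" "\<Psi> w \<in> U"
  shows "frechet_derivative (P b c) (at w) a - frechet_derivative (P a c) (at w) b
       + frechet_derivative (P a b) (at w) c = 0"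
proof -
  let ?T = "\<lambda>a. frechet_derivative \<Psi> (at w) a"
  let ?H = "\<lambda>a b. frechet_derivative (\<lambda>w. frechet_derivative \<Psi> (at w) a) (at w) b"
  have diff: "(\<lambda>y. B y i j) differentiable (at (\<Psi> w))" for i j
    using smooth_on_has_derivative assms by (intro differentiableI) blast
  have expand: "frechet_derivative (P a b) (at w) c =
     frechet_derivative (\<lambda>y. B y (?T a) (?T b)) (at (\<Psi> w)) (?T c)
       + B (\<Psi> w) (?H a c) (?T b) + B (\<Psi> w) (?T a) (?H b c)" for a b c
    unfolding P_def
    by (rule fun_cong[OF frechet_derivative_at[symmetric]], rule has_derivative_bilinear_family[OF assms(2)])
      (use assms diff in \<open>auto intro: smooth_on_has_derivative smooth_on_derivative\<close>)
  have sym: "?H a b = ?H b a" for a b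
    by (rule symmetric_second_derivative[OF \<open>open W\<close> \<open>smooth_on W \<Psi>\<close> \<open>w \<in> W\<close>])
  show ?thesis
    using closed[of "?T b" "?T c" "?T a"] antisym[of "?T b" "?H c a"]
    unfolding expand sym[of b a] sym[of c b] sym[of a c] by simp
qed

section \<open>Local sections of submersions\<close>

lemma isCont_imp_tendsto_nhds: "isCont f x \<Longrightarrow> (f \<longlongrightarrow> f x) (nhds x)"
  by (simp add: isCont_def tendsto_at_iff_tendsto_nhds)

text \<open>If the scalar factor vanishes at \<open>x\<close>, the product is differentiable at \<open>x\<close> even though the
  other factor is merely continuous. This is how continuity of a pointwise inverse gives its
  differentiability.\<close>

lemma has_derivative_scaleR_vanishing:
  fixes q :: "'e::real_normed_vector \<Rightarrow> real" and c :: "'e \<Rightarrow> 'f::real_normed_vector"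
  assumes q: "(q has_derivative q') (at x)" and "q x = 0" and c: "isCont c x"
  shows "((\<lambda>y. q y *\<^sub>R c y) has_derivative (\<lambda>h. q' h *\<^sub>R c x)) (at x)"
proof -
  interpret q': bounded_linear q' using q by (rule has_derivative_bounded_linear)
  obtain K where K: "\<And>h. norm (q' h) \<le> norm h * K"
    using q'.bounded by blast
  have q0: "((\<lambda>h. norm (q (x + h) - q x - q' h) / norm h) \<longlongrightarrow> 0) (at 0)"
    using q by (simp add: has_derivative_at)
  have c0: "((\<lambda>h. c (x + h)) \<longlongrightarrow> c x) (at 0)"
    using c by (simp add: isCont_iff)
  show ?thesis
    unfolding has_derivative_at
  proof (intro conjI)
    show "bounded_linear (\<lambda>h. q' h *\<^sub>R c x)"
      by (rule bounded_linear_compose[OF bounded_linear_scaleR_left q'.bounded_linear_axioms])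
    have lim: "((\<lambda>h. norm (q (x + h) - q x - q' h) / norm h * norm (c (x + h))
        + \<bar>K\<bar> * norm (c (x + h) - c x)) \<longlongrightarrow> 0 * norm (c x) + \<bar>K\<bar> * norm (c x - c x)) (at 0)"
      by (intro tendsto_intros q0 c0)
    have bound: "norm (q (x + h) *\<^sub>R c (x + h) - q x *\<^sub>R c x - q' h *\<^sub>R c x) / norm h
        \<le> norm (q (x + h) - q x - q' h) / norm h * norm (c (x + h)) + \<bar>K\<bar> * norm (c (x + h) - c x)"
      if "h \<noteq> 0" for h
    proof -
      have "q (x + h) *\<^sub>R c (x + h) - q x *\<^sub>R c x - q' h *\<^sub>R c x =
          (q (x + h) - q x - q' h) *\<^sub>R c (x + h) + q' h *\<^sub>R (c (x + h) - c x)"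
        using assms(2) by (simp add: algebra_simps)
      also have "norm \<dots> \<le> norm (q (x + h) - q x - q' h) * norm (c (x + h))
          + norm (q' h) * norm (c (x + h) - c x)"
        by (rule norm_triangle_le) simp
      also have "norm (q' h) * norm (c (x + h) - c x) \<le> (norm h * \<bar>K\<bar>) * norm (c (x + h) - c x)"
        using K[of h] mult_left_mono[OF abs_ge_self[of K] norm_ge_zero[of h]]
        by (intro mult_right_mono) auto
      finally show ?thesis
        using that by (simp add: field_simps)
    qed
    show "((\<lambda>h. norm (q (x + h) *\<^sub>R c (x + h) - q x *\<^sub>R c x - q' h *\<^sub>R c x) / norm h) \<longlongrightarrow> 0) (at 0)"
      by (rule tendsto_sandwich[of "\<lambda>_. 0", OF _ _ tendsto_const])
        (use lim bound in \<open>auto simp: eventually_at_filter\<close>)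
  qed
qed

context
  fixes A P :: "'e::real_normed_vector \<Rightarrow> 'f::euclidean_space \<Rightarrow> 'f" and U :: "'e set"
  assumes U: "open U"
    and A: "\<And>y. y \<in> U \<Longrightarrow> linear (A y)" and P: "\<And>y. y \<in> U \<Longrightarrow> linear (P y)"
    and AP: "\<And>y v. y \<in> U \<Longrightarrow> A y (P y v) = v" and PA: "\<And>y v. y \<in> U \<Longrightarrow> P y (A y v) = v"
begin

text \<open>An injective linear map is bounded below, and this survives a small perturbation.\<close>

lemma inverse_family_locally_bounded:
  assumes "\<And>v. continuous_on U (\<lambda>y. A y v)" "x \<in> U"
  obtains K where "\<forall>\<^sub>F y in nhds x. \<forall>v. norm (P y v) \<le> K * norm v"
proof -
  have "inj (A x)" using PA[OF assms(2)] by (metis injI)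
  then obtain B where B: "B > 0" "\<And>v. B * norm v \<le> norm (A x v)"
    using linear_inj_bounded_below_pos[OF A[OF assms(2)]] by metis
  have "isCont (\<lambda>y. \<Sum>b\<in>Basis. norm (A y b - A x b)) x"
    using assms U by (auto intro!: continuous_intros simp: continuous_on_eq_continuous_at)
  then have "((\<lambda>y. \<Sum>b\<in>Basis. norm (A y b - A x b)) \<longlongrightarrow> 0) (nhds x)"
    by (auto dest: isCont_imp_tendsto_nhds)
  then have "\<forall>\<^sub>F y in nhds x. (\<Sum>b\<in>Basis. norm (A y b - A x b)) < B / 2"
    using B(1) by (intro order_tendstoD(2)) auto
  moreover have "\<forall>\<^sub>F y in nhds x. y \<in> U"
    using U assms(2) by (rule eventually_nhds_in_open)
  ultimately have "\<forall>\<^sub>F y in nhds x. \<forall>v. norm (P y v) \<le> (2 / B) * norm v"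
  proof eventually_elim
    case (elim y)
    show ?case
    proof
      fix v
      let ?w = "P y v"
      have "A y ?w - A x ?w = (\<Sum>b\<in>Basis. (?w \<bullet> b) *\<^sub>R (A y b - A x b))"
        using linear_eq_sum_Basis[OF A[OF elim(2)], of ?w] linear_eq_sum_Basis[OF A[OF assms(2)], of ?w]
        by (simp add: scaleR_diff_right sum_subtractf)
      also have "norm \<dots> \<le> (\<Sum>b\<in>Basis. norm ((?w \<bullet> b) *\<^sub>R (A y b - A x b)))"
        by (rule norm_sum)
      also have "\<dots> \<le> (\<Sum>b\<in>Basis. norm ?w * norm (A y b - A x b))"
        by (intro sum_mono) (auto intro!: mult_right_mono Basis_le_norm)
      also have "\<dots> = norm ?w * (\<Sum>b\<in>Basis. norm (A y b - A x b))"
        by (simp add: sum_distrib_left)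
      also have "\<dots> \<le> norm ?w * (B / 2)"
        using elim(1) by (intro mult_left_mono) auto
      finally have "norm (v - A x ?w) \<le> norm ?w * (B / 2)"
        by (simp add: AP[OF elim(2)])
      moreover have "norm (A x ?w) \<le> norm (v - A x ?w) + norm v"
        by (metis norm_minus_commute norm_triangle_sub add.commute)
      ultimately have "norm ?w * (B / 2) \<le> norm v"
        using B(2)[of ?w] by (simp add: algebra_simps)
      then show "norm (P y v) \<le> (2 / B) * norm v"
        using B(1) by (simp add: field_simps)
    qed
  qed
  then show thesis by (rule that)
qed

text \<open>From \<open>P y v - P x v = P y (v - A y (P x v))\<close> and the local bound on \<open>P\<close>.\<close>

lemma continuous_inverse_family:
  assumes "\<And>v. continuous_on U (\<lambda>y. A y v)"
  shows "continuous_on U (\<lambda>y. P y v)"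
proof -
  have "isCont (\<lambda>y. P y v) x" if x: "x \<in> U" for x
  proof -
    obtain K where K: "\<forall>\<^sub>F y in nhds x. \<forall>v. norm (P y v) \<le> K * norm v"
      using inverse_family_locally_bounded[OF assms x] .
    have "isCont (\<lambda>y. A y (P x v)) x"
      using assms U x by (auto simp: continuous_on_eq_continuous_at)
    then have "((\<lambda>y. A y (P x v)) \<longlongrightarrow> v) (nhds x)"
      using isCont_imp_tendsto_nhds AP[OF x] by metis
    then have "((\<lambda>y. K * norm (A y (P x v) - v)) \<longlongrightarrow> K * norm (v - v)) (nhds x)"
      by (intro tendsto_intros)
    then have lim: "((\<lambda>y. K * norm (A y (P x v) - v)) \<longlongrightarrow> 0) (nhds x)" by simp
    have "\<forall>\<^sub>F y in nhds x. y \<in> U"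
      using U x by (rule eventually_nhds_in_open)
    with K have "\<forall>\<^sub>F y in nhds x. norm (P y v - P x v) \<le> K * norm (A y (P x v) - v)"
    proof eventually_elim
      case (elim y)
      have "P y (v - A y (P x v)) = P y v - P x v"
        by (simp add: linear_diff[OF P[OF elim(2)]] PA[OF elim(2)])
      then show ?case
        using elim(1) by (metis norm_minus_commute)
    qed
    then have "((\<lambda>y. P y v - P x v) \<longlongrightarrow> 0) (nhds x)"
      by (rule Lim_null_comparison[OF _ lim])
    then show ?thesis
      using tendsto_at_iff_tendsto_nhds[of "\<lambda>y. P y v" x] by (simp add: isCont_def LIM_zero_iff)
  qed
  then show ?thesis by (simp add: continuous_at_imp_continuous_on)
qed

text \<open>The rule for an inverse, \<open>dP = - P (dA) P\<close>, obtained from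
  \<open>P y v = w - P y (A y w - v)\<close> with the fixed vector \<open>w = P x v\<close>: the argument \<open>A y w - v\<close>
  vanishes at \<open>y = x\<close>.\<close>

lemma has_derivative_inverse_family:
  assumes "\<And>v y. y \<in> U \<Longrightarrow> (\<lambda>y. A y v) differentiable (at y)" "x \<in> U"
  shows "((\<lambda>y. P y v) has_derivative
    (\<lambda>h. - P x (\<Sum>b\<in>Basis. (P x v \<bullet> b) *\<^sub>R frechet_derivative (\<lambda>y. A y b) (at x) h))) (at x)"
proof -
  let ?w = "P x v"
  let ?q' = "\<lambda>h. \<Sum>b\<in>Basis. (?w \<bullet> b) *\<^sub>R frechet_derivative (\<lambda>y. A y b) (at x) h"
  have contA: "continuous_on U (\<lambda>y. A y v)" for v
    using assms(1) by (auto intro!: continuous_at_imp_continuous_on differentiable_imp_continuous_within)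
  have "((\<lambda>y. \<Sum>b\<in>Basis. (?w \<bullet> b) *\<^sub>R A y b) has_derivative ?q') (at x)"
    using assms by (intro has_derivative_sum has_derivative_scaleR_right)
      (simp add: frechet_derivative_works[symmetric])
  then have "((\<lambda>y. A y ?w) has_derivative ?q') (at x)"
    by (rule has_derivative_transform_within_open[OF _ U assms(2)])
      (rule linear_eq_sum_Basis[OF A, symmetric])
  then have q: "((\<lambda>y. A y ?w - v) has_derivative ?q') (at x)"
    by (auto intro!: derivative_eq_intros)
  have "((\<lambda>y. \<Sum>c\<in>Basis. ((A y ?w - v) \<bullet> c) *\<^sub>R P y c) has_derivative
      (\<lambda>h. \<Sum>c\<in>Basis. (?q' h \<bullet> c) *\<^sub>R P x c)) (at x)"
    using continuous_inverse_family[OF contA] assms(2) U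
    by (intro has_derivative_sum has_derivative_scaleR_vanishing
        bounded_linear.has_derivative[OF bounded_linear_inner_left q])
      (auto simp: AP continuous_on_eq_continuous_at)
  moreover have "(\<lambda>h. \<Sum>c\<in>Basis. (?q' h \<bullet> c) *\<^sub>R P x c) = (\<lambda>h. P x (?q' h))"
    by (rule ext, rule linear_eq_sum_Basis[OF P[OF assms(2)], symmetric])
  ultimately have "((\<lambda>y. \<Sum>c\<in>Basis. ((A y ?w - v) \<bullet> c) *\<^sub>R P y c) has_derivative
      (\<lambda>h. P x (?q' h))) (at x)" by simp
  then have "((\<lambda>y. P y (A y ?w - v)) has_derivative (\<lambda>h. P x (?q' h))) (at x)"
    by (rule has_derivative_transform_within_open[OF _ U assms(2)])
      (rule linear_eq_sum_Basis[OF P, symmetric])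
  then have "((\<lambda>y. ?w - P y (A y ?w - v)) has_derivative (\<lambda>h. - P x (?q' h))) (at x)"
    by (auto intro!: derivative_eq_intros)
  then show ?thesis
    by (rule has_derivative_transform_within_open[OF _ U assms(2)])
      (simp add: linear_diff[OF P] PA)
qed

lemma Ck_on_inverse_family:
  assumes "\<And>v. Ck_on k U (\<lambda>y. A y v)"
  shows "Ck_on k U (\<lambda>y. P y v)"
  using assms
proof (induction k arbitrary: v)
  case 0
  then show ?case using continuous_inverse_family by simp
next
  case (Suc k)
  have lower: "Ck_on k U (\<lambda>y. P y v)" for v
    using Suc Ck_on_SucD by blast
  show ?case
  proof (rule Ck_on_SucI[OF U has_derivative_inverse_family])
    fix h
    let ?q' = "\<lambda>y. \<Sum>b\<in>Basis. (P y v \<bullet> b) *\<^sub>R frechet_derivative (\<lambda>y. A y b) (at y) h"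
    have "Ck_on k U (\<lambda>y. P y v \<bullet> b)" for b
      by (rule Ck_on_linear_image[OF U bounded_linear_inner_left lower])
    moreover have "Ck_on k U (\<lambda>y. frechet_derivative (\<lambda>y. A y b) (at y) h)" for b
      using Suc.prems[of b] by simp
    ultimately have q: "Ck_on k U ?q'"
      by (intro Ck_on_sum[OF U] Ck_on_bilinear[OF U bounded_bilinear_scaleR])
    have "Ck_on k U (\<lambda>y. ?q' y \<bullet> c)" for c
      by (rule Ck_on_linear_image[OF U bounded_linear_inner_left q])
    then have "Ck_on k U (\<lambda>y. \<Sum>c\<in>Basis. (?q' y \<bullet> c) *\<^sub>R P y c)"
      by (intro Ck_on_sum[OF U] Ck_on_bilinear[OF U bounded_bilinear_scaleR] lower)
    then have "Ck_on k U (\<lambda>y. P y (?q' y))"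
      by (rule Ck_on_cong[OF U]) (rule linear_eq_sum_Basis[OF P, symmetric])
    then show "Ck_on k U (\<lambda>y. - P y (?q' y))"
      by (rule Ck_on_linear_image[OF U bounded_linear_minus[OF bounded_linear_ident]])
  qed (use Suc.prems in auto)
qed

end

text \<open>The classical inverse function theorem makes \<open>g\<close> differentiable with derivative the inverse
  of \<open>Df (g y)\<close>. That derivative is as often differentiable as \<open>g\<close> itself, so
  \<open>g\<close> gains one order in each step of an induction.\<close>

lemma smooth_inverse_function:
  fixes f :: "'f::euclidean_space \<Rightarrow> 'f"
  assumes "open U" "smooth_on U f" "x \<in> U" "bij (frechet_derivative f (at x))"
  obtains V g where "open V" "f x \<in> V" "smooth_on V g" "g ` V \<subseteq> U" "\<And>z. z \<in> V \<Longrightarrow> f (g z) = z" "g (f x) = x"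
proof -
  define f' where "f' y = Blinfun (frechet_derivative f (at y))" for y
  have f: "(f has_derivative frechet_derivative f (at y)) (at y)" if "y \<in> U" for y
    using smooth_on_has_derivative[OF assms(2) that] .
  have f': "blinfun_apply (f' y) = frechet_derivative f (at y)" if "y \<in> U" for y
    unfolding f'_def by (rule bounded_linear_Blinfun_apply[OF has_derivative_bounded_linear[OF f[OF that]]])
  have "continuous_on U (\<lambda>y. blinfun_apply (f' y) i)" for i
    using smooth_on_imp_continuous[OF smooth_on_derivative[OF assms(2), of i]]
    by (simp add: f' cong: continuous_on_cong)
  then have contf': "continuous_on U f'"
    by (intro continuous_on_blinfun_componentwise)
  have lin: "linear (frechet_derivative f (at x))"
    using f[OF assms(3)] by (rule has_derivative_linear)
  define I where "I = Blinfun (inv (frechet_derivative f (at x)))"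
  have "linear (inv (frechet_derivative f (at x)))"
    using lin assms(4) by (simp add: bij_is_inj inj_linear_imp_inv_linear)
  then have I: "blinfun_apply I = inv (frechet_derivative f (at x))"
    unfolding I_def by (simp add: bounded_linear_Blinfun_apply linear_linear)
  have "I o\<^sub>L f' x = id_blinfun"
    using assms(4) by (intro blinfun_eqI) (simp add: I f'[OF assms(3)] bij_is_inj)
  then obtain U' V g g' where *: "open U'" "U' \<subseteq> U" "x \<in> U'" "open V" "f x \<in> V" "homeomorphism U' V f g"
    "\<And>y. y \<in> V \<Longrightarrow> (g has_derivative (g' y)) (at y)"
    "\<And>y. y \<in> V \<Longrightarrow> g' y = inv (blinfun_apply (f' (g y)))"
    "\<And>y. y \<in> V \<Longrightarrow> bij (blinfun_apply (f' (g y)))"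
    using inverse_function_theorem[OF assms(1) _ contf' assms(3)] f f' by metis
  have gV: "g y \<in> U" if "y \<in> V" for y
    using * that by (auto simp: homeomorphism_def)
  let ?A = "\<lambda>y. frechet_derivative f (at (g y))"
  have bij: "bij (?A y)" and g'_eq: "g' y = inv (?A y)" if "y \<in> V" for y
    using *(8,9)[OF that] f'[OF gV[OF that]] by auto
  have "Ck_on k V g" for k
  proof (induction k)
    case 0
    then show ?case using *(6) by (simp add: homeomorphism_def)
  next
    case (Suc k)
    show ?case
    proof (rule Ck_on_SucI[OF *(4,7)])
      fix v
      show "Ck_on k V (\<lambda>y. g' y v)"
      proof (rule Ck_on_inverse_family[OF *(4), of ?A])
        show "Ck_on k V (\<lambda>y. ?A y v)" for v
          using gV assms(2) smooth_on_derivative[OF assms(2), of v]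
          by (intro Ck_on_compose[OF *(4) assms(1) _ Suc]) (auto simp: smooth_on_def)
        fix y assume y: "y \<in> V"
        show "linear (?A y)" using f[OF gV[OF y]] by (rule has_derivative_linear)
        show "linear (g' y)" using *(7)[OF y] by (rule has_derivative_linear)
        show "?A y (g' y v) = v" "g' y (?A y v) = v" for v
          using bij[OF y] g'_eq[OF y] by (simp_all add: bij_is_inj bij_is_surj surj_f_inv_f)
      qed
    qed
  qed
  then have "smooth_on V g" by (simp add: smooth_on_def)
  moreover have "f (g z) = z" if "z \<in> V" for z
    using *(6) that by (simp add: homeomorphism_def)
  moreover have "g (f x) = x"
    using *(3,6) by (simp add: homeomorphism_def)
  ultimately show thesis using that *(4,5) gV by (metis image_subsetI)
qed

text \<open>Restricting \<open>f\<close> to the affine subspace \<open>x + range R\<close>, with \<open>R\<close> a linear right inverse of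
  \<open>Df (x)\<close>, makes its derivative the identity, so that the restriction has a local inverse.\<close>

lemma smooth_local_section:
  fixes f :: "'e::euclidean_space \<Rightarrow> 'f::euclidean_space"
  assumes "open U" "smooth_on U f" "x \<in> U" "surj (frechet_derivative f (at x))"
  obtains V \<sigma> where "open V" "f x \<in> V" "smooth_on V \<sigma>" "\<sigma> ` V \<subseteq> U" "\<And>z. z \<in> V \<Longrightarrow> f (\<sigma> z) = z"
    "\<sigma> (f x) = x"
proof -
  have f: "(f has_derivative frechet_derivative f (at x)) (at x)"
    using assms by (intro smooth_on_has_derivative)
  obtain R where R: "linear R" "frechet_derivative f (at x) \<circ> R = id"
    using linear_surjective_right_inverse[OF has_derivative_linear[OF f] assms(4)] by blast
  have bl: "bounded_linear R" using R(1) by (simp add: linear_linear)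
  let ?l = "\<lambda>z. x + R z"
  let ?U = "?l -` U"
  have contl: "continuous_on UNIV ?l"
    using bl by (intro continuous_intros) (auto intro: bounded_linear.continuous_on)
  have openU: "open ?U"
    using assms(1) contl by (rule open_vimage)
  have sml: "smooth_on ?U ?l"
    by (rule smooth_on_add[OF openU smooth_on_const smooth_on_linear_image[OF openU bl smooth_on_ident]])
  have smf: "smooth_on ?U (\<lambda>z. f (?l z))"
    by (rule smooth_on_compose[OF openU assms(1) _ sml assms(2)]) auto
  have R0: "R 0 = 0" using R(1) by (rule linear_0)
  have "(?l has_derivative R) (at 0)"
    using bounded_linear_imp_has_derivative[OF bl] by (auto intro!: derivative_eq_intros)
  from has_derivative_compose[OF this, of f] f
  have "((\<lambda>z. f (?l z)) has_derivative (\<lambda>h. frechet_derivative f (at x) (R h))) (at 0)"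
    by (simp add: R0)
  moreover have "(\<lambda>h. frechet_derivative f (at x) (R h)) = id"
    using R(2) by (simp add: comp_def)
  ultimately have "frechet_derivative (\<lambda>z. f (?l z)) (at 0) = id"
    using frechet_derivative_at[of "\<lambda>z. f (?l z)" id 0] by simp
  then obtain V g where *: "open V" "f (?l 0) \<in> V" "smooth_on V g" "g ` V \<subseteq> ?U"
    "\<And>z. z \<in> V \<Longrightarrow> f (?l (g z)) = z" "g (f (?l 0)) = 0"
    using smooth_inverse_function[OF openU smf, of 0] assms(3) R0 by auto
  show thesis
  proof (rule that[of V "\<lambda>z. ?l (g z)"])
    show "smooth_on V (\<lambda>z. ?l (g z))"
      by (rule smooth_on_compose[OF *(1) openU *(4,3) sml])
  qed (use * R0 in auto)
qed

section \<open>Local uniqueness for ordinary differential equations\<close>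

lemma smooth_locally_Lipschitz:
  fixes f :: "'e::euclidean_space \<Rightarrow> 'f::real_normed_vector"
  assumes "open V" "smooth_on V f" "x \<in> V"
  obtains r M where "r > 0" "M \<ge> 0" "\<And>a b. a \<in> cball x r \<Longrightarrow> b \<in> cball x r \<Longrightarrow> norm (f a - f b) \<le> M * norm (a - b)"
proof -
  obtain r where r: "r > 0" "cball x r \<subseteq> V"
    using assms(1,3) open_contains_cball by blast
  let ?N = "\<lambda>y. \<Sum>b\<in>Basis. norm (frechet_derivative f (at y) b)"
  have "continuous_on (cball x r) ?N"
    by (intro continuous_intros continuous_on_subset[OF smooth_on_imp_continuous[OF smooth_on_derivative[OF assms(2)]] r(2)])
  then have "bounded (?N ` cball x r)"
    by (intro compact_imp_bounded compact_continuous_image) auto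
  then obtain M where M: "\<And>y. y \<in> cball x r \<Longrightarrow> norm (?N y) \<le> M"
    unfolding bounded_iff by blast
  have der: "(f has_derivative frechet_derivative f (at y)) (at y)" if "y \<in> cball x r" for y
    using that r(2) by (intro smooth_on_has_derivative[OF assms(2)]) auto
  have "onorm (frechet_derivative f (at y)) \<le> M" if "y \<in> cball x r" for y
  proof (rule onorm_le)
    fix v
    have "norm (frechet_derivative f (at y) v) = norm (\<Sum>b\<in>Basis. (v \<bullet> b) *\<^sub>R frechet_derivative f (at y) b)"
      by (rule arg_cong[OF linear_eq_sum_Basis[OF has_derivative_linear[OF der[OF that]]]])
    also have "\<dots> \<le> (\<Sum>b\<in>Basis. norm v * norm (frechet_derivative f (at y) b))"
      by (rule sum_norm_le) (auto intro!: mult_right_mono Basis_le_norm)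
    also have "\<dots> = ?N y * norm v" by (simp add: sum_distrib_left mult.commute)
    also have "\<dots> \<le> M * norm v"
      using M[OF that] by (intro mult_right_mono) auto
    finally show "norm (frechet_derivative f (at y) v) \<le> M * norm v" .
  qed
  then have "norm (f a - f b) \<le> M * norm (a - b)" if "a \<in> cball x r" "b \<in> cball x r" for a b
    using that by (intro differentiable_bound[of "cball x r" f "\<lambda>y. frechet_derivative f (at y)"])
      (simp_all add: has_derivative_at_withinI[OF der])
  moreover have "M \<ge> 0" using M[of x] r(1) by (smt (verit) centre_in_cball norm_ge_zero)
  ultimately show thesis using that r(1) by blast
qed

text \<open>Gronwall's argument: \<open>w = \<parallel>u - v\<parallel>\<^sup>2\<close> satisfies \<open>\<bar>w'\<bar> \<le> 2 M w\<close> for a local Lipschitz constant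
  \<open>M\<close> of \<open>f\<close>, so \<open>w exp (- 2 M t)\<close> decreases and \<open>w exp (2 M t)\<close> increases, and both vanish at \<open>t0\<close>.\<close>

lemma ode_local_uniqueness:
  fixes f :: "'e::euclidean_space \<Rightarrow> 'e"
  assumes "open V" "smooth_on V f" "open J" "t0 \<in> J" "u t0 \<in> V"
    and u: "\<And>t. t \<in> J \<Longrightarrow> (u has_vector_derivative f (u t)) (at t)"
    and v: "\<And>t. t \<in> J \<Longrightarrow> (v has_vector_derivative f (v t)) (at t)"
    and "u t0 = v t0"
  obtains \<delta> where "\<delta> > 0" "\<And>t. dist t t0 < \<delta> \<Longrightarrow> u t = v t"
proof -
  obtain r M where r: "r > 0" "M \<ge> 0"
    "\<And>a b. a \<in> cball (u t0) r \<Longrightarrow> b \<in> cball (u t0) r \<Longrightarrow> norm (f a - f b) \<le> M * norm (a - b)"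
    using smooth_locally_Lipschitz[OF assms(1,2,5)] by metis
  have "isCont u t0" "isCont v t0"
    using u[OF assms(4)] v[OF assms(4)] by (auto intro: has_vector_derivative_continuous)
  then have "\<forall>\<^sub>F t in nhds t0. dist (u t) (u t0) < r \<and> dist (v t) (v t0) < r \<and> t \<in> J"
    using r(1) assms(3,4)
    by (intro eventually_conj eventually_nhds_in_open tendstoD)
      (auto dest: isCont_imp_tendsto_nhds)
  then obtain \<delta> where \<delta>: "\<delta> > 0" "\<And>t. dist t t0 < \<delta> \<Longrightarrow> u t \<in> cball (u t0) r \<and> v t \<in> cball (u t0) r \<and> t \<in> J"
    unfolding eventually_nhds_metric assms(8) by (metis dist_commute mem_cball less_imp_le)
  define w where "w t = (u t - v t) \<bullet> (u t - v t)" for t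
  define w' where "w' t = 2 * ((u t - v t) \<bullet> (f (u t) - f (v t)))" for t
  have w: "(w has_real_derivative w' t) (at t)" if "dist t t0 < \<delta>" for t
  proof -
    have "((\<lambda>t. u t - v t) has_derivative (\<lambda>h. h *\<^sub>R (f (u t) - f (v t)))) (at t)"
      using has_vector_derivative_diff[OF u v] \<delta>(2)[OF that] by (simp add: has_vector_derivative_def)
    from has_derivative_inner[OF this this] show ?thesis
      unfolding w_def w'_def has_field_derivative_def
      by (rule has_derivative_eq_rhs) (auto simp: inner_commute algebra_simps)
  qed
  have bound: "\<bar>w' t\<bar> \<le> 2 * M * w t" if "dist t t0 < \<delta>" for t
  proof -
    have "\<bar>(u t - v t) \<bullet> (f (u t) - f (v t))\<bar> \<le> norm (u t - v t) * norm (f (u t) - f (v t))"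
      by (rule Cauchy_Schwarz_ineq2)
    also have "\<dots> \<le> norm (u t - v t) * (M * norm (u t - v t))"
      using \<delta>(2)[OF that] by (intro mult_left_mono r) auto
    also have "\<dots> = M * w t"
      by (simp add: w_def dot_square_norm power2_eq_square)
    finally show ?thesis by (simp add: w'_def abs_mult)
  qed
  have w0: "w t0 = 0" by (simp add: w_def assms(8))
  have wpos: "w t \<ge> 0" for t by (simp add: w_def)
  have "w t = 0" if t: "dist t t0 < \<delta>" for t
  proof (cases "t0 \<le> t")
    case True
    have "w t * exp (- (2 * M) * t) \<le> w t0 * exp (- (2 * M) * t0)"
    proof (rule DERIV_nonpos_imp_nonincreasing[OF True])
      fix s assume "t0 \<le> s" "s \<le> t"
      then have s: "dist s t0 < \<delta>" using t by (auto simp: dist_real_def)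
      have "((\<lambda>t. w t * exp (- (2 * M) * t)) has_real_derivative
          (w' s - 2 * M * w s) * exp (- (2 * M) * s)) (at s)"
        by (auto intro!: derivative_eq_intros w[OF s] simp: algebra_simps)
      moreover have "(w' s - 2 * M * w s) * exp (- (2 * M) * s) \<le> 0"
        using bound[OF s] by (intro mult_nonpos_nonneg) auto
      ultimately show "\<exists>y. ((\<lambda>t. w t * exp (- (2 * M) * t)) has_real_derivative y) (at s) \<and> y \<le> 0"
        by blast
    qed
    then show ?thesis using w0 wpos[of t] by (simp add: mult_le_0_iff)
  next
    case False
    have "w t * exp ((2 * M) * t) \<le> w t0 * exp ((2 * M) * t0)"
    proof (rule DERIV_nonneg_imp_nondecreasing[of t t0])
      fix s assume "t \<le> s" "s \<le> t0"
      then have s: "dist s t0 < \<delta>" using t by (auto simp: dist_real_def)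
      have "((\<lambda>t. w t * exp ((2 * M) * t)) has_real_derivative
          (w' s + 2 * M * w s) * exp ((2 * M) * s)) (at s)"
        by (auto intro!: derivative_eq_intros w[OF s] simp: algebra_simps)
      moreover have "(w' s + 2 * M * w s) * exp ((2 * M) * s) \<ge> 0"
        using bound[OF s] by (intro mult_nonneg_nonneg) auto
      ultimately show "\<exists>y. ((\<lambda>t. w t * exp ((2 * M) * t)) has_real_derivative y) (at s) \<and> 0 \<le> y"
        by blast
    qed (use False in auto)
    then show ?thesis using w0 wpos[of t] by (simp add: mult_le_0_iff)
  qed
  then show thesis using \<delta>(1) that by (auto simp: w_def)
qed

section \<open>Charts, tangent vectors and tangent maps\<close>

lemma chart_inv_mem: "u \<in> snd c ` fst c \<Longrightarrow> chart_inv c u \<in> fst c"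
  by (simp add: chart_inv_def inv_into_into)

lemma chart_inv_right: "u \<in> snd c ` fst c \<Longrightarrow> snd c (chart_inv c u) = u"
  by (simp add: chart_inv_def f_inv_into_f)

lemma chart_inv_left: "is_chart T c \<Longrightarrow> x \<in> fst c \<Longrightarrow> chart_inv c (snd c x) = x"
  unfolding is_chart_def chart_inv_def
  by (metis homeomorphic_imp_injective_map inv_into_f_f openin_subset topspace_subtopology_subset)

lemma chart_image_open:
  assumes "is_chart T c" "openin T W"
  shows "open (snd c ` (fst c \<inter> W))"
proof -
  have "open_map (subtopology T (fst c)) (top_of_set (snd c ` fst c)) (snd c)"
    using assms(1) unfolding is_chart_def by (blast intro: homeomorphic_imp_open_map)
  moreover have "openin (subtopology T (fst c)) (fst c \<inter> W)"
    using assms(2) by (simp add: openin_subtopology_Int2)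
  ultimately have "openin (top_of_set (snd c ` fst c)) (snd c ` (fst c \<inter> W))"
    by (simp add: open_map_def)
  then show ?thesis
    using assms(1) openin_open_trans[of "snd c ` fst c"] unfolding is_chart_def by blast
qed

lemma continuous_map_chart_inv:
  assumes "is_chart T c"
  shows "continuous_map (top_of_set (snd c ` fst c)) T (chart_inv c)"
proof -
  have c: "openin T (fst c)" "homeomorphic_map (subtopology T (fst c)) (top_of_set (snd c ` fst c)) (snd c)"
    using assms by (auto simp: is_chart_def)
  then obtain g where g: "homeomorphic_maps (subtopology T (fst c)) (top_of_set (snd c ` fst c)) (snd c) g"
    by (auto simp: homeomorphic_map_maps)
  have "topspace (subtopology T (fst c)) = fst c"
    using openin_subset[OF c(1)] by auto
  then have "g u = chart_inv c u" if "u \<in> snd c ` fst c" for u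
    using g that chart_inv_left[OF assms] unfolding homeomorphic_maps_def by auto
  moreover have "continuous_map (top_of_set (snd c ` fst c)) T g"
    using g by (auto simp: homeomorphic_maps_def continuous_map_in_subtopology)
  ultimately show ?thesis
    by (auto intro: continuous_map_eq)
qed

lemma open_continuous_preimage:
  assumes "continuous_map (top_of_set U) T g" "open U" "openin T W"
  shows "open {u \<in> U. g u \<in> W}"
  using openin_continuous_map_preimage[OF assms(1,3)] openin_open_trans[OF _ assms(2)] by simp

lemma manifold_chart: "smooth_manifold M \<Longrightarrow> c \<in> atlas M \<Longrightarrow> is_chart (mtop M) c"
  by (simp add: smooth_manifold_def)

lemma charts_at_iff: "c \<in> charts_at M x \<longleftrightarrow> c \<in> atlas M \<and> x \<in> fst c"
  by (simp add: charts_at_def)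

lemma charts_at_pts: "smooth_manifold M \<Longrightarrow> c \<in> charts_at M x \<Longrightarrow> x \<in> pts M"
  unfolding smooth_manifold_def charts_at_def by auto

lemma chart_at_mem: "smooth_manifold M \<Longrightarrow> x \<in> pts M \<Longrightarrow> chart_at M x \<in> charts_at M x"
  unfolding chart_at_def smooth_manifold_def charts_at_def
  by (rule someI_ex) (metis (mono_tags, lifting) UN_E mem_Collect_eq)

lemma transition_open:
  assumes "smooth_manifold M" "c \<in> charts_at M x" "d \<in> charts_at M x"
  shows "open (snd c ` (fst c \<inter> fst d))" "snd c x \<in> snd c ` (fst c \<inter> fst d)"
    "smooth_on (snd c ` (fst c \<inter> fst d)) (snd d \<circ> chart_inv c)"
proof -
  have "openin (mtop M) (fst d)" "is_chart (mtop M) c"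
    using assms by (auto simp: smooth_manifold_def is_chart_def charts_at_iff)
  then show "open (snd c ` (fst c \<inter> fst d))" by (simp add: chart_image_open)
  show "snd c x \<in> snd c ` (fst c \<inter> fst d)" using assms by (simp add: charts_at_iff)
  show "smooth_on (snd c ` (fst c \<inter> fst d)) (snd d \<circ> chart_inv c)"
    using assms by (auto simp: smooth_manifold_def charts_at_iff)
qed

lemma transition_has_derivative:
  assumes "smooth_manifold M" "c \<in> charts_at M x" "d \<in> charts_at M x"
  shows "((snd d \<circ> chart_inv c) has_derivative frechet_derivative (snd d \<circ> chart_inv c) (at (snd c x)))
    (at (snd c x))"
  using transition_open[OF assms] by (intro smooth_on_has_derivative)

text \<open>The chain rule behind every independence-of-charts statement: applied to a chart it is the
  cocycle rule for tangent vectors, applied to a map or a function it lets tangent maps and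
  differentials be computed in any chart.\<close>

lemma has_derivative_change_chart:
  assumes "smooth_manifold M" "c \<in> charts_at M x" "c' \<in> charts_at M x"
    and g: "((g \<circ> chart_inv c') has_derivative g') (at (snd c' x))"
  shows "((g \<circ> chart_inv c) has_derivative
    (\<lambda>v. g' (frechet_derivative (snd c' \<circ> chart_inv c) (at (snd c x)) v))) (at (snd c x))"
proof -
  note tr = transition_open[OF assms(1-3)]
  have charts: "is_chart (mtop M) c" "is_chart (mtop M) c'"
    using assms(1-3) by (auto simp: charts_at_iff manifold_chart)
  have "(snd c' \<circ> chart_inv c) (snd c x) = snd c' x"
    using assms(2) chart_inv_left[OF charts(1)] by (simp add: charts_at_iff)
  then have "((\<lambda>u. (g \<circ> chart_inv c') ((snd c' \<circ> chart_inv c) u)) has_derivative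
    (\<lambda>v. g' (frechet_derivative (snd c' \<circ> chart_inv c) (at (snd c x)) v))) (at (snd c x))"
    using g by (intro has_derivative_compose[OF transition_has_derivative[OF assms(1-3)]]) metis
  then show ?thesis
    by (rule has_derivative_transform_within_open[OF _ tr(1,2)])
      (auto simp: chart_inv_left[OF charts(1)] chart_inv_left[OF charts(2)])
qed

lemma frechet_derivative_change_chart:
  assumes "smooth_manifold M" "c \<in> charts_at M x" "c' \<in> charts_at M x"
    and "(g \<circ> chart_inv c') differentiable (at (snd c' x))"
  shows "frechet_derivative (g \<circ> chart_inv c) (at (snd c x)) v =
    frechet_derivative (g \<circ> chart_inv c') (at (snd c' x))
      (frechet_derivative (snd c' \<circ> chart_inv c) (at (snd c x)) v)"
  by (rule fun_cong[OF frechet_derivative_at[symmetric]], rule has_derivative_change_chart[OF assms(1-3)])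
    (use assms(4) in \<open>simp only: frechet_derivative_works\<close>)

lemma transition_self:
  assumes "smooth_manifold M" "c \<in> charts_at M x"
  shows "frechet_derivative (snd c \<circ> chart_inv c) (at (snd c x)) v = v"
proof -
  have "((snd c \<circ> chart_inv c) has_derivative (\<lambda>v. v)) (at (snd c x))"
    by (rule has_derivative_transform_within_open[OF has_derivative_ident
          transition_open(1,2)[OF assms assms(2)]])
      (auto simp: chart_inv_right)
  from frechet_derivative_at[OF this] show ?thesis by metis
qed

lemma tvec_of_chart:
  "d \<in> charts_at M x \<Longrightarrow>
    tvec_of M c x v d = frechet_derivative (snd d \<circ> chart_inv c) (at (snd c x)) v"
  by (simp add: tvec_of_def)

text \<open>Tangent vectors at \<open>x\<close> correspond to coordinate vectors in any fixed chart around \<open>x\<close>, through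
  \<open>tvec_of M c x\<close> and evaluation at \<open>c\<close>; this and the next lemmas establish the correspondence.\<close>

lemma tvec_of_self: "smooth_manifold M \<Longrightarrow> c \<in> charts_at M x \<Longrightarrow> tvec_of M c x v c = v"
  by (simp add: tvec_of_chart transition_self)

lemma tvec_of_in_tangent_space:
  assumes "smooth_manifold M" "c \<in> charts_at M x"
  shows "tvec_of M c x v \<in> tangent_space M x"
  unfolding tangent_space_def
proof (intro CollectI conjI ballI allI impI)
  fix d e assume de: "d \<in> charts_at M x" "e \<in> charts_at M x"
  have "(snd e \<circ> chart_inv d) differentiable (at (snd d x))"
    using transition_has_derivative[OF assms(1) de] by (rule differentiableI)
  then show "tvec_of M c x v e = frechet_derivative (snd e \<circ> chart_inv d) (at (snd d x)) (tvec_of M c x v d)"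
    using frechet_derivative_change_chart[OF assms de(1), of "snd e" v] de by (simp add: tvec_of_chart)
qed (simp add: tvec_of_def)

lemma tangent_vector_change_chart:
  "v \<in> tangent_space M x \<Longrightarrow> c \<in> charts_at M x \<Longrightarrow> d \<in> charts_at M x \<Longrightarrow>
    v d = frechet_derivative (snd d \<circ> chart_inv c) (at (snd c x)) (v c)"
  unfolding tangent_space_def by blast

lemma tangent_vector_outside: "v \<in> tangent_space M x \<Longrightarrow> d \<notin> charts_at M x \<Longrightarrow> v d = 0"
  unfolding tangent_space_def by blast

lemma tangent_vector_eq_tvec_of:
  assumes "v \<in> tangent_space M x" "c \<in> charts_at M x"
  shows "v = tvec_of M c x (v c)"
proof
  fix d
  show "v d = tvec_of M c x (v c) d"
    using tangent_vector_change_chart[OF assms, of d] tangent_vector_outside[OF assms(1), of d]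
    unfolding tvec_of_def by presburger
qed

lemma tvec_of_linear:
  assumes "smooth_manifold M" "c \<in> charts_at M x"
  shows "tvec_of M c x (a *\<^sub>R u + b *\<^sub>R v) = (\<lambda>d. a *\<^sub>R tvec_of M c x u d + b *\<^sub>R tvec_of M c x v d)"
proof
  fix d
  show "tvec_of M c x (a *\<^sub>R u + b *\<^sub>R v) d = a *\<^sub>R tvec_of M c x u d + b *\<^sub>R tvec_of M c x v d"
  proof (cases "d \<in> charts_at M x")
    case True
    then show ?thesis
      using has_derivative_linear[OF transition_has_derivative[OF assms True]]
      by (simp add: tvec_of_chart linear_add linear_cmul)
  qed (simp add: tvec_of_def)
qed

lemma linear_form_tvec_of:
  assumes "smooth_manifold M" "c \<in> charts_at M x" "linear_form (tangent_space M x) l"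
  shows "linear (\<lambda>e. l (tvec_of M c x e))"
proof (rule linearI)
  have *: "l (tvec_of M c x (a *\<^sub>R u + b *\<^sub>R v)) = a * l (tvec_of M c x u) + b * l (tvec_of M c x v)" for a b u v
    using assms(3) tvec_of_in_tangent_space[OF assms(1,2)]
    unfolding linear_form_def tvec_of_linear[OF assms(1,2)] by blast
  show "l (tvec_of M c x (u + v)) = l (tvec_of M c x u) + l (tvec_of M c x v)" for u v
    using *[of 1 u 1 v] by simp
  show "l (tvec_of M c x (r *\<^sub>R u)) = r *\<^sub>R l (tvec_of M c x u)" for r u
    using *[of r u 0 0] by simp
qed

lemma smooth_map_in_charts:
  assumes "smooth_map M N f" "c \<in> atlas M" "is_chart (mtop M) c" "d \<in> atlas N" "is_chart (mtop N) d"
  shows "open {u \<in> snd c ` fst c. f (chart_inv c u) \<in> fst d}"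
    "smooth_on {u \<in> snd c ` fst c. f (chart_inv c u) \<in> fst d} (snd d \<circ> f \<circ> chart_inv c)"
proof -
  have "continuous_map (top_of_set (snd c ` fst c)) (mtop N) (f \<circ> chart_inv c)"
    using assms(1) by (intro continuous_map_compose[OF continuous_map_chart_inv[OF assms(3)]])
      (simp add: smooth_map_def)
  then show "open {u \<in> snd c ` fst c. f (chart_inv c u) \<in> fst d}"
    using open_continuous_preimage[of "snd c ` fst c" "mtop N" "f \<circ> chart_inv c" "fst d"] assms(3,5)
    by (auto simp: is_chart_def)
  have "{u \<in> snd c ` fst c. f (chart_inv c u) \<in> fst d} = snd c ` {x \<in> fst c. f x \<in> fst d}"
    using chart_inv_left[OF assms(3)] by auto
  then show "smooth_on {u \<in> snd c ` fst c. f (chart_inv c u) \<in> fst d} (snd d \<circ> f \<circ> chart_inv c)"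
    using assms by (simp add: smooth_map_def)
qed

lemma smooth_map_has_derivative:
  assumes "smooth_manifold M" "smooth_manifold N" "smooth_map M N f"
    "c \<in> charts_at M x" "d \<in> charts_at N (f x)"
  shows "((snd d \<circ> f \<circ> chart_inv c) has_derivative
     frechet_derivative (snd d \<circ> f \<circ> chart_inv c) (at (snd c x))) (at (snd c x))"
proof (rule smooth_on_has_derivative[OF smooth_map_in_charts(2)[OF assms(3)]])
  have c: "is_chart (mtop M) c" using assms by (auto simp: charts_at_iff manifold_chart)
  then show "snd c x \<in> {u \<in> snd c ` fst c. f (chart_inv c u) \<in> fst d}"
    using assms chart_inv_left[OF c] by (auto simp: charts_at_iff)
qed (use assms in \<open>auto simp: charts_at_iff manifold_chart\<close>)

lemma tangent_map_in_chart:
  assumes "smooth_manifold M" "smooth_manifold N" "smooth_map M N f"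
    "c \<in> charts_at M x" "d \<in> charts_at N (f x)" "v \<in> tangent_space M x"
  shows "tangent_map M N f x v d = frechet_derivative (snd d \<circ> f \<circ> chart_inv c) (at (snd c x)) (v c)"
proof -
  let ?c = "chart_at M x"
  have c: "?c \<in> charts_at M x"
    using assms by (meson chart_at_mem charts_at_pts)
  have "v ?c = frechet_derivative (snd ?c \<circ> chart_inv c) (at (snd c x)) (v c)"
    by (rule tangent_vector_change_chart[OF assms(6,4) c])
  then show ?thesis
    using frechet_derivative_change_chart[OF assms(1,4) c, of "snd d \<circ> f"]
      smooth_map_has_derivative[OF assms(1-3) c assms(5)] assms(5)
    by (simp add: tangent_map_def Let_def differentiableI)
qed

lemma tangent_map_eq_tvec_of:
  assumes "smooth_manifold M" "smooth_manifold N" "smooth_map M N f"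
    "c \<in> charts_at M x" "d \<in> charts_at N (f x)" "v \<in> tangent_space M x"
  shows "tangent_map M N f x v = tvec_of N d (f x) (frechet_derivative (snd d \<circ> f \<circ> chart_inv c) (at (snd c x)) (v c))"
proof
  fix e
  show "tangent_map M N f x v e = tvec_of N d (f x) (frechet_derivative (snd d \<circ> f \<circ> chart_inv c) (at (snd c x)) (v c)) e"
  proof (cases "e \<in> charts_at N (f x)")
    case True
    let ?df = "frechet_derivative (snd d \<circ> f \<circ> chart_inv c) (at (snd c x))"
    have charts: "is_chart (mtop M) c" "is_chart (mtop N) d"
      using assms by (auto simp: charts_at_iff manifold_chart)
    have x: "chart_inv c (snd c x) = x"
      using chart_inv_left[OF charts(1)] assms(4) by (simp add: charts_at_iff)
    let ?U = "{u \<in> snd c ` fst c. f (chart_inv c u) \<in> fst d}"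
    have U: "open ?U"
      using assms charts by (intro smooth_map_in_charts) (auto simp: charts_at_iff)
    have xU: "snd c x \<in> ?U" using assms(4,5) x by (simp add: charts_at_iff)
    have "((\<lambda>u. (snd e \<circ> chart_inv d) ((snd d \<circ> f \<circ> chart_inv c) u)) has_derivative
       (\<lambda>v. frechet_derivative (snd e \<circ> chart_inv d) (at (snd d (f x))) (?df v))) (at (snd c x))"
      using transition_has_derivative[OF assms(2,5) True]
      by (intro has_derivative_compose[OF smooth_map_has_derivative[OF assms(1-5)]]) (metis comp_apply x)
    then have "((snd e \<circ> f \<circ> chart_inv c) has_derivative
       (\<lambda>v. frechet_derivative (snd e \<circ> chart_inv d) (at (snd d (f x))) (?df v))) (at (snd c x))"
      by (rule has_derivative_transform_within_open[OF _ U xU]) (simp add: chart_inv_left[OF charts(2)])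
    from frechet_derivative_at[OF this] show ?thesis
      using True by (simp add: tangent_map_in_chart[OF assms(1-4) True assms(6)] tvec_of_chart)
        metis
  qed (simp_all add: tangent_map_def tvec_of_def Let_def)
qed

lemma smooth_fun_in_chart:
  assumes "smooth_manifold M" "smooth_map M (open_mfd U) f" "c \<in> atlas M" "open U"
  shows "smooth_on (snd c ` fst c) (f \<circ> chart_inv c)"
proof -
  have c: "is_chart (mtop M) c" using assms by (simp add: manifold_chart)
  then have sub: "fst c \<subseteq> pts M" by (simp add: is_chart_def openin_subset)
  have "f x \<in> U" if "x \<in> pts M" for x
    using assms(2) that unfolding smooth_map_def open_mfd_def by (auto simp: continuous_map_def)
  then have "{x \<in> fst c. f x \<in> U} = fst c" using sub by auto
  then show ?thesis
    using assms(2,3) by (auto simp: smooth_map_def open_mfd_def)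
qed

lemma snd_chart_mem: "c \<in> charts_at M x \<Longrightarrow> snd c x \<in> snd c ` fst c"
  by (simp add: charts_at_iff)

lemma differential_in_chart:
  assumes "smooth_manifold M" "smooth_map M (open_mfd U) f" "open U" "c \<in> charts_at M x" "v \<in> tangent_space M x"
  shows "differential M f x v = frechet_derivative (f \<circ> chart_inv c) (at (snd c x)) (v c)"
proof -
  let ?c = "chart_at M x"
  have c: "?c \<in> charts_at M x"
    using assms by (meson chart_at_mem charts_at_pts)
  have "v ?c = frechet_derivative (snd ?c \<circ> chart_inv c) (at (snd c x)) (v c)"
    by (rule tangent_vector_change_chart[OF assms(5,4) c])
  moreover have "(f \<circ> chart_inv ?c) differentiable (at (snd ?c x))"
    using c snd_chart_mem[OF c]
    by (intro differentiableI[OF smooth_on_has_derivative[OF smooth_fun_in_chart[OF assms(1,2) _ assms(3)]]])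
      (auto simp: charts_at_iff)
  ultimately show ?thesis
    using frechet_derivative_change_chart[OF assms(1,4) c, of f]
    by (simp add: differential_def Let_def)
qed

text \<open>Knowing the coordinate velocity in one chart suffices, which avoids checking smoothness of
  orbits chart by chart.\<close>

lemma velocity_eq_tvec_of:
  assumes "smooth_manifold M" "c \<in> charts_at M (g t)" "\<forall>\<^sub>F s in nhds t. g s \<in> fst c"
    and g: "((snd c \<circ> g) has_vector_derivative w) (at t)"
  shows "velocity M g t = tvec_of M c (g t) w"
proof
  fix d
  show "velocity M g t d = tvec_of M c (g t) w d"
  proof (cases "d \<in> charts_at M (g t)")
    case True
    have c: "is_chart (mtop M) c" using assms by (auto simp: charts_at_iff manifold_chart)
    let ?D = "frechet_derivative (snd d \<circ> chart_inv c) (at (snd c (g t)))"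
    have D: "((snd d \<circ> chart_inv c) has_derivative ?D) (at ((snd c \<circ> g) t))"
      using transition_has_derivative[OF assms(1,2) True] by simp
    have "((\<lambda>s. (snd d \<circ> chart_inv c) ((snd c \<circ> g) s)) has_derivative (\<lambda>h. ?D (h *\<^sub>R w))) (at t)"
      by (rule has_derivative_compose[OF g[unfolded has_vector_derivative_def] D])
    moreover have "(\<lambda>h. ?D (h *\<^sub>R w)) = (\<lambda>h. h *\<^sub>R ?D w)"
      using has_derivative_linear[OF D] by (simp add: linear_cmul)
    ultimately have 1: "((\<lambda>s. (snd d \<circ> chart_inv c) ((snd c \<circ> g) s)) has_derivative (\<lambda>h. h *\<^sub>R ?D w)) (at t)"
      by simp
    have "\<forall>\<^sub>F s in at t. (snd d \<circ> chart_inv c) ((snd c \<circ> g) s) = (snd d \<circ> g) s"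
      using assms(3) by (auto simp: eventually_at_filter chart_inv_left[OF c] elim: eventually_mono)
    then have "((snd d \<circ> g) has_vector_derivative ?D w) (at t)"
      unfolding has_vector_derivative_def
      using assms(2) by (intro has_derivative_transform_eventually[OF 1])
        (auto simp: charts_at_iff chart_inv_left[OF c])
    then show ?thesis
      using True by (simp add: velocity_def tvec_of_def vector_derivative_at)
  qed (simp add: velocity_def tvec_of_def)
qed

lemma smooth_curve_in_chart:
  assumes "smooth_map (open_mfd I) M g" "open I" "t \<in> I" "smooth_manifold M" "c \<in> charts_at M (g t)"
  shows "\<forall>\<^sub>F s in nhds t. g s \<in> fst c" "((snd c \<circ> g) has_vector_derivative velocity M g t c) (at t)"
proof -
  let ?U = "{s \<in> I. g s \<in> fst c}"
  have "continuous_map (top_of_set I) (mtop M) g" "openin (mtop M) (fst c)"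
    using assms manifold_chart[OF assms(4)] by (auto simp: smooth_map_def open_mfd_def is_chart_def charts_at_iff)
  then have U: "open ?U" using assms(2) by (simp add: open_continuous_preimage)
  have tU: "t \<in> ?U" using assms by (simp add: charts_at_iff)
  show "\<forall>\<^sub>F s in nhds t. g s \<in> fst c"
    using eventually_nhds_in_open[OF U tU] by (auto elim: eventually_mono)
  have "smooth_on ?U (snd c \<circ> g \<circ> chart_inv (I, id))"
    using assms(1,5) by (auto simp: smooth_map_def open_mfd_def charts_at_iff)
  then have "smooth_on ?U (snd c \<circ> g)"
    by (rule smooth_on_cong[OF U]) (simp add: chart_inv_def)
  from smooth_on_has_derivative[OF this tU]
  have "(snd c \<circ> g) differentiable (at t)" by (rule differentiableI)
  then show "((snd c \<circ> g) has_vector_derivative velocity M g t c) (at t)"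
    using assms(5) by (simp add: velocity_def vector_derivative_works[symmetric])
qed

section \<open>Product charts\<close>

lemma chart_preimage_open:
  assumes "is_chart T c" "open B"
  shows "openin T {x \<in> fst c. snd c x \<in> B}"
proof -
  have c: "openin T (fst c)" "homeomorphic_map (subtopology T (fst c)) (top_of_set (snd c ` fst c)) (snd c)"
    using assms(1) by (auto simp: is_chart_def)
  have top: "topspace (subtopology T (fst c)) = fst c"
    using openin_subset[OF c(1)] by auto
  have "continuous_map (subtopology T (fst c)) (top_of_set (snd c ` fst c)) (snd c)"
    using c(2) by (rule homeomorphic_imp_continuous_map)
  moreover have "openin (top_of_set (snd c ` fst c)) (snd c ` fst c \<inter> B)"
    using assms(2) by (rule openin_open_Int)
  ultimately have "openin (subtopology T (fst c))
      {x \<in> topspace (subtopology T (fst c)). snd c x \<in> snd c ` fst c \<inter> B}"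
    by (rule openin_continuous_map_preimage)
  then have "openin (subtopology T (fst c)) {x \<in> fst c. snd c x \<in> snd c ` fst c \<inter> B}"
    by (simp only: top)
  moreover have "{x \<in> fst c. snd c x \<in> snd c ` fst c \<inter> B} = {x \<in> fst c. snd c x \<in> B}" by auto
  ultimately show ?thesis
    using openin_trans_full c(1) by metis
qed

lemma is_chart_open: "open U \<Longrightarrow> is_chart (top_of_set U) (U, id)"
  by (simp add: is_chart_def subtopology_subtopology)

lemma chart_inv_open: "u \<in> U \<Longrightarrow> chart_inv (U, id) u = u"
  by (simp add: chart_inv_def)

lemma is_chart_prod:
  assumes "is_chart T c" "is_chart T' d"
  shows "is_chart (prod_topology T T') (fst c \<times> fst d, map_prod (snd c) (snd d))"
proof -
  have im: "map_prod (snd c) (snd d) ` (fst c \<times> fst d) = (snd c ` fst c) \<times> (snd d ` fst d)"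
    by auto
  obtain g where g: "homeomorphic_maps (subtopology T (fst c)) (top_of_set (snd c ` fst c)) (snd c) g"
    using assms(1) by (auto simp: is_chart_def homeomorphic_map_maps)
  obtain g' where g': "homeomorphic_maps (subtopology T' (fst d)) (top_of_set (snd d ` fst d)) (snd d) g'"
    using assms(2) by (auto simp: is_chart_def homeomorphic_map_maps)
  have "homeomorphic_maps (prod_topology (subtopology T (fst c)) (subtopology T' (fst d)))
     (prod_topology (top_of_set (snd c ` fst c)) (top_of_set (snd d ` fst d)))
     (\<lambda>(x, y). (snd c x, snd d y)) (\<lambda>(x, y). (g x, g' y))"
    using g g' by (simp add: homeomorphic_maps_prod del: prod_topology_subtopology_eu)
  then have "homeomorphic_map (subtopology (prod_topology T T') (fst c \<times> fst d))
      (top_of_set ((snd c ` fst c) \<times> (snd d ` fst d))) (map_prod (snd c) (snd d))"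
    by (auto simp: homeomorphic_map_maps subtopology_Times map_prod_def)
  then show ?thesis
    using assms unfolding is_chart_def by (simp add: im openin_prod_Times_iff open_Times)
qed

lemma chart_inv_prod:
  assumes "is_chart T c" "is_chart T' d" "u \<in> snd c ` fst c" "w \<in> snd d ` fst d"
  shows "chart_inv (fst c \<times> fst d, map_prod (snd c) (snd d)) (u, w) = (chart_inv c u, chart_inv d w)"
  using chart_inv_left[OF is_chart_prod[OF assms(1,2)], of "(chart_inv c u, chart_inv d w)"] assms(3,4)
  by (simp add: chart_inv_mem chart_inv_right)

section \<open>Trivialising the quotient by a scaling function\<close>

locale scaled_bundle =
  fixes G :: "real set"
    and S :: "('a, 'e::euclidean_space) mfd"
    and \<phi> :: "real \<Rightarrow> 'a \<Rightarrow> 'a"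
    and F :: "'a \<Rightarrow> real"
    and C :: "('a set, 'f::euclidean_space) mfd"
  assumes group: "scaling_group G"
    and S: "smooth_manifold S"
    and action: "principal_action G S \<phi>"
    and F: "scaling_function G S \<phi> F"
    and quotient: "quotient_manifold G S \<phi> C"
begin

abbreviation p :: "'a \<Rightarrow> 'a set" where "p \<equiv> quot_map G \<phi>"

definition triv :: "real \<Rightarrow> 'a set \<Rightarrow> 'a" where
  "triv s y = inv_into (pts S) (\<lambda>x. (F x, p x)) (s, y)"

lemma C: "smooth_manifold C"
  using quotient by (simp add: quotient_manifold_def)

lemma smooth_p: "smooth_map S C p"
  using quotient by (simp add: quotient_manifold_def submersion_def)

lemma smooth_F: "smooth_map S (open_mfd G) F"
  using F by (simp add: scaling_function_def)

lemma open_G: "open G"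
  using group by (auto simp: scaling_group_def)

lemma group_simps [simp]: "1 \<in> G" "0 \<notin> G" "s \<in> G \<Longrightarrow> r \<in> G \<Longrightarrow> s * r \<in> G" "s \<in> G \<Longrightarrow> r \<in> G \<Longrightarrow> s / r \<in> G"
  using group by (auto simp: scaling_group_def)

lemma group_nonzero: "s \<in> G \<Longrightarrow> s \<noteq> 0"
  using group_simps(2) by metis

lemma act_pts [simp]: "s \<in> G \<Longrightarrow> x \<in> pts S \<Longrightarrow> \<phi> s x \<in> pts S"
proof -
  have "continuous_map (prod_topology (top_of_set G) (mtop S)) (mtop S) (\<lambda>(s, x). \<phi> s x)"
    using action by (simp add: principal_action_def smooth_map_def prod_mfd_def open_mfd_def)
  then show "s \<in> G \<Longrightarrow> x \<in> pts S \<Longrightarrow> \<phi> s x \<in> pts S"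
    by (auto simp: continuous_map_def Pi_iff)
qed

lemma act_one [simp]: "x \<in> pts S \<Longrightarrow> \<phi> 1 x = x"
  using action by (simp add: principal_action_def)

lemma act_act: "s \<in> G \<Longrightarrow> r \<in> G \<Longrightarrow> x \<in> pts S \<Longrightarrow> \<phi> s (\<phi> r x) = \<phi> (s * r) x"
  using action by (simp add: principal_action_def)

lemma F_act: "s \<in> G \<Longrightarrow> x \<in> pts S \<Longrightarrow> F (\<phi> s x) = s * F x"
  using F by (simp add: scaling_function_def)

lemma F_G [simp]: "x \<in> pts S \<Longrightarrow> F x \<in> G"
  using smooth_F by (auto simp: smooth_map_def open_mfd_def continuous_map_def)

lemma F_nonzero [simp]: "x \<in> pts S \<Longrightarrow> F x \<noteq> 0"
  using F_G group_nonzero by blast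

lemma p_act: "s \<in> G \<Longrightarrow> x \<in> pts S \<Longrightarrow> p (\<phi> s x) = p x"
proof -
  assume s: "s \<in> G" and x: "x \<in> pts S"
  have "\<phi> r (\<phi> s x) \<in> (\<lambda>s. \<phi> s x) ` G" if "r \<in> G" for r
    using s x that by (auto simp: act_act)
  moreover have "\<phi> r x \<in> (\<lambda>r. \<phi> r (\<phi> s x)) ` G" if "r \<in> G" for r
  proof (rule image_eqI)
    show "\<phi> r x = \<phi> (r / s) (\<phi> s x)" using s x that by (simp add: act_act group_nonzero)
  qed (use s that in simp)
  ultimately show ?thesis unfolding quot_map_def by blast
qed

lemma pts_C: "pts C = p ` pts S"
  using quotient by (simp add: quotient_manifold_def)

text \<open>Points with the same image lie on one orbit and differ by a group element \<open>s\<close> with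
  \<open>s * F x = F x\<close>. Conversely \<open>\<phi> (s / F x) x\<close> is the point over \<open>p x\<close> where \<open>F\<close> is \<open>s\<close>.\<close>

lemma bij_triv: "bij_betw (\<lambda>x. (F x, p x)) (pts S) (G \<times> pts C)"
  unfolding bij_betw_def
proof
  show "inj_on (\<lambda>x. (F x, p x)) (pts S)"
  proof (rule inj_onI)
    fix x x' assume x: "x \<in> pts S" "x' \<in> pts S" and eq: "(F x, p x) = (F x', p x')"
    have "\<phi> 1 x' \<in> p x'" unfolding quot_map_def by (rule imageI) simp
    then have "x' \<in> p x" using x eq by simp
    then obtain s where s: "s \<in> G" "x' = \<phi> s x" by (auto simp: quot_map_def)
    then have "s = 1" using eq x F_act[OF s(1) x(1)] by simp
    then show "x = x'" using s x by simp
  qed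
  show "(\<lambda>x. (F x, p x)) ` pts S = G \<times> pts C"
  proof (intro equalityI subsetI)
    fix w assume "w \<in> G \<times> pts C"
    then obtain s x where w: "w = (s, p x)" "s \<in> G" "x \<in> pts S" by (auto simp: pts_C)
    show "w \<in> (\<lambda>x. (F x, p x)) ` pts S"
    proof (rule image_eqI)
      show "w = (F (\<phi> (s / F x) x), p (\<phi> (s / F x) x))"
        using w by (simp add: F_act p_act)
    qed (use w in simp)
  qed (auto simp: pts_C)
qed

lemma triv:
  assumes "s \<in> G" "y \<in> pts C"
  shows "triv s y \<in> pts S" "F (triv s y) = s" "p (triv s y) = y"
proof -
  have w: "(s, y) \<in> (\<lambda>x. (F x, p x)) ` pts S"
    using assms bij_triv by (simp add: bij_betw_def)
  then show "triv s y \<in> pts S" unfolding triv_def by (rule inv_into_into)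
  have "(F (triv s y), p (triv s y)) = (s, y)"
    unfolding triv_def using f_inv_into_f[OF w] by simp
  then show "F (triv s y) = s" "p (triv s y) = y" by auto
qed

lemma triv_eq: "x \<in> pts S \<Longrightarrow> s \<in> G \<Longrightarrow> triv s (p x) = \<phi> (s / F x) x"
proof -
  assume x: "x \<in> pts S" and s: "s \<in> G"
  have "triv s (p x) = inv_into (pts S) (\<lambda>x. (F x, p x)) (F (\<phi> (s / F x) x), p (\<phi> (s / F x) x))"
    using x s by (simp add: triv_def F_act p_act)
  also have "\<dots> = \<phi> (s / F x) x"
    using bij_triv x s by (intro inv_into_f_f) (auto simp: bij_betw_def)
  finally show ?thesis .
qed

lemma triv_F_p: "x \<in> pts S \<Longrightarrow> triv (F x) (p x) = x"
  by (simp add: triv_eq)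

lemma act_triv: "r \<in> G \<Longrightarrow> s \<in> G \<Longrightarrow> y \<in> pts C \<Longrightarrow> \<phi> r (triv s y) = triv (r * s) y"
  using triv[of s y] triv_eq[of "triv s y" "r * s"] by (simp add: group_nonzero)

lemma action_in_charts:
  assumes c: "c \<in> atlas S" and d: "d \<in> atlas S"
  defines "A \<equiv> {w. fst w \<in> G \<and> snd w \<in> snd c ` fst c \<and> \<phi> (fst w) (chart_inv c (snd w)) \<in> fst d}"
  shows "open A" "smooth_on A (\<lambda>w. snd d (\<phi> (fst w) (chart_inv c (snd w))))"
proof -
  let ?k = "(fst (G, id :: real \<Rightarrow> real) \<times> fst c, map_prod (snd (G, id :: real \<Rightarrow> real)) (snd c))"
  have charts: "is_chart (mtop S) c" "is_chart (mtop S) d"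
    using c d S by (auto simp: manifold_chart)
  have k: "?k \<in> atlas (prod_mfd (open_mfd G) S)"
    using c unfolding prod_mfd_def open_mfd_def mfd.simps by blast
  have kc: "is_chart (mtop (prod_mfd (open_mfd G) S)) ?k"
    using is_chart_prod[OF is_chart_open[OF open_G] charts(1)] by (simp add: prod_mfd_def open_mfd_def)
  have sm: "smooth_map (prod_mfd (open_mfd G) S) S (\<lambda>(s, x). \<phi> s x)"
    using action by (simp add: principal_action_def)
  have inv: "chart_inv ?k w = (fst w, chart_inv c (snd w))" if "fst w \<in> G" "snd w \<in> snd c ` fst c" for w
    using chart_inv_prod[OF is_chart_open[OF open_G] charts(1), of "fst w" "snd w"] that
    by (simp add: chart_inv_open)
  have A: "{u \<in> snd ?k ` fst ?k. (\<lambda>(s, x). \<phi> s x) (chart_inv ?k u) \<in> fst d} = A"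
  proof -
    have "snd ?k ` fst ?k = id ` G \<times> snd c ` fst c"
      unfolding fst_conv snd_conv by (rule map_prod_surj_on[OF refl refl])
    then show ?thesis using inv by (auto simp: A_def)
  qed
  note * = smooth_map_in_charts[OF sm k kc d charts(2), unfolded A]
  then show "open A" by simp
  show "smooth_on A (\<lambda>w. snd d (\<phi> (fst w) (chart_inv c (snd w))))"
    using *(2) by (rule smooth_on_cong[OF *(1)]) (use inv in \<open>simp add: A_def\<close>)
qed

text \<open>The tangent map of \<open>p\<close> is onto, hence so is its coordinate expression, and the Euclidean local
  section applies; \<open>\<sigma>\<close> is its expression in the charts \<open>c\<close> and \<open>e\<close>.\<close>

lemma local_section:
  assumes "x \<in> pts S" "c \<in> charts_at S x" "e \<in> charts_at C (p x)"
  obtains V \<sigma> where "open V" "snd e (p x) \<in> V" "V \<subseteq> snd e ` fst e" "smooth_on V \<sigma>"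
    "\<sigma> ` V \<subseteq> snd c ` fst c" "\<And>z. z \<in> V \<Longrightarrow> p (chart_inv c (\<sigma> z)) = chart_inv e z"
    "\<sigma> (snd e (p x)) = snd c x"
proof -
  let ?f = "snd e \<circ> p \<circ> chart_inv c"
  let ?U = "{u \<in> snd c ` fst c. p (chart_inv c u) \<in> fst e}"
  have charts: "c \<in> atlas S" "is_chart (mtop S) c" "e \<in> atlas C" "is_chart (mtop C) e"
    using assms S C by (auto simp: charts_at_iff manifold_chart)
  note U = smooth_map_in_charts[OF smooth_p charts]
  have x: "chart_inv c (snd c x) = x"
    using assms by (simp add: chart_inv_left[OF charts(2)] charts_at_iff)
  have xU: "snd c x \<in> ?U" using assms by (simp add: x charts_at_iff)
  have px: "?f (snd c x) = snd e (p x)" by (simp add: x)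
  have "surj (frechet_derivative ?f (at (snd c x)))"
  proof (rule surjI)
    fix w
    have "tvec_of C e (p x) w \<in> tangent_map S C p x ` tangent_space S x"
      using quotient assms tvec_of_in_tangent_space[OF C assms(3)]
      by (simp add: quotient_manifold_def submersion_def)
    then obtain v where "v \<in> tangent_space S x" "tvec_of C e (p x) w = tangent_map S C p x v"
      by blast
    then have "\<exists>v\<in>tangent_space S x. tangent_map S C p x v e = w"
      using tvec_of_self[OF C assms(3), of w] by metis
    then have "\<exists>v. frechet_derivative ?f (at (snd c x)) v = w"
      using tangent_map_in_chart[OF S C smooth_p assms(2,3)] by metis
    then show "frechet_derivative ?f (at (snd c x)) (SOME v. frechet_derivative ?f (at (snd c x)) v = w) = w"
      by (rule someI_ex)
  qed
  then obtain V \<sigma> where V: "open V" "?f (snd c x) \<in> V" "smooth_on V \<sigma>" "\<sigma> ` V \<subseteq> ?U"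
    "\<And>z. z \<in> V \<Longrightarrow> ?f (\<sigma> z) = z" "\<sigma> (?f (snd c x)) = snd c x"
    by (rule smooth_local_section[OF U xU]) (rule that)
  show thesis
  proof (rule that[OF V(1) V(2)[unfolded px] _ V(3) _ _ V(6)[unfolded px]])
    show "\<sigma> ` V \<subseteq> snd c ` fst c" using V(4) by blast
    have mem: "p (chart_inv c (\<sigma> z)) \<in> fst e" if "z \<in> V" for z
      using V(4) that by blast
    have val: "snd e (p (chart_inv c (\<sigma> z))) = z" if "z \<in> V" for z
      using V(5)[OF that] by simp
    show "V \<subseteq> snd e ` fst e" using mem val by (metis image_eqI subsetI)
    show "p (chart_inv c (\<sigma> z)) = chart_inv e z" if "z \<in> V" for z
      using chart_inv_left[OF charts(4) mem[OF that]] val[OF that] by simp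
  qed
qed

text \<open>The key to smoothness of the inverse trivialisation. The section is taken through the point
  \<open>triv s0 y0\<close> itself: then the group element that moves it to that point is \<open>1\<close>, so one chart
  \<open>c\<close> serves both before and after the action.\<close>

lemma triv_in_charts:
  assumes "s0 \<in> G" "e \<in> charts_at C y0" "c \<in> charts_at S (triv s0 y0)"
  obtains W where "open W" "(s0, snd e y0) \<in> W" "W \<subseteq> G \<times> snd e ` fst e"
    "\<And>w. w \<in> W \<Longrightarrow> triv (fst w) (chart_inv e (snd w)) \<in> fst c"
    "smooth_on W (\<lambda>w. snd c (triv (fst w) (chart_inv e (snd w))))"
proof -
  define x where "x = triv s0 y0"
  have y0: "y0 \<in> pts C" using charts_at_pts[OF C assms(2)] .
  have x: "x \<in> pts S" "F x = s0" "p x = y0" using triv[OF assms(1) y0] by (auto simp: x_def)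
  have c: "c \<in> charts_at S x" using assms(3) by (simp add: x_def)
  have e: "e \<in> charts_at C (p x)" using assms(2) x by simp
  have charts: "c \<in> atlas S" "is_chart (mtop S) c" using c S by (auto simp: charts_at_iff manifold_chart)
  have cS: "fst c \<subseteq> pts S" using charts(2) by (simp add: is_chart_def openin_subset)
  obtain V \<sigma> where V: "open V" "snd e (p x) \<in> V" "V \<subseteq> snd e ` fst e" "smooth_on V \<sigma>"
    "\<sigma> ` V \<subseteq> snd c ` fst c" "\<And>z. z \<in> V \<Longrightarrow> p (chart_inv c (\<sigma> z)) = chart_inv e z"
    "\<sigma> (snd e (p x)) = snd c x"
    using local_section[OF x(1) c e] by metis
  define A where "A = {w. fst w \<in> G \<and> snd w \<in> snd c ` fst c \<and> \<phi> (fst w) (chart_inv c (snd w)) \<in> fst c}"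
  note A = action_in_charts[OF charts(1) charts(1), folded A_def]
  have \<sigma>S: "chart_inv c (\<sigma> z) \<in> pts S" if "z \<in> V" for z
    using chart_inv_mem[of "\<sigma> z" c] V(5) cS that by blast
  define f where "f w = F (chart_inv c (\<sigma> (snd w)))" for w :: "real \<times> 'f"
  define g where "g w = (fst w / f w, \<sigma> (snd w))" for w :: "real \<times> 'f"
  have GV: "open (G \<times> V)" using open_G V(1) by (rule open_Times)
  have sm\<sigma>: "smooth_on (G \<times> V) (\<lambda>w. \<sigma> (snd w))"
    by (rule smooth_on_compose[OF GV V(1) _ smooth_on_linear_image[OF GV bounded_linear_snd smooth_on_ident] V(4)])
      auto
  have opc: "open (snd c ` fst c)" using charts(2) by (simp add: is_chart_def)
  have "smooth_on (G \<times> V) (\<lambda>w. (F \<circ> chart_inv c) (\<sigma> (snd w)))"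
    by (rule smooth_on_compose[OF GV opc _ sm\<sigma> smooth_fun_in_chart[OF S smooth_F charts(1) open_G]])
      (use V(5) in auto)
  then have smf: "smooth_on (G \<times> V) f"
    by (simp add: f_def[abs_def])
  have fG: "f w \<in> G" if "w \<in> G \<times> V" for w
    using \<sigma>S[of "snd w"] that by (auto simp: f_def)
  have smg: "smooth_on (G \<times> V) g"
    unfolding g_def
    by (intro smooth_on_Pair smooth_on_divide sm\<sigma> smf GV group_nonzero fG
        smooth_on_linear_image[OF GV bounded_linear_fst smooth_on_ident])
  define W where "W = (G \<times> V) \<inter> g -` A"
  have W: "open W"
    unfolding W_def using smooth_on_imp_continuous[OF smg] GV A(1) by (rule continuous_open_preimage)
  have eq: "triv (fst w) (chart_inv e (snd w)) = \<phi> (fst (g w)) (chart_inv c (snd (g w)))" if "w \<in> G \<times> V" for w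
    using triv_eq[OF \<sigma>S, of "snd w" "fst w"] V(6)[of "snd w"] that by (auto simp: g_def f_def)
  show thesis
  proof (rule that[OF W])
    have "chart_inv c (snd c x) = x"
      using c by (simp add: chart_inv_left[OF charts(2)] charts_at_iff)
    then have "g (s0, snd e y0) = (1, snd c x)" "\<phi> 1 x \<in> fst c"
      using V(7) x c assms(1) by (auto simp: g_def f_def group_nonzero charts_at_iff)
    then show "(s0, snd e y0) \<in> W"
      using V(2) x assms(1) c \<open>chart_inv c (snd c x) = x\<close> by (simp add: W_def A_def charts_at_iff)
    show "W \<subseteq> G \<times> snd e ` fst e" using V(3) by (auto simp: W_def)
    show "triv (fst w) (chart_inv e (snd w)) \<in> fst c" if "w \<in> W" for w
      using eq[of w] that by (auto simp: W_def A_def)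
    have "smooth_on W (\<lambda>w. snd c (\<phi> (fst (g w)) (chart_inv c (snd (g w)))))"
      by (rule smooth_on_compose[OF W A(1) _ smooth_on_subset[OF smg] A(2)]) (auto simp: W_def)
    then show "smooth_on W (\<lambda>w. snd c (triv (fst w) (chart_inv e (snd w))))"
      by (rule smooth_on_cong[OF W]) (use eq in \<open>auto simp: W_def\<close>)
  qed
qed

lemma smooth_triv: "smooth_map (prod_mfd (open_mfd G) C) S (\<lambda>w. triv (fst w) (snd w))"
  unfolding smooth_map_def
proof (intro conjI ballI)
  have top: "mtop (prod_mfd (open_mfd G) C) = prod_topology (top_of_set G) (mtop C)"
    by (simp add: prod_mfd_def open_mfd_def)
  show "continuous_map (mtop (prod_mfd (open_mfd G) C)) (mtop S) (\<lambda>w. triv (fst w) (snd w))"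
    unfolding continuous_map_eq_topcontinuous_at topcontinuous_at_def top
  proof (intro ballI conjI allI impI)
    fix w V assume "w \<in> topspace (prod_topology (top_of_set G) (mtop C))"
      and V: "openin (mtop S) V \<and> triv (fst w) (snd w) \<in> V"
    then obtain s y where w: "w = (s, y)" "s \<in> G" "y \<in> pts C" by auto
    let ?e = "chart_at C y" and ?c = "chart_at S (triv s y)"
    have e: "?e \<in> charts_at C y" and c: "?c \<in> charts_at S (triv s y)"
      using w C S triv by (auto intro: chart_at_mem)
    have charts: "is_chart (mtop C) ?e" "is_chart (mtop S) ?c"
      using e c C S by (auto simp: charts_at_iff manifold_chart)
    obtain W where W: "open W" "(s, snd ?e y) \<in> W" "W \<subseteq> G \<times> snd ?e ` fst ?e"
      "\<And>w. w \<in> W \<Longrightarrow> triv (fst w) (chart_inv ?e (snd w)) \<in> fst ?c"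
      "smooth_on W (\<lambda>w. snd ?c (triv (fst w) (chart_inv ?e (snd w))))"
      by (rule triv_in_charts[OF w(2) e c]) (rule that)
    let ?W = "W \<inter> (\<lambda>w. snd ?c (triv (fst w) (chart_inv ?e (snd w)))) -` (snd ?c ` (fst ?c \<inter> V))"
    have "open ?W"
      using smooth_on_imp_continuous[OF W(5)] W(1) chart_image_open[OF charts(2)] V
      by (blast intro: continuous_open_preimage)
    moreover have "(s, snd ?e y) \<in> ?W"
      using W(2) W(4)[OF W(2)] V w e by (simp add: chart_inv_left[OF charts(1)] charts_at_iff)
    ultimately obtain A B where AB: "open A" "open B" "(s, snd ?e y) \<in> A \<times> B" "A \<times> B \<subseteq> ?W"
      by (rule open_prod_elim)
    \<comment> \<open>a product neighbourhood on which the coordinate expression stays in the image of \<open>V\<close>\<close>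
    let ?N = "(G \<inter> A) \<times> {y \<in> fst ?e. snd ?e y \<in> B}"
    have "openin (prod_topology (top_of_set G) (mtop C)) ?N"
      using AB by (auto simp: openin_prod_Times_iff chart_preimage_open[OF charts(1)] openin_open_Int)
    moreover have "w \<in> ?N" using w AB(3) e by (auto simp: charts_at_iff)
    moreover have "triv (fst v) (snd v) \<in> V" if "v \<in> ?N" for v
    proof -
      have v: "(fst v, snd ?e (snd v)) \<in> ?W" "snd v \<in> fst ?e" using that AB(4) by auto
      then have 1: "triv (fst v) (snd v) \<in> fst ?c"
        using W(4)[of "(fst v, snd ?e (snd v))"] by (simp add: chart_inv_left[OF charts(1)])
      have "snd ?c (triv (fst v) (snd v)) \<in> snd ?c ` (fst ?c \<inter> V)"
        using v(1) unfolding Int_iff vimage_eq fst_conv snd_conv chart_inv_left[OF charts(1) v(2)]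
        by (rule conjunct2)
      then obtain x where x: "x \<in> fst ?c" "x \<in> V" "snd ?c (triv (fst v) (snd v)) = snd ?c x"
        by (elim imageE IntE) (rule that)
      have "triv (fst v) (snd v) = x"
        by (rule trans[OF trans[OF chart_inv_left[OF charts(2) 1, symmetric]
                arg_cong[OF x(3), of "chart_inv ?c"]] chart_inv_left[OF charts(2) x(1)]])
      then show ?thesis using x(2) by simp
    qed
    ultimately show "\<exists>U. openin (prod_topology (top_of_set G) (mtop C)) U \<and> w \<in> U \<and>
        (\<forall>y\<in>U. triv (fst y) (snd y) \<in> V)" by blast
  qed (use triv in auto)
next
  fix k c assume k: "k \<in> atlas (prod_mfd (open_mfd G) C)" and c: "c \<in> atlas S"
  from k obtain e where e: "e \<in> atlas C" and k_eq: "k = (fst (G, id :: real \<Rightarrow> real) \<times> fst e, map_prod (snd (G, id :: real \<Rightarrow> real)) (snd e))"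
    by (auto simp: prod_mfd_def open_mfd_def)
  have charts: "is_chart (mtop C) e" "is_chart (mtop S) c"
    using e c C S by (auto simp: manifold_chart)
  have inv: "chart_inv k w = (fst w, chart_inv e (snd w))" if "fst w \<in> G" "snd w \<in> snd e ` fst e" for w
    using chart_inv_prod[OF is_chart_open[OF open_G] charts(1), of "fst w" "snd w"] that
    by (simp add: chart_inv_open k_eq)
  show "smooth_on (snd k ` {x \<in> fst k. triv (fst x) (snd x) \<in> fst c})
      (snd c \<circ> (\<lambda>w. triv (fst w) (snd w)) \<circ> chart_inv k)"
  proof (rule smooth_on_locally)
    fix u assume "u \<in> snd k ` {x \<in> fst k. triv (fst x) (snd x) \<in> fst c}"
    then obtain s y where u: "u = (s, snd e y)" "s \<in> G" "y \<in> fst e" "triv s y \<in> fst c"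
      by (auto simp: k_eq)
    obtain W where W: "open W" "(s, snd e y) \<in> W" "W \<subseteq> G \<times> snd e ` fst e"
      "\<And>w. w \<in> W \<Longrightarrow> triv (fst w) (chart_inv e (snd w)) \<in> fst c"
      "smooth_on W (\<lambda>w. snd c (triv (fst w) (chart_inv e (snd w))))"
      using triv_in_charts[of s e y c] u e c by (auto simp: charts_at_iff)
    have "smooth_on W (snd c \<circ> (\<lambda>w. triv (fst w) (snd w)) \<circ> chart_inv k)"
      using W(5) by (rule smooth_on_cong[OF W(1)]) (use W(3) inv in force)
    then show "\<exists>V. open V \<and> u \<in> V \<and> smooth_on V (snd c \<circ> (\<lambda>w. triv (fst w) (snd w)) \<circ> chart_inv k)"
      using W u by blast
  qed
qed

lemma smooth_F_p: "smooth_map S (prod_mfd (open_mfd G) C) (\<lambda>x. (F x, p x))"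
  unfolding smooth_map_def
proof (intro conjI ballI)
  have "continuous_map (mtop S) (top_of_set G) F" "continuous_map (mtop S) (mtop C) p"
    using smooth_F smooth_p by (auto simp: smooth_map_def open_mfd_def)
  then show "continuous_map (mtop S) (mtop (prod_mfd (open_mfd G) C)) (\<lambda>x. (F x, p x))"
    by (simp add: prod_mfd_def open_mfd_def continuous_map_pairedI)
next
  fix c k assume c: "c \<in> atlas S" and k: "k \<in> atlas (prod_mfd (open_mfd G) C)"
  from k obtain e where e: "e \<in> atlas C" and k_eq: "k = (fst (G, id :: real \<Rightarrow> real) \<times> fst e, map_prod (snd (G, id :: real \<Rightarrow> real)) (snd e))"
    by (auto simp: prod_mfd_def open_mfd_def)
  have charts: "is_chart (mtop C) e" "is_chart (mtop S) c"
    using e c C S by (auto simp: manifold_chart)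
  have cS: "fst c \<subseteq> pts S" using charts(2) by (simp add: is_chart_def openin_subset)
  let ?U = "{u \<in> snd c ` fst c. p (chart_inv c u) \<in> fst e}"
  note U = smooth_map_in_charts[OF smooth_p c charts(2) e charts(1)]
  have "smooth_on ?U (\<lambda>u. ((F \<circ> chart_inv c) u, (snd e \<circ> p \<circ> chart_inv c) u))"
    by (rule smooth_on_Pair[OF U(1) smooth_on_subset[OF smooth_fun_in_chart[OF S smooth_F c open_G]] U(2)])
      auto
  moreover have "snd c ` {x \<in> fst c. (F x, p x) \<in> fst k} = ?U"
    using chart_inv_left[OF charts(2)] cS by (auto simp: k_eq)
  ultimately show "smooth_on (snd c ` {x \<in> fst c. (F x, p x) \<in> fst k}) (snd k \<circ> (\<lambda>x. (F x, p x)) \<circ> chart_inv c)"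
    by (simp add: k_eq comp_def)
qed

theorem trivialisation: "diffeomorphism S (prod_mfd (open_mfd G) C) (\<lambda>x. (F x, p x))"
  unfolding diffeomorphism_def
proof (intro conjI smooth_F_p)
  show "bij_betw (\<lambda>x. (F x, p x)) (pts S) (pts (prod_mfd (open_mfd G) C))"
    using bij_triv by (simp add: prod_mfd_def open_mfd_def)
  have "inv_into (pts S) (\<lambda>x. (F x, p x)) = (\<lambda>w. triv (fst w) (snd w))"
    by (simp add: triv_def)
  then show "smooth_map (prod_mfd (open_mfd G) C) S (inv_into (pts S) (\<lambda>x. (F x, p x)))"
    using smooth_triv by simp
qed

end

section \<open>The symplectic form in trivialising coordinates\<close>

lemma bilinear_two_form_in_chart:
  assumes "smooth_manifold M" "two_form M \<beta>" "c \<in> charts_at M x"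
  shows "bilinear (\<lambda>u v. \<beta> x (tvec_of M c x u) (tvec_of M c x v))"
proof -
  have x: "x \<in> pts M" using assms by (auto intro: charts_at_pts)
  have T: "tvec_of M c x u \<in> tangent_space M x" for u
    using tvec_of_in_tangent_space[OF assms(1,3)] .
  have right: "linear (\<lambda>v. \<beta> x (tvec_of M c x u) (tvec_of M c x v))" for u
    using assms(2) x T by (intro linear_form_tvec_of[OF assms(1,3)]) (auto simp: two_form_def)
  have "\<beta> x (tvec_of M c x u) (tvec_of M c x v) = - \<beta> x (tvec_of M c x v) (tvec_of M c x u)" for u v
    using assms(2) x T unfolding two_form_def by blast
  then have "(\<lambda>u. \<beta> x (tvec_of M c x u) (tvec_of M c x v)) = (\<lambda>u. - \<beta> x (tvec_of M c x v) (tvec_of M c x u))" for v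
    by (rule ext)
  then show ?thesis
    unfolding bilinear_def using right by (simp add: linear_compose_neg)
qed

context scaled_bundle
begin

lemma smooth_act:
  assumes "r \<in> G"
  shows "smooth_map S S (\<phi> r)"
  unfolding smooth_map_def
proof (intro conjI ballI)
  have "continuous_map (prod_topology (top_of_set G) (mtop S)) (mtop S) (\<lambda>(s, x). \<phi> s x)"
    using action by (simp add: principal_action_def smooth_map_def prod_mfd_def open_mfd_def)
  moreover have "continuous_map (mtop S) (prod_topology (top_of_set G) (mtop S)) (\<lambda>x. (r, x))"
    using assms by (intro continuous_map_pairedI) auto
  ultimately have "continuous_map (mtop S) (mtop S) ((\<lambda>(s, x). \<phi> s x) \<circ> (\<lambda>x. (r, x)))"
    by (intro continuous_map_compose)
  then show "continuous_map (mtop S) (mtop S) (\<phi> r)" by (simp add: comp_def)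
next
  fix c d assume cd: "c \<in> atlas S" "d \<in> atlas S"
  have c: "is_chart (mtop S) c" using cd S by (simp add: manifold_chart)
  define A where "A = {w. fst w \<in> G \<and> snd w \<in> snd c ` fst c \<and> \<phi> (fst w) (chart_inv c (snd w)) \<in> fst d}"
  note A = action_in_charts[OF cd, folded A_def]
  let ?i = "\<lambda>u. (r, u)"
  have i: "smooth_on UNIV ?i"
    by (rule smooth_on_Pair[OF open_UNIV smooth_on_const smooth_on_ident])
  have V: "open (?i -` A)"
    by (rule open_vimage[OF A(1)]) (intro continuous_intros)
  have "smooth_on (?i -` A) (\<lambda>u. snd d (\<phi> (fst (?i u)) (chart_inv c (snd (?i u)))))"
    by (rule smooth_on_compose[OF V A(1) _ smooth_on_subset[OF i] A(2)]) auto
  moreover have "snd c ` {x \<in> fst c. \<phi> r x \<in> fst d} = ?i -` A"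
    using chart_inv_left[OF c] assms by (auto simp: A_def)
  ultimately show "smooth_on (snd c ` {x \<in> fst c. \<phi> r x \<in> fst d}) (snd d \<circ> \<phi> r \<circ> chart_inv c)"
    by (simp add: comp_def)
qed

end

text \<open>\<open>W\<close> is a domain on which the inverse trivialisation has a smooth expression \<open>\<Psi>\<close> in the charts
  \<open>c\<close> of \<open>S\<close> and \<open>d\<close> of \<open>C\<close>. The vectors \<open>T w a\<close> are the images of constant coordinate vectors
  \<open>a\<close> under its tangent map.\<close>

locale trivialising_charts = scaled_bundle G S \<phi> F C
  for G :: "real set"
    and S :: "('a, 'e::euclidean_space) mfd"
    and \<phi> :: "real \<Rightarrow> 'a \<Rightarrow> 'a"
    and F :: "'a \<Rightarrow> real"
    and C :: "('a set, 'f::euclidean_space) mfd" +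
  fixes c :: "('a, 'e) chart" and d :: "('a set, 'f) chart" and W :: "(real \<times> 'f) set"
  assumes c: "c \<in> atlas S" and d: "d \<in> atlas C"
    and W: "open W" "W \<subseteq> G \<times> snd d ` fst d"
    and W_c: "\<And>w. w \<in> W \<Longrightarrow> triv (fst w) (chart_inv d (snd w)) \<in> fst c"
    and W_smooth: "smooth_on W (\<lambda>w. snd c (triv (fst w) (chart_inv d (snd w))))"
begin

abbreviation base :: "real \<times> 'f \<Rightarrow> 'a set" where "base w \<equiv> chart_inv d (snd w)"
abbreviation pt :: "real \<times> 'f \<Rightarrow> 'a" where "pt w \<equiv> triv (fst w) (base w)"
abbreviation \<Psi> :: "real \<times> 'f \<Rightarrow> 'e" where "\<Psi> w \<equiv> snd c (pt w)"
abbreviation d\<Psi> :: "real \<times> 'f \<Rightarrow> real \<times> 'f \<Rightarrow> 'e" where "d\<Psi> w \<equiv> frechet_derivative \<Psi> (at w)"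
abbreviation T :: "real \<times> 'f \<Rightarrow> real \<times> 'f \<Rightarrow> ('a, 'e) tvec" where
  "T w a \<equiv> tvec_of S c (pt w) (d\<Psi> w a)"

lemma cc: "is_chart (mtop S) c" and dc: "is_chart (mtop C) d"
  using c d S C by (auto simp: manifold_chart)

lemma pt:
  assumes "w \<in> W"
  shows "fst w \<in> G" "snd w \<in> snd d ` fst d" "d \<in> charts_at C (base w)" "base w \<in> pts C" "pt w \<in> pts S"
    "F (pt w) = fst w" "p (pt w) = base w" "c \<in> charts_at S (pt w)" "snd d (base w) = snd w"
    "chart_inv c (\<Psi> w) = pt w" "\<Psi> w \<in> snd c ` fst c"
proof -
  show 1: "fst w \<in> G" "snd w \<in> snd d ` fst d" using assms W by auto
  then show 2: "d \<in> charts_at C (base w)" using d by (simp add: charts_at_iff chart_inv_mem)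
  then show 3: "base w \<in> pts C" by (rule charts_at_pts[OF C])
  show "pt w \<in> pts S" "F (pt w) = fst w" "p (pt w) = base w" using triv[OF 1(1) 3] by auto
  show "c \<in> charts_at S (pt w)" using c W_c[OF assms] by (simp add: charts_at_iff)
  show "snd d (base w) = snd w" using 1 by (simp add: chart_inv_right)
  show "chart_inv c (\<Psi> w) = pt w" "\<Psi> w \<in> snd c ` fst c"
    using W_c[OF assms] by (auto simp: chart_inv_left[OF cc])
qed

lemma \<Psi>_has_derivative: "w \<in> W \<Longrightarrow> (\<Psi> has_derivative d\<Psi> w) (at w)"
  using W_smooth by (rule smooth_on_has_derivative)

lemma T_tangent: "w \<in> W \<Longrightarrow> T w a \<in> tangent_space S (pt w)"
  by (intro tvec_of_in_tangent_space S pt)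

text \<open>Derivatives of functions on \<open>S\<close> in the directions \<open>T w a\<close> are read off from their expression
  in the coordinates \<open>(s, z)\<close>; there \<open>F\<close> is \<open>fst\<close>, \<open>p\<close> is \<open>snd\<close> and \<open>H\<close> is \<open>s h\<close>.\<close>

lemma derivative_along_\<Psi>:
  fixes g :: "'e \<Rightarrow> 'z::real_normed_vector"
  assumes w: "w \<in> W" and g: "(g has_derivative g') (at (\<Psi> w))"
    and k: "(k has_derivative k') (at w)" and eq: "\<And>w. w \<in> W \<Longrightarrow> g (\<Psi> w) = k w"
  shows "g' (d\<Psi> w a) = k' a"
proof -
  have "((\<lambda>w. g (\<Psi> w)) has_derivative (\<lambda>a. g' (d\<Psi> w a))) (at w)"
    by (rule has_derivative_compose[OF \<Psi>_has_derivative[OF w] g])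
  then have "(k has_derivative (\<lambda>a. g' (d\<Psi> w a))) (at w)"
    by (rule has_derivative_transform_within_open[OF _ W(1) w eq])
  from has_derivative_unique[OF this k] show ?thesis by meson
qed

lemma F_rep_has_derivative:
  "w \<in> W \<Longrightarrow> ((F \<circ> chart_inv c) has_derivative frechet_derivative (F \<circ> chart_inv c) (at (\<Psi> w))) (at (\<Psi> w))"
  by (rule smooth_on_has_derivative[OF smooth_fun_in_chart[OF S smooth_F c open_G] pt(11)])

lemma p_rep_has_derivative:
  "w \<in> W \<Longrightarrow> ((snd d \<circ> p \<circ> chart_inv c) has_derivative
     frechet_derivative (snd d \<circ> p \<circ> chart_inv c) (at (\<Psi> w))) (at (\<Psi> w))"
  using pt[of w] by (intro smooth_map_has_derivative[OF S C smooth_p]) auto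

lemma tangent_p_T: "w \<in> W \<Longrightarrow> tangent_map S C p (pt w) (T w a) = tvec_of C d (base w) (snd a)"
proof -
  assume w: "w \<in> W"
  note ptw = pt[OF w]
  have "frechet_derivative (snd d \<circ> p \<circ> chart_inv c) (at (\<Psi> w)) (d\<Psi> w a) = snd a"
    by (rule derivative_along_\<Psi>[OF w p_rep_has_derivative[OF w] has_derivative_snd[OF has_derivative_ident]])
      (simp add: pt)
  moreover have "T w a c = d\<Psi> w a"
    by (rule tvec_of_self[OF S ptw(8)])
  moreover have "d \<in> charts_at C (p (pt w))" using ptw by simp
  ultimately show ?thesis
    using tangent_map_eq_tvec_of[OF S C smooth_p ptw(8) _ T_tangent[OF w], of d a] ptw(7) by simp
qed

text \<open>The generator is \<open>s \<partial>\<^sub>s\<close>, since the action by \<open>r\<close> is \<open>(s, y) \<mapsto> (r s, y)\<close>.\<close>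

lemma generator_eq: "w \<in> W \<Longrightarrow> generator S \<phi> (pt w) = tvec_of S c (pt w) (fst w *\<^sub>R d\<Psi> w (1, 0))"
proof -
  assume w: "w \<in> W"
  note ptw = pt[OF w]
  define \<iota> where "\<iota> r = (r * fst w, snd w)" for r
  let ?V = "G \<inter> \<iota> -` W"
  have V: "open ?V"
    unfolding \<iota>_def by (intro open_Int open_G open_vimage W(1) continuous_intros)
  have V1: "1 \<in> ?V" using w by (simp add: \<iota>_def)
  have act: "\<phi> r (pt w) = pt (\<iota> r)" if "r \<in> ?V" for r
    using act_triv[of r "fst w" "base w"] that ptw by (simp add: \<iota>_def)
  have "(\<iota> has_derivative (\<lambda>h. (h * fst w, 0))) (at 1)"
    unfolding \<iota>_def by (auto intro!: derivative_eq_intros)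
  moreover have "(\<Psi> has_derivative d\<Psi> w) (at (\<iota> 1))"
    using \<Psi>_has_derivative[OF w] by (simp add: \<iota>_def)
  ultimately have "((\<lambda>r. \<Psi> (\<iota> r)) has_derivative (\<lambda>h. d\<Psi> w (h * fst w, 0))) (at 1)"
    by (rule has_derivative_compose)
  moreover have "d\<Psi> w (h * fst w, 0) = h *\<^sub>R (fst w *\<^sub>R d\<Psi> w (1, 0))" for h
    using linear_cmul[OF has_derivative_linear[OF \<Psi>_has_derivative[OF w]], of "h * fst w" "(1, 0)"]
    by simp
  ultimately have "((\<lambda>r. \<Psi> (\<iota> r)) has_derivative (\<lambda>h. h *\<^sub>R (fst w *\<^sub>R d\<Psi> w (1, 0)))) (at 1)"
    by simp
  then have "((snd c \<circ> (\<lambda>r. \<phi> r (pt w))) has_vector_derivative fst w *\<^sub>R d\<Psi> w (1, 0)) (at 1)"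
    unfolding has_vector_derivative_def
    by (rule has_derivative_transform_within_open[OF _ V V1]) (simp add: act)
  moreover have "\<forall>\<^sub>F r in nhds 1. \<phi> r (pt w) \<in> fst c"
    using eventually_nhds_in_open[OF V V1] by eventually_elim (simp add: act W_c)
  ultimately have "velocity S (\<lambda>r. \<phi> r (pt w)) 1 = tvec_of S c (\<phi> 1 (pt w)) (fst w *\<^sub>R d\<Psi> w (1, 0))"
    using ptw by (intro velocity_eq_tvec_of[OF S]) simp_all
  then show ?thesis using ptw(5) by (simp add: generator_def)
qed

text \<open>The components of a tangent vector in the trivialisation are its images under \<open>dF\<close> and \<open>dp\<close>.\<close>

lemma \<Psi>_reconstruct:
  assumes w: "w \<in> W"
  shows "u = d\<Psi> w (frechet_derivative (F \<circ> chart_inv c) (at (\<Psi> w)) u,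
    frechet_derivative (snd d \<circ> p \<circ> chart_inv c) (at (\<Psi> w)) u)"
proof -
  note ptw = pt[OF w]
  let ?k = "\<lambda>u. ((F \<circ> chart_inv c) u, (snd d \<circ> p \<circ> chart_inv c) u)"
  let ?U = "{u \<in> snd c ` fst c. p (chart_inv c u) \<in> fst d}"
  have k: "(?k has_derivative (\<lambda>u. (frechet_derivative (F \<circ> chart_inv c) (at (\<Psi> w)) u,
    frechet_derivative (snd d \<circ> p \<circ> chart_inv c) (at (\<Psi> w)) u))) (at (\<Psi> w))"
    by (intro has_derivative_Pair F_rep_has_derivative p_rep_has_derivative w)
  have kw: "?k (\<Psi> w) = w" using ptw by simp
  have "((\<lambda>u. \<Psi> (?k u)) has_derivative (\<lambda>u. d\<Psi> w (frechet_derivative (F \<circ> chart_inv c) (at (\<Psi> w)) u,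
    frechet_derivative (snd d \<circ> p \<circ> chart_inv c) (at (\<Psi> w)) u))) (at (\<Psi> w))"
    by (rule has_derivative_compose[OF k]) (unfold kw, rule \<Psi>_has_derivative[OF w])
  moreover have "open ?U"
    by (rule smooth_map_in_charts[OF smooth_p c cc d dc])
  moreover have "\<Psi> w \<in> ?U" using ptw by (simp add: charts_at_iff)
  moreover have "\<Psi> (?k u) = u" if "u \<in> ?U" for u
  proof -
    have "chart_inv c u \<in> pts S"
      using that chart_inv_mem[of u c] cc by (auto simp: is_chart_def dest: openin_subset)
    then show ?thesis
      using that by (simp add: chart_inv_left[OF dc] triv_F_p chart_inv_right)
  qed
  ultimately have "((\<lambda>u. u) has_derivative (\<lambda>u. d\<Psi> w (frechet_derivative (F \<circ> chart_inv c) (at (\<Psi> w)) u,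
    frechet_derivative (snd d \<circ> p \<circ> chart_inv c) (at (\<Psi> w)) u))) (at (\<Psi> w))"
    by (rule has_derivative_transform_within_open)
  from has_derivative_unique[OF has_derivative_ident this] show ?thesis by meson
qed

end

locale contact_reduction = scaled_bundle G S \<phi> F C
  for G :: "real set"
    and S :: "('a, 'e::euclidean_space) mfd"
    and \<phi> :: "real \<Rightarrow> 'a \<Rightarrow> 'a"
    and F :: "'a \<Rightarrow> real"
    and C :: "('a set, 'f::euclidean_space) mfd" +
  fixes \<omega> :: "('a, 'e) form2" and H :: "'a \<Rightarrow> real" and \<eta> :: "('a set, 'f) form1"
  assumes sympl: "symplectic_form S \<omega>"
    and scaling: "scaling_symmetry G S \<omega> H \<phi>"
    and contact: "induced_contact_form G S \<omega> \<phi> F C \<eta>"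

locale contact_charts = contact_reduction G S \<phi> F C \<omega> H \<eta> + trivialising_charts G S \<phi> F C c d W
  for G :: "real set"
    and S :: "('a, 'e::euclidean_space) mfd"
    and \<phi> :: "real \<Rightarrow> 'a \<Rightarrow> 'a"
    and F :: "'a \<Rightarrow> real"
    and C :: "('a set, 'f::euclidean_space) mfd"
    and \<omega> H \<eta> c d W
begin

text \<open>\<open>B\<close> and \<open>E\<close> are the coefficients of \<open>\<omega>\<close> and \<open>\<eta>\<close> in the charts \<open>c\<close> and \<open>d\<close>, and \<open>P\<close> is the
  pullback of \<open>\<omega>\<close> to the coordinates \<open>(s, z)\<close>.\<close>

definition B :: "'e \<Rightarrow> 'e \<Rightarrow> 'e \<Rightarrow> real" where
  "B u e e' = \<omega> (chart_inv c u) (tvec_of S c (chart_inv c u) e) (tvec_of S c (chart_inv c u) e')"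

definition P :: "real \<times> 'f \<Rightarrow> real \<times> 'f \<Rightarrow> real \<times> 'f \<Rightarrow> real" where
  "P a b = (\<lambda>w. B (\<Psi> w) (d\<Psi> w a) (d\<Psi> w b))"

definition E :: "'f \<Rightarrow> 'f \<Rightarrow> real" where
  "E b z = \<eta> (chart_inv d z) (tvec_of C d (chart_inv d z) b)"

lemma two_form: "two_form S \<omega>"
  using sympl by (simp add: symplectic_form_def)

lemma B_bilinear: "u \<in> snd c ` fst c \<Longrightarrow> bilinear (B u)"
  unfolding B_def using c chart_inv_mem[of u c]
  by (intro bilinear_two_form_in_chart[OF S two_form]) (simp add: charts_at_iff)

lemma B_smooth: "smooth_on (snd c ` fst c) (\<lambda>u. B u e e')"
  using two_form c by (simp add: two_form_def B_def)

lemma B_antisym: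
  assumes "u \<in> snd c ` fst c"
  shows "B u e e' = - B u e' e"
proof -
  have x: "c \<in> charts_at S (chart_inv c u)" using assms c by (simp add: charts_at_iff chart_inv_mem)
  show ?thesis
    using two_form tvec_of_in_tangent_space[OF S x] charts_at_pts[OF S x]
    unfolding two_form_def B_def by blast
qed

lemma P_eq: "w \<in> W \<Longrightarrow> P a b w = \<omega> (pt w) (T w a) (T w b)"
  by (simp add: P_def B_def pt)

lemma P_has_derivative:
  assumes w: "w \<in> W"
  shows "(P a b has_derivative frechet_derivative (P a b) (at w)) (at w)"
proof -
  have diff: "(\<lambda>u. B u e e') differentiable (at (\<Psi> w))" for e e'
    using smooth_on_has_derivative[OF B_smooth pt(11)[OF w]] by (rule differentiableI)
  have op: "open (snd c ` fst c)" using cc by (simp add: is_chart_def)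
  have d2: "((\<lambda>w. d\<Psi> w a) has_derivative frechet_derivative (\<lambda>w. d\<Psi> w a) (at w)) (at w)" for a
    by (rule smooth_on_has_derivative[OF smooth_on_derivative[OF W_smooth] w])
  have "P a b differentiable (at w)"
    unfolding P_def
    by (rule differentiableI[OF has_derivative_bilinear_family[OF op B_bilinear diff pt(11)[OF w]
            \<Psi>_has_derivative[OF w] d2 d2]])
  then show ?thesis by (simp only: frechet_derivative_works)
qed

text \<open>Pair \<open>\<partial>\<^sub>s\<close>, which is the generator divided by \<open>s\<close>, with a lift of \<open>b\<close>: the defining relation
  \<open>p\<^sup>*\<eta> = \<lambda> / F\<close> of \<open>\<eta>\<close> gives \<open>- \<eta>(b)\<close>, as \<open>\<lambda>\<close> is minus the contraction of \<open>\<omega>\<close> with the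
  generator and \<open>F = s\<close>.\<close>

lemma P_vertical:
  assumes w: "w \<in> W"
  shows "P (1, 0) (0, b) w = - E b (snd w)"
proof -
  note ptw = pt[OF w]
  let ?v = "T w (0, b)"
  have "\<omega> (pt w) (tvec_of S c (pt w) (fst w *\<^sub>R d\<Psi> w (1, 0))) ?v = fst w * P (1, 0) (0, b) w"
    using B_bilinear[OF ptw(11)] ptw(10) by (simp add: bilinear_def linear_cmul P_def B_def linear_iff)
  then have "liouville_form S \<omega> \<phi> (pt w) ?v = - (fst w * P (1, 0) (0, b) w)"
    by (simp add: liouville_form_def contraction_def generator_eq[OF w])
  moreover have "pullback1 S C p \<eta> (pt w) ?v = 1 / F (pt w) * liouville_form S \<omega> \<phi> (pt w) ?v"
    using contact ptw(5) T_tangent[OF w] by (simp add: induced_contact_form_def)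
  moreover have "pullback1 S C p \<eta> (pt w) ?v = E b (snd w)"
    by (simp add: pullback1_def tangent_p_T[OF w] ptw(7) E_def)
  ultimately show ?thesis
    using ptw(1,6) group_nonzero[of "fst w"] by simp
qed

text \<open>The action by \<open>r = s / s0\<close> carries the slice at \<open>s0\<close> to the slice at \<open>s\<close> without moving \<open>z\<close>,
  and multiplies \<open>\<omega>\<close> by \<open>r\<close>.\<close>

lemma P_homogeneous:
  assumes w0: "(s0, z) \<in> W" and w: "(s, z) \<in> W"
  shows "P (0, a) (0, b) (s, z) = s / s0 * P (0, a) (0, b) (s0, z)"
proof -
  note pt0 = pt[OF w0] and pt1 = pt[OF w]
  let ?r = "s / s0" and ?x = "pt (s0, z)"
  have r: "?r \<in> G" and s0: "s0 \<noteq> 0" using pt0(1) pt1(1) group_nonzero[of s0] by auto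
  have x: "\<phi> ?r ?x = pt (s, z)"
    using act_triv[OF r, of s0 "chart_inv d z"] pt0 s0 by simp
  have T: "tangent_map S S (\<phi> ?r) ?x (T (s0, z) (0, a)) = T (s, z) (0, a)" for a
  proof -
    let ?\<phi> = "snd c \<circ> \<phi> ?r \<circ> chart_inv c"
    have c1: "c \<in> charts_at S (\<phi> ?r ?x)" using pt1(8) unfolding x .
    note \<phi> = smooth_map_has_derivative[OF S S smooth_act[OF r] pt0(8) c1]
    define i0 i1 :: "'f \<Rightarrow> real \<times> 'f" where "i0 z' = (s0, z')" and "i1 z' = (s, z')" for z'
    have i: "(i0 has_derivative (\<lambda>h. (0, h))) (at z)" "(i1 has_derivative (\<lambda>h. (0, h))) (at z)"
      unfolding i0_def i1_def by (auto intro!: derivative_eq_intros)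
    have "((\<lambda>z'. \<Psi> (i0 z')) has_derivative (\<lambda>h. d\<Psi> (s0, z) (0, h))) (at z)"
      using i(1) by (rule has_derivative_compose) (use \<Psi>_has_derivative[OF w0] in \<open>simp add: i0_def\<close>)
    then have der: "((\<lambda>z'. ?\<phi> (\<Psi> (i0 z'))) has_derivative
        (\<lambda>h. frechet_derivative ?\<phi> (at (\<Psi> (s0, z))) (d\<Psi> (s0, z) (0, h)))) (at z)"
      by (rule has_derivative_compose) (unfold i0_def, rule \<phi>)
    have V: "open (i0 -` W \<inter> i1 -` W)" "z \<in> i0 -` W \<inter> i1 -` W"
      using w w0 unfolding i0_def i1_def
      by (auto intro!: open_vimage W(1) continuous_intros)
    have eq: "?\<phi> (\<Psi> (i0 z')) = \<Psi> (i1 z')" if "z' \<in> i0 -` W \<inter> i1 -` W" for z'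
      using that pt[of "(s0, z')"] act_triv[OF r, of s0 "chart_inv d z'"] s0
      by (simp add: i0_def i1_def)
    from der V eq have "((\<lambda>z'. \<Psi> (i1 z')) has_derivative
        (\<lambda>h. frechet_derivative ?\<phi> (at (\<Psi> (s0, z))) (d\<Psi> (s0, z) (0, h)))) (at z)"
      by (rule has_derivative_transform_within_open)
    moreover have "((\<lambda>z'. \<Psi> (i1 z')) has_derivative (\<lambda>h. d\<Psi> (s, z) (0, h))) (at z)"
      using i(2) by (rule has_derivative_compose) (use \<Psi>_has_derivative[OF w] in \<open>simp add: i1_def\<close>)
    ultimately have "(\<lambda>h. frechet_derivative ?\<phi> (at (\<Psi> (s0, z))) (d\<Psi> (s0, z) (0, h))) =
      (\<lambda>h. d\<Psi> (s, z) (0, h))"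
      by (rule has_derivative_unique)
    then have "frechet_derivative ?\<phi> (at (\<Psi> (s0, z))) (d\<Psi> (s0, z) (0, a)) = d\<Psi> (s, z) (0, a)"
      by meson
    moreover have "T (s0, z) (0, a) c = d\<Psi> (s0, z) (0, a)"
      by (rule tvec_of_self[OF S pt0(8)])
    ultimately show ?thesis
      using tangent_map_eq_tvec_of[OF S S smooth_act[OF r] pt0(8) c1 T_tangent[OF w0], of "(0, a)"]
      unfolding x by simp
  qed
  have "pullback2 S S (\<phi> ?r) \<omega> ?x (T (s0, z) (0, a)) (T (s0, z) (0, b)) =
      ?r * \<omega> ?x (T (s0, z) (0, a)) (T (s0, z) (0, b))"
    using scaling r pt0(5) T_tangent[OF w0] unfolding scaling_symmetry_def by blast
  then show ?thesis
    unfolding pullback2_def T x P_eq[OF w0] P_eq[OF w] .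
qed

text \<open>Closedness of \<open>\<omega>\<close> on \<open>\<partial>\<^sub>s\<close> and two vectors tangent to the slice. The charts have to be the ones
  in which the exterior derivatives at this point are computed by definition; elsewhere in \<open>W\<close>
  no such choice is involved.\<close>

lemma P_horizontal:
  assumes w: "w \<in> W" and "c = chart_at S (pt w)" "d = chart_at C (base w)"
  shows "P (0, u d) (0, v d) w = - fst w * ext_deriv1 C \<eta> (base w) u v"
proof -
  note ptw = pt[OF w]
  obtain s z where sz: "w = (s, z)" by (cases w)
  have s: "s \<noteq> 0" using ptw(1) group_nonzero sz by auto
  let ?a = "(1, 0) :: real \<times> 'f" and ?b = "(0, u d) :: real \<times> 'f" and ?c = "(0, v d) :: real \<times> 'f"
  have "frechet_derivative (P ?b ?c) (at w) ?a - frechet_derivative (P ?a ?c) (at w) ?b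
      + frechet_derivative (P ?a ?b) (at w) ?c = 0"
    unfolding P_def
  proof (rule closed_two_form_pullback[OF _ B_bilinear B_smooth B_antisym[OF ptw(11)] _ W(1) w W_smooth ptw(11)])
    show "open (snd c ` fst c)" using cc by (simp add: is_chart_def)
    fix e1 e2 e3
    let ?t = "tvec_of S c (pt w)"
    have "ext_deriv2 S \<omega> (pt w) (?t e1) (?t e2) (?t e3) = 0"
      using sympl ptw(5) tvec_of_in_tangent_space[OF S ptw(8)] unfolding symplectic_form_def by blast
    then show "frechet_derivative (\<lambda>u. B u e2 e3) (at (\<Psi> w)) e1
       - frechet_derivative (\<lambda>u. B u e1 e3) (at (\<Psi> w)) e2
       + frechet_derivative (\<lambda>u. B u e1 e2) (at (\<Psi> w)) e3 = 0"
      unfolding ext_deriv2_def Let_def assms(2)[symmetric] tvec_of_self[OF S ptw(8)] B_def .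
  qed
  moreover have "frechet_derivative (P ?b ?c) (at w) ?a = P ?b ?c w / s"
  proof -
    define i where "i r = (r, z)" for r :: real
    have "(i has_derivative (\<lambda>h. (h, 0))) (at s)"
      unfolding i_def by (auto intro!: derivative_eq_intros)
    then have "((\<lambda>r. P ?b ?c (i r)) has_derivative (\<lambda>h. frechet_derivative (P ?b ?c) (at w) (h, 0))) (at s)"
      by (rule has_derivative_compose) (use P_has_derivative[OF w] in \<open>simp add: i_def sz\<close>)
    moreover have "((\<lambda>r. P ?b ?c (i r)) has_derivative (\<lambda>h. h / s * P ?b ?c w)) (at s)"
    proof (rule has_derivative_transform_within_open)
      show "((\<lambda>r. r / s * P ?b ?c w) has_derivative (\<lambda>h. h / s * P ?b ?c w)) (at s)"
        using s by (auto intro!: derivative_eq_intros)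
      show "open (i -` W)" unfolding i_def by (intro open_vimage W(1) continuous_intros)
      show "s \<in> i -` W" using w by (simp add: i_def sz)
      show "r / s * P ?b ?c w = P ?b ?c (i r)" if "r \<in> i -` W" for r
        using P_homogeneous[of s z r] w that by (simp add: i_def sz)
    qed
    ultimately have "(\<lambda>h. frechet_derivative (P ?b ?c) (at w) (h, 0)) = (\<lambda>h. h / s * P ?b ?c w)"
      by (rule has_derivative_unique)
    from fun_cong[OF this, of 1] show ?thesis by simp
  qed
  moreover have "frechet_derivative (P ?a (0, b)) (at w) (0, b') = - frechet_derivative (E b) (at (snd w)) b'" for b b'
  proof -
    have "smooth_on (snd d ` fst d) (E b)"
      using contact d by (simp add: induced_contact_form_def one_form_def E_def[abs_def])
    then have E: "(E b has_derivative frechet_derivative (E b) (at (snd w))) (at (snd w))"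
      using ptw(2) by (rule smooth_on_has_derivative)
    have "((\<lambda>w. - E b (snd w)) has_derivative (\<lambda>h. - frechet_derivative (E b) (at (snd w)) (snd h))) (at w)"
      by (intro has_derivative_minus has_derivative_compose[OF has_derivative_snd[OF has_derivative_ident] E])
    then have "(P ?a (0, b) has_derivative (\<lambda>h. - frechet_derivative (E b) (at (snd w)) (snd h))) (at w)"
      by (rule has_derivative_transform_within_open[OF _ W(1) w]) (simp add: P_vertical)
    from frechet_derivative_at[OF this] show ?thesis by (metis snd_conv)
  qed
  moreover have "ext_deriv1 C \<eta> (base w) u v =
    frechet_derivative (E (v d)) (at (snd w)) (u d) - frechet_derivative (E (u d)) (at (snd w)) (v d)"
    unfolding ext_deriv1_def Let_def assms(3)[symmetric] ptw(9) E_def[abs_def] ..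
  ultimately have "P ?b ?c w / s = - ext_deriv1 C \<eta> (base w) u v"
    by simp
  then show ?thesis
    using s by (simp add: sz field_simps)
qed

end

section \<open>Integral curves\<close>

text \<open>Differentiating a function along a curve, with both expressed in the same chart.\<close>

lemma curve_compose:
  assumes "smooth_manifold M" "smooth_map (open_mfd I) M g" "open I" "t \<in> I" "c \<in> charts_at M (g t)"
    and k: "((k \<circ> chart_inv c) has_derivative k') (at (snd c (g t)))"
  shows "((k \<circ> g) has_vector_derivative k' (velocity M g t c)) (at t)"
proof -
  have c: "is_chart (mtop M) c" using assms by (auto simp: charts_at_iff manifold_chart)
  note g = smooth_curve_in_chart[OF assms(2-4,1,5)]
  have k1: "((k \<circ> chart_inv c) has_derivative k') (at ((snd c \<circ> g) t))" using k by simp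
  have "((\<lambda>s. (k \<circ> chart_inv c) ((snd c \<circ> g) s)) has_derivative (\<lambda>h. k' (h *\<^sub>R velocity M g t c))) (at t)"
    by (rule has_derivative_compose[OF g(2)[unfolded has_vector_derivative_def] k1])
  moreover have "(\<lambda>h. k' (h *\<^sub>R velocity M g t c)) = (\<lambda>h. h *\<^sub>R k' (velocity M g t c))"
    using has_derivative_linear[OF k] by (simp add: linear_cmul)
  ultimately have 1: "((\<lambda>s. (k \<circ> chart_inv c) ((snd c \<circ> g) s)) has_derivative
      (\<lambda>h. h *\<^sub>R k' (velocity M g t c))) (at t)" by simp
  have "\<forall>\<^sub>F s in at t. (k \<circ> chart_inv c) ((snd c \<circ> g) s) = (k \<circ> g) s"
    using g(1) by (auto simp: eventually_at_filter chart_inv_left[OF c] elim: eventually_mono)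
  then show ?thesis
    unfolding has_vector_derivative_def
    using assms(5) by (intro has_derivative_transform_eventually[OF 1])
      (auto simp: charts_at_iff chart_inv_left[OF c])
qed

text \<open>The coincidence set is closed because \<open>M\<close> is Hausdorff and open by local uniqueness in a
  chart. The curves are only required to solve the equation in charts, so that a projected curve
  can be used without first proving it smooth.\<close>

lemma integral_curve_unique:
  assumes M: "smooth_manifold M" and Y: "vector_field M Y"
    and I: "open I" "connected I" "t0 \<in> I"
    and \<alpha>: "continuous_map (top_of_set I) (mtop M) \<alpha>"
      "\<And>t d. t \<in> I \<Longrightarrow> d \<in> charts_at M (\<alpha> t) \<Longrightarrow> ((snd d \<circ> \<alpha>) has_vector_derivative Y (\<alpha> t) d) (at t)"
    and \<beta>: "continuous_map (top_of_set I) (mtop M) \<beta>"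
      "\<And>t d. t \<in> I \<Longrightarrow> d \<in> charts_at M (\<beta> t) \<Longrightarrow> ((snd d \<circ> \<beta>) has_vector_derivative Y (\<beta> t) d) (at t)"
    and "\<alpha> t0 = \<beta> t0" "t \<in> I"
  shows "\<alpha> t = \<beta> t"
proof -
  let ?Z = "{t \<in> I. \<alpha> t = \<beta> t}"
  have "closedin (top_of_set I) {t \<in> topspace (top_of_set I). \<alpha> t = \<beta> t}"
    using M \<alpha>(1) \<beta>(1) by (intro closedin_continuous_maps_eq[of "mtop M"]) (auto simp: smooth_manifold_def)
  then have "closedin (top_of_set I) ?Z" by simp
  moreover have "open ?Z"
  proof (subst open_subopen, intro ballI)
    fix t1 assume t1: "t1 \<in> ?Z"
    define d where "d = chart_at M (\<alpha> t1)"
    have "\<alpha> t1 \<in> pts M" using \<alpha>(1) t1 unfolding continuous_map_def Pi_iff by auto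
    then have d: "d \<in> charts_at M (\<alpha> t1)" unfolding d_def by (rule chart_at_mem[OF M])
    have dc: "is_chart (mtop M) d" "d \<in> atlas M" using d M by (auto simp: charts_at_iff manifold_chart)
    then have opd: "openin (mtop M) (fst d)" "open (snd d ` fst d)" by (auto simp: is_chart_def)
    let ?J = "{t \<in> I. \<alpha> t \<in> fst d} \<inter> {t \<in> I. \<beta> t \<in> fst d}"
    have J: "open ?J"
      using open_continuous_preimage[OF \<alpha>(1) I(1) opd(1)] open_continuous_preimage[OF \<beta>(1) I(1) opd(1)]
      by (rule open_Int)
    have t1J: "t1 \<in> ?J" using t1 d by (auto simp: charts_at_iff)
    let ?f = "\<lambda>u. Y (chart_inv d u) d"
    have f: "smooth_on (snd d ` fst d) ?f" using Y dc(2) by (simp add: vector_field_def)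
    have u: "((snd d \<circ> \<alpha>) has_vector_derivative ?f ((snd d \<circ> \<alpha>) t)) (at t)" if "t \<in> ?J" for t
      using \<alpha>(2)[of t d] that dc(2) by (simp add: charts_at_iff chart_inv_left[OF dc(1)])
    have v: "((snd d \<circ> \<beta>) has_vector_derivative ?f ((snd d \<circ> \<beta>) t)) (at t)" if "t \<in> ?J" for t
      using \<beta>(2)[of t d] that dc(2) by (simp add: charts_at_iff chart_inv_left[OF dc(1)])
    have "(snd d \<circ> \<alpha>) t1 \<in> snd d ` fst d" "(snd d \<circ> \<alpha>) t1 = (snd d \<circ> \<beta>) t1"
      using t1 d by (auto simp: charts_at_iff)
    then obtain \<delta> where \<delta>: "\<delta> > 0" "\<And>t. dist t t1 < \<delta> \<Longrightarrow> (snd d \<circ> \<alpha>) t = (snd d \<circ> \<beta>) t"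
      using ode_local_uniqueness[OF opd(2) f J t1J _ u v] by blast
    have "\<alpha> t = \<beta> t" if "t \<in> ?J" "dist t t1 < \<delta>" for t
    proof -
      have \<alpha>d: "\<alpha> t \<in> fst d" and \<beta>d: "\<beta> t \<in> fst d" using that(1) by auto
      have "snd d (\<alpha> t) = snd d (\<beta> t)" using \<delta>(2)[OF that(2)] by simp
      from arg_cong[OF this, of "chart_inv d"] show ?thesis
        unfolding chart_inv_left[OF dc(1) \<alpha>d] chart_inv_left[OF dc(1) \<beta>d] .
    qed
    then have "?J \<inter> ball t1 \<delta> \<subseteq> ?Z" by (auto simp: dist_commute)
    then show "\<exists>T. open T \<and> t1 \<in> T \<and> T \<subseteq> ?Z"
      using J t1J \<delta>(1) by (intro exI[of _ "?J \<inter> ball t1 \<delta>"]) auto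
  qed
  then have "openin (top_of_set I) ?Z"
    by (rule open_subset[rotated]) auto
  ultimately have "?Z = {} \<or> ?Z = I"
    using I(2) unfolding connected_clopen by blast
  then show ?thesis using assms(10,11) I(3) by blast
qed

section \<open>Hamiltonian dynamics and its reduction\<close>

locale reduced_Hamiltonian_system = contact_reduction G S \<phi> F C \<omega> H \<eta>
  for G :: "real set"
    and S :: "('a, 'e::euclidean_space) mfd"
    and \<phi> :: "real \<Rightarrow> 'a \<Rightarrow> 'a"
    and F :: "'a \<Rightarrow> real"
    and C :: "('a set, 'f::euclidean_space) mfd"
    and \<omega> H \<eta> +
  fixes R Y :: "'a set \<Rightarrow> ('a set, 'f) tvec"
    and X :: "'a \<Rightarrow> ('a, 'e) tvec"
    and h :: "'a set \<Rightarrow> real"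
  assumes smooth_H: "smooth_fun S H"
    and Reeb: "Reeb_vector_field C \<eta> R"
    and smooth_h: "smooth_fun C h" and h: "\<And>x. x \<in> pts S \<Longrightarrow> h (p x) = 1 / F x * H x"
    and Hamiltonian: "Hamiltonian_vector_field S \<omega> H X"
    and Y: "vector_field C Y" and projects: "projects_to S C p X Y"
begin

lemma X_tangent: "x \<in> pts S \<Longrightarrow> X x \<in> tangent_space S x"
  using Hamiltonian by (simp add: Hamiltonian_vector_field_def vector_field_def)

lemma R_tangent: "y \<in> pts C \<Longrightarrow> R y \<in> tangent_space C y"
  using Reeb by (simp add: Reeb_vector_field_def vector_field_def)

text \<open>Evaluate \<open>i\<^sub>X \<omega> = dH\<close> on the lift \<open>T w (0, R)\<close> of the Reeb field, in the trivialisation around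
  \<open>x\<close>.\<close>

lemma F_derivative_along_X:
  assumes x: "x \<in> pts S"
  shows "differential S F x (X x) = - F x * differential C h (p x) (R (p x))"
proof -
  define c where "c = chart_at S x"
  define d where "d = chart_at C (p x)"
  have px: "p x \<in> pts C" using x by (simp add: pts_C)
  have cx: "c \<in> charts_at S x" unfolding c_def by (rule chart_at_mem[OF S x])
  have dx: "d \<in> charts_at C (p x)" unfolding d_def by (rule chart_at_mem[OF C px])
  have cx': "c \<in> charts_at S (triv (F x) (p x))" using cx x by (simp add: triv_F_p)
  obtain W where dom: "open W" "(F x, snd d (p x)) \<in> W" "W \<subseteq> G \<times> snd d ` fst d"
    "\<And>w. w \<in> W \<Longrightarrow> triv (fst w) (chart_inv d (snd w)) \<in> fst c"
    "smooth_on W (\<lambda>w. snd c (triv (fst w) (chart_inv d (snd w))))"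
    by (rule triv_in_charts[OF F_G[OF x] dx cx']) (rule that)
  interpret contact_charts G S \<phi> F C \<omega> H \<eta> c d W
    by unfold_locales (use dom cx dx in \<open>auto simp: charts_at_iff\<close>)
  define w where "w = (F x, snd d (p x))"
  have w: "w \<in> W" using dom by (simp add: w_def)
  note ptw = pt[OF w]
  have base: "base w = p x" using dx by (simp add: w_def chart_inv_left[OF dc] charts_at_iff)
  have ptx: "pt w = x" using x base by (simp add: w_def triv_F_p)
  let ?u = "X x c" and ?r = "R (p x) d"
  let ?a = "frechet_derivative (F \<circ> chart_inv c) (at (\<Psi> w)) ?u"
  let ?b = "frechet_derivative (snd d \<circ> p \<circ> chart_inv c) (at (\<Psi> w)) ?u"
  have a: "?a = differential S F x (X x)"
    by (simp only: differential_def Let_def c_def[symmetric] ptx)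
  have "tangent_map S C p x (X x) d = ?b"
    using tangent_map_in_chart[OF S C smooth_p cx dx X_tangent[OF x]] by (simp only: ptx)
  then have b: "?b = Y (p x) d"
    using projects x by (simp add: projects_to_def)
  have Yx: "Y (p x) \<in> tangent_space C (p x)" using Y px by (simp add: vector_field_def)
  have Xx: "X x = T w (?a, ?b)"
    by (simp only: \<Psi>_reconstruct[OF w, of ?u, symmetric], simp only: ptx, rule tangent_vector_eq_tvec_of[OF X_tangent[OF x] cx])
  \<comment> \<open>pairing with the lift is linear in the other argument, which separates the two components of \<open>X\<close>\<close>
  have lin: "linear (\<lambda>e. P e (0, ?r) w)"
  proof -
    have "linear (\<lambda>e. B (\<Psi> w) e (d\<Psi> w (0, ?r)))"
      using B_bilinear[OF ptw(11)] by (simp add: bilinear_def)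
    from linear_compose[OF has_derivative_linear[OF \<Psi>_has_derivative[OF w]] this]
    show ?thesis by (simp add: P_def comp_def)
  qed
  have "\<omega> x (X x) (T w (0, ?r)) = P (?a, ?b) (0, ?r) w"
    by (subst Xx) (simp add: P_eq[OF w] ptx)
  also have "(?a, ?b) = ?a *\<^sub>R (1, 0) + (0, ?b)" by simp
  also have "P (?a *\<^sub>R (1, 0) + (0, ?b)) (0, ?r) w = ?a * P (1, 0) (0, ?r) w + P (0, ?b) (0, ?r) w"
    by (simp only: linear_add[OF lin] linear_cmul[OF lin] real_scaleR_def)
  also have "P (1, 0) (0, ?r) w = - 1"
  proof -
    have "tvec_of C d (p x) ?r = R (p x)"
      using tangent_vector_eq_tvec_of[OF R_tangent[OF px] dx] by simp
    then have "E ?r (snd w) = \<eta> (p x) (R (p x))" by (simp add: E_def base)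
    then show ?thesis using Reeb px P_vertical[OF w] by (simp add: Reeb_vector_field_def)
  qed
  also have "P (0, ?b) (0, ?r) w = 0"
  proof -
    have "ext_deriv1 C \<eta> (p x) (Y (p x)) (R (p x)) = - ext_deriv1 C \<eta> (p x) (R (p x)) (Y (p x))"
      by (simp add: ext_deriv1_def Let_def)
    also have "\<dots> = 0"
      using Reeb px Yx by (simp add: Reeb_vector_field_def contraction_def)
    finally have zero: "ext_deriv1 C \<eta> (base w) (Y (p x)) (R (p x)) = 0" by (simp only: base)
    have cw: "c = chart_at S (pt w)" unfolding ptx by (rule c_def)
    have dw: "d = chart_at C (base w)" unfolding base by (rule d_def)
    show ?thesis
      unfolding b P_horizontal[OF w cw dw] zero by simp
  qed
  finally have 1: "\<omega> x (X x) (T w (0, ?r)) = ?a * - 1 + 0" .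
  have "\<omega> x (X x) (T w (0, ?r)) = differential S H x (T w (0, ?r))"
    using Hamiltonian x T_tangent[OF w, of "(0, ?r)"] unfolding ptx
    by (simp add: Hamiltonian_vector_field_def contraction_def)
  also have "\<dots> = frechet_derivative (H \<circ> chart_inv c) (at (\<Psi> w)) (d\<Psi> w (0, ?r))"
    using tvec_of_self[OF S cx] by (simp only: differential_def Let_def c_def[symmetric] ptx)
  also have "\<dots> = F x * frechet_derivative (h \<circ> chart_inv d) (at (snd d (p x))) (snd (0 :: real, ?r))
      + fst (0, ?r) * (h \<circ> chart_inv d) (snd w)"
  proof (rule derivative_along_\<Psi>[OF w, where g = "H \<circ> chart_inv c"
        and k = "\<lambda>w. fst w * (h \<circ> chart_inv d) (snd w)" and a = "(0, ?r)"
        and k' = "\<lambda>v. F x * frechet_derivative (h \<circ> chart_inv d) (at (snd d (p x))) (snd v)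
          + fst v * (h \<circ> chart_inv d) (snd w)"])
    show "((H \<circ> chart_inv c) has_derivative frechet_derivative (H \<circ> chart_inv c) (at (\<Psi> w))) (at (\<Psi> w))"
      by (rule smooth_on_has_derivative[OF smooth_fun_in_chart[OF S smooth_H c open_UNIV] ptw(11)])
    have dh: "((h \<circ> chart_inv d) has_derivative frechet_derivative (h \<circ> chart_inv d) (at (snd w))) (at (snd w))"
      by (rule smooth_on_has_derivative[OF smooth_fun_in_chart[OF C smooth_h d open_UNIV] ptw(2)])
    have "((\<lambda>w. fst w * (h \<circ> chart_inv d) (snd w)) has_derivative
      (\<lambda>v. fst w * frechet_derivative (h \<circ> chart_inv d) (at (snd w)) (snd v)
        + fst v * (h \<circ> chart_inv d) (snd w))) (at w)"
      by (rule has_derivative_mult[OF has_derivative_fst[OF has_derivative_ident]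
        has_derivative_compose[OF has_derivative_snd[OF has_derivative_ident] dh]])
    then show "((\<lambda>w. fst w * (h \<circ> chart_inv d) (snd w)) has_derivative
      (\<lambda>v. F x * frechet_derivative (h \<circ> chart_inv d) (at (snd d (p x))) (snd v)
        + fst v * (h \<circ> chart_inv d) (snd w))) (at w)"
      by (simp only: w_def fst_conv snd_conv)
    fix w' assume w': "w' \<in> W"
    note pt' = pt[OF w']
    show "(H \<circ> chart_inv c) (\<Psi> w') = fst w' * (h \<circ> chart_inv d) (snd w')"
      using h[OF pt'(5)] pt'(6,7,10) group_nonzero[OF pt'(1)] by simp
  qed
  also have "\<dots> = F x * differential C h (p x) (R (p x))"
    by (simp add: differential_def Let_def d_def)
  finally show ?thesis using 1 unfolding a by simp
qed

context
  fixes \<epsilon> :: real and \<Gamma> :: "real \<Rightarrow> 'a" and \<gamma> :: "real \<Rightarrow> 'a set"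
  assumes \<epsilon>: "\<epsilon> > 0" and \<Gamma>: "integral_curve S X {-\<epsilon><..<\<epsilon>} \<Gamma>"
    and \<gamma>: "integral_curve C Y {-\<epsilon><..<\<epsilon>} \<gamma>" and start: "\<gamma> 0 = p (\<Gamma> 0)"
begin

lemma \<Gamma>_smooth: "smooth_map (open_mfd {-\<epsilon><..<\<epsilon>}) S \<Gamma>"
  and \<gamma>_smooth: "smooth_map (open_mfd {-\<epsilon><..<\<epsilon>}) C \<gamma>"
  using \<Gamma> \<gamma> by (auto simp: integral_curve_def)

lemma \<Gamma>_continuous: "continuous_map (top_of_set {-\<epsilon><..<\<epsilon>}) (mtop S) \<Gamma>"
  and \<gamma>_continuous: "continuous_map (top_of_set {-\<epsilon><..<\<epsilon>}) (mtop C) \<gamma>"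
  using \<Gamma>_smooth \<gamma>_smooth by (auto simp: smooth_map_def open_mfd_def)

lemma \<Gamma>_pts: "t \<in> {-\<epsilon><..<\<epsilon>} \<Longrightarrow> \<Gamma> t \<in> pts S"
  and \<gamma>_pts: "t \<in> {-\<epsilon><..<\<epsilon>} \<Longrightarrow> \<gamma> t \<in> pts C"
  using \<Gamma>_continuous \<gamma>_continuous by (auto simp: continuous_map_def Pi_iff)

lemma projected_curve:
  assumes t: "t \<in> {-\<epsilon><..<\<epsilon>}"
  shows "p (\<Gamma> t) = \<gamma> t"
proof -
  let ?I = "{-\<epsilon><..<\<epsilon>}"
  have "(p \<circ> \<Gamma>) t = \<gamma> t"
  proof (rule integral_curve_unique[OF C Y, of ?I 0])
    show "continuous_map (top_of_set ?I) (mtop C) (p \<circ> \<Gamma>)"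
      using \<Gamma>_continuous smooth_p by (intro continuous_map_compose) (auto simp: smooth_map_def)
  next
    fix t d assume t: "t \<in> ?I" and "d \<in> charts_at C ((p \<circ> \<Gamma>) t)"
    then have d: "d \<in> charts_at C (p (\<Gamma> t))" by simp
    have c: "chart_at S (\<Gamma> t) \<in> charts_at S (\<Gamma> t)" by (rule chart_at_mem[OF S \<Gamma>_pts[OF t]])
    have "velocity S \<Gamma> t = X (\<Gamma> t)" using \<Gamma> t by (simp add: integral_curve_def)
    moreover have "tangent_map S C p (\<Gamma> t) (X (\<Gamma> t)) d = frechet_derivative (snd d \<circ> p \<circ> chart_inv (chart_at S (\<Gamma> t)))
        (at (snd (chart_at S (\<Gamma> t)) (\<Gamma> t))) (X (\<Gamma> t) (chart_at S (\<Gamma> t)))"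
      by (rule tangent_map_in_chart[OF S C smooth_p c d X_tangent[OF \<Gamma>_pts[OF t]]])
    ultimately have "((snd d \<circ> p \<circ> \<Gamma>) has_vector_derivative tangent_map S C p (\<Gamma> t) (X (\<Gamma> t)) d) (at t)"
      using curve_compose[OF S \<Gamma>_smooth open_greaterThanLessThan t c smooth_map_has_derivative[OF S C smooth_p c d]]
      by (simp only:)
    then show "((snd d \<circ> (p \<circ> \<Gamma>)) has_vector_derivative Y ((p \<circ> \<Gamma>) t) d) (at t)"
      using projects \<Gamma>_pts[OF t] by (simp add: projects_to_def comp_assoc)
  next
    fix t d assume t: "t \<in> ?I" and d: "d \<in> charts_at C (\<gamma> t)"
    show "((snd d \<circ> \<gamma>) has_vector_derivative Y (\<gamma> t) d) (at t)"
      using smooth_curve_in_chart(2)[OF \<gamma>_smooth _ t C d] \<gamma> t by (simp add: integral_curve_def)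
  qed (use \<epsilon> t start \<gamma>_continuous in auto)
  then show ?thesis by simp
qed

lemma F_along_\<Gamma>:
  assumes t: "t \<in> {-\<epsilon><..<\<epsilon>}"
  shows "((\<lambda>t. F (\<Gamma> t)) has_real_derivative - F (\<Gamma> t) * differential C h (\<gamma> t) (R (\<gamma> t))) (at t)"
proof -
  let ?c = "chart_at S (\<Gamma> t)"
  have c: "?c \<in> charts_at S (\<Gamma> t)" by (rule chart_at_mem[OF S \<Gamma>_pts[OF t]])
  have "((F \<circ> chart_inv ?c) has_derivative frechet_derivative (F \<circ> chart_inv ?c) (at (snd ?c (\<Gamma> t)))) (at (snd ?c (\<Gamma> t)))"
    using c by (intro smooth_on_has_derivative[OF smooth_fun_in_chart[OF S smooth_F _ open_G] snd_chart_mem])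
      (auto simp: charts_at_iff)
  from curve_compose[OF S \<Gamma>_smooth _ t c this]
  have "((F \<circ> \<Gamma>) has_vector_derivative differential S F (\<Gamma> t) (velocity S \<Gamma> t)) (at t)"
    by (simp add: differential_def Let_def)
  moreover have "velocity S \<Gamma> t = X (\<Gamma> t)" using \<Gamma> t by (simp add: integral_curve_def)
  ultimately show ?thesis
    using F_derivative_along_X[OF \<Gamma>_pts[OF t]] projected_curve[OF t]
    by (simp add: has_real_derivative_iff_has_vector_derivative comp_def)
qed

text \<open>Continuity is a local matter and can be checked in the fixed chart around \<open>\<gamma> t\<close>, although the
  chart in which the differential is defined changes along the curve.\<close>

lemma Reeb_derivative_continuous:
  "continuous_on {-\<epsilon><..<\<epsilon>} (\<lambda>t. differential C h (\<gamma> t) (R (\<gamma> t)))"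
proof (rule continuous_at_imp_continuous_on, rule ballI)
  fix t assume t: "t \<in> {-\<epsilon><..<\<epsilon>}"
  define d where "d = chart_at C (\<gamma> t)"
  have d: "d \<in> charts_at C (\<gamma> t)" unfolding d_def by (rule chart_at_mem[OF C \<gamma>_pts[OF t]])
  then have dc: "d \<in> atlas C" "is_chart (mtop C) d" using C by (auto simp: charts_at_iff manifold_chart)
  then have opd: "open (snd d ` fst d)" by (simp add: is_chart_def)
  let ?k = "\<lambda>z. frechet_derivative (h \<circ> chart_inv d) (at z) (R (chart_inv d z) d)"
  have sm: "smooth_on (snd d ` fst d) ?k"
    using Reeb dc(1) by (intro smooth_on_derivative_along opd smooth_fun_in_chart[OF C smooth_h _ open_UNIV])
      (auto simp: Reeb_vector_field_def vector_field_def)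
  have "isCont ?k ((snd d \<circ> \<gamma>) t)"
    unfolding comp_apply[of "snd d" \<gamma> t]
    by (rule bspec[OF continuous_on_eq_continuous_at[OF opd, THEN iffD1, OF smooth_on_imp_continuous[OF sm]]
          snd_chart_mem[OF d]])
  moreover note curve = smooth_curve_in_chart[OF \<gamma>_smooth open_greaterThanLessThan t C d]
  ultimately have "isCont (\<lambda>t. ?k ((snd d \<circ> \<gamma>) t)) t"
    by (intro isCont_o2[OF has_vector_derivative_continuous[OF curve(2)]])
  moreover have "\<forall>\<^sub>F s in nhds t. ?k ((snd d \<circ> \<gamma>) s) = differential C h (\<gamma> s) (R (\<gamma> s))"
    using curve(1) eventually_nhds_in_open[OF open_greaterThanLessThan t]
  proof eventually_elim
    case (elim s)
    then have "d \<in> charts_at C (\<gamma> s)" using dc by (simp add: charts_at_iff)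
    then show ?case
      using differential_in_chart[OF C smooth_h open_UNIV _ R_tangent[OF \<gamma>_pts[OF elim(2)]], of d] elim(1)
      by (simp add: chart_inv_left[OF dc(2)])
  qed
  ultimately show "isCont (\<lambda>t. differential C h (\<gamma> t) (R (\<gamma> t))) t"
    using isCont_cong by fast
qed

lemma F_along_\<Gamma>_eq:
  assumes t: "t \<in> {-\<epsilon><..<\<epsilon>}"
  shows "F (\<Gamma> t) = F (\<Gamma> 0) * exp (- (LBINT s=0..t. differential C h (\<gamma> s) (R (\<gamma> s))))"
proof -
  let ?I = "{-\<epsilon><..<\<epsilon>}"
  define g where "g s = differential C h (\<gamma> s) (R (\<gamma> s))" for s
  \<comment> \<open>\<open>- ln \<bar>F\<bar>\<close> is an antiderivative of the integrand; the square under \<open>ln\<close>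
      covers both signs of \<open>F\<close>, and \<open>F exp A\<close> is constant\<close>
  define A where "A s = - ln (F (\<Gamma> s) * F (\<Gamma> s)) / 2" for s
  have F0: "F (\<Gamma> s) \<noteq> 0" if "s \<in> ?I" for s using \<Gamma>_pts[OF that] by simp
  have F': "((\<lambda>t. F (\<Gamma> t)) has_real_derivative - F (\<Gamma> s) * g s) (at s)" if "s \<in> ?I" for s
    using F_along_\<Gamma>[OF that] by (simp add: g_def)
  have A': "(A has_real_derivative g s) (at s)" if s: "s \<in> ?I" for s
  proof -
    have "F (\<Gamma> s) * F (\<Gamma> s) > 0" using F0[OF s] not_real_square_gt_zero by blast
    then show ?thesis
      unfolding A_def using F0[OF s] by (auto intro!: derivative_eq_intros F'[OF s])
  qed
  have "((\<lambda>s. F (\<Gamma> s) * exp (A s)) has_real_derivative 0) (at s)" if s: "s \<in> ?I" for s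
    by (auto intro!: derivative_eq_intros F'[OF s] A'[OF s])
  then have "F (\<Gamma> t) * exp (A t) = F (\<Gamma> 0) * exp (A 0)"
    using t \<epsilon> by (intro DERIV_isconst3[of "-\<epsilon>" \<epsilon>]) auto
  then have "F (\<Gamma> t) = F (\<Gamma> 0) * exp (- (A t - A 0))"
    by (simp add: exp_diff field_simps)
  moreover have "(LBINT s=0..t. g s) = A t - A 0"
  proof -
    have sub: "{min 0 t..max 0 t} \<subseteq> ?I" using t \<epsilon> by auto
    have "(LBINT s=ereal 0..ereal t. g s) = A t - A 0"
    proof (rule interval_integral_FTC_finite)
      show "continuous_on {min 0 t..max 0 t} g"
        unfolding g_def by (rule continuous_on_subset[OF Reeb_derivative_continuous sub])
      show "(A has_vector_derivative g s) (at s within {min 0 t..max 0 t})"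
        if "min 0 t \<le> s" "s \<le> max 0 t" for s
      proof -
        have "s \<in> ?I" using sub that by auto
        from A'[OF this] show ?thesis
          by (simp add: has_real_derivative_iff_has_vector_derivative has_vector_derivative_at_within)
      qed
    qed
    then show ?thesis by (simp add: zero_ereal_def)
  qed
  ultimately show ?thesis
    by (simp only: g_def)
qed

end

end

theorem mainTheorem8:
  fixes G :: "real set"
    and S :: "('a, 'e::euclidean_space) mfd"
    and \<omega> :: "('a, 'e) form2"
    and H F :: "'a \<Rightarrow> real"
    and \<phi> :: "real \<Rightarrow> 'a \<Rightarrow> 'a"
    and C :: "('a set, 'f::euclidean_space) mfd"
    and \<eta> :: "('a set, 'f) form1"
    and R Y :: "'a set \<Rightarrow> ('a set, 'f) tvec"
    and X :: "'a \<Rightarrow> ('a, 'e) tvec"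
    and h :: "'a set \<Rightarrow> real"
    and x0 :: 'a and s0 \<epsilon> :: real
    and \<Gamma> :: "real \<Rightarrow> 'a" and \<gamma> :: "real \<Rightarrow> 'a set"
  assumes "scaling_group G"
    and "symplectic_Hamiltonian_system S \<omega> H"
    and "scaling_symmetry G S \<omega> H \<phi>"
    and "scaling_function G S \<phi> F"
    and "quotient_manifold G S \<phi> C"
    and "induced_contact_form G S \<omega> \<phi> F C \<eta>"
    and "Reeb_vector_field C \<eta> R"
    and "smooth_fun C h" and "\<forall>x\<in>pts S. h (quot_map G \<phi> x) = 1 / F x * H x"
    and "Hamiltonian_vector_field S \<omega> H X"
    and "vector_field C Y" and "projects_to S C (quot_map G \<phi>) X Y"
    and "x0 \<in> pts S" and "s0 = F x0" and "\<epsilon> > 0"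
    and "integral_curve S X {-\<epsilon><..<\<epsilon>} \<Gamma>" and "\<Gamma> 0 = x0"
    and "integral_curve C Y {-\<epsilon><..<\<epsilon>} \<gamma>" and "\<gamma> 0 = quot_map G \<phi> x0"
  shows "diffeomorphism S (prod_mfd (open_mfd G) C) (\<lambda>x. (F x, quot_map G \<phi> x)) \<and>
         (\<forall>t\<in>{-\<epsilon><..<\<epsilon>}. (F (\<Gamma> t), quot_map G \<phi> (\<Gamma> t)) =
            (s0 * exp (- (LBINT s=0..t. differential C h (\<gamma> s) (R (\<gamma> s)))), \<gamma> t))"
proof -
  interpret reduced_Hamiltonian_system G S \<phi> F C \<omega> H \<eta> R Y X h
    using assms
    by unfold_locales (auto simp: symplectic_Hamiltonian_system_def scaling_symmetry_def)
  have start: "\<gamma> 0 = quot_map G \<phi> (\<Gamma> 0)" using assms by simp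
  show ?thesis
    using trivialisation projected_curve[OF \<open>\<epsilon> > 0\<close> assms(16,18) start]
      F_along_\<Gamma>_eq[OF \<open>\<epsilon> > 0\<close> assms(16,18) start] assms(14,17)
    by auto
qed

end
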